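(* Let $X$ be a Banach space, let $\omega\in\mathbb{R}$, let $A$ be an operator of half-plane type $\omega$ on $X$, and let $m\geq1$ be an integer. The following assertions are equivalent: (i) $A$ has property $(W\gamma\text{-}GFS)_{m,\omega}$; (ii) $A$ has a strong $W\gamma$-$1$-bounded functional calculus of type $\omega$; (iii) $A$ has a strong $W\gamma$-$m$-bounded functional calculus of type $\omega$. Moreover, if $A$ satisfies these conditions, then $-A$ generates a $C_0$-semigroup of $W\gamma$-type $\omega$.
   Context: All Banach spaces are complex. $R(\lambda,A)=(\lambda I-A)^{-1}$ for $\lambda\in\rho(A)$. Half-plane type. For $\alpha\in\mathbb{R}$, $R_\alpha=\{z\in\mathbb{C}:\mathrm{Re}(z)>\alpha\}$. A closed densely defined operator $A$ on $X$ is of half-plane type $\omega$ if $\sigma(A)\subset\overline{R_\omega}$ and $\sup\{\|R(z,A)\|:\mathrm{Re}(z)\leq\alpha\}<\infty$ for every $\alpha<\omega$. Functional calculus. $H^\infty(R_\alpha)$ is the space of bounded analytic functions on $R_\alpha$ with the sup norm; $\mathcal{E}(R_\alpha)$ is the set of $f\in H^\infty(R_\alpha)$ such that $f(z)=O(|z|^{-(1+s)})$ as $|z|\to\infty$ for some $s>0$. Let $\alpha<\omega$. For $f\in\mathcal{E}(R_\alpha)$, $f(A):=-\frac{1}{2\pi}\int_{-\infty}^{\infty}f(\delta+it)R(\delta+it,A)\,dt\in\mathcal{L}(X)$, independent of $\delta\in(\alpha,\omega)$. For $f\in H^\infty(R_\alpha)$, pick $\mu<\alpha$ and $e(z)=(\mu-z)^{-2}$;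 then $e(A)=R(\mu,A)^2$ is injective and $f(A):=e(A)^{-1}(ef)(A)$ with its natural domain (a closed operator, independent of $\mu$). If $f\in H^\infty(R_\alpha)$ then $f^{(m)}\in H^\infty(R_\beta)$ for all $\beta\in(\alpha,\omega)$, so $f^{(m)}(A)$ is defined. $A$ has a strong $m$-bounded functional calculus of type $\omega$ if there is $C>0$ such that for all $\alpha<\omega$ and $f\in H^\infty(R_\alpha)$, $f^{(m)}(A)\in\mathcal{L}(X)$ and $\|f^{(m)}(A)\|\leq\frac{C}{(\omega-\alpha)^m}\|f\|_{H^\infty(R_\alpha)}$. $A$ has a strong $W\gamma$-$m$-bounded functional calculus of type $\omega$ if it has a strong $m$-bounded functional calculus of type $\omega$ and the set $\bigcup_{\alpha<\omega}\{(\omega-\alpha)^mf^{(m)}(A): f\in H^\infty(R_\alpha),\ \|f\|_{H^\infty(R_\alpha)}\leq 1\}$ is $W\gamma$-bounded. Gaussian sums. $(\gamma_n)_{n\geq1}$ is a sequence of independent complex standard Gaussian variables on a probability space $\Sigma$; $G(X)$ is the closure of $\{\sum_{k=1}^n\gamma_k\otimes x_k: x_k\in X,\ n\in\mathbb{N}\}$ in $L^2(\Sigma,X)$, with the induced norm. A set $\mathcal{T}\subset\mathcal{L}(X)$ is $W\gamma$-bounded (weak $\gamma$-bounded) if there is $C$ such that $\sum_{n=1}^N|\langle T_nx_n,y_n^*\rangle|\leq C\|\sum_{n=1}^N\gamma_n\otimes x_n\|_{G(X)}\|\sum_{n=1}^N\gamma_n\otimes y_n^*\|_{G(X^* )}$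 for all finite sequences $(T_n)\subset\mathcal{T}$, $(x_n)\subset X$, $(y_n^* )\subset X^*$. A $C_0$-semigroup $(T_t)_{t\geq0}$ is of $W\gamma$-type $\omega$ if $\{e^{\omega t}T_t:t\geq0\}$ is $W\gamma$-bounded. $A$ has property $(W\gamma\text{-}GFS)_{m,\omega}$ if there is $C>0$ such that for all $N\in\mathbb{N}$, $\alpha_1,\ldots,\alpha_N<\omega$, $x_1,\ldots,x_N\in X$ and $y_1,\ldots,y_N\in X^*$, $$\sum_{k=1}^N\int_{\mathbb{R}}|\langle(\omega-\alpha_k)^mR(\alpha_k+it,A)^{m+1}x_k,y_k\rangle|\,dt\leq C\Big\|\sum_{k=1}^N\gamma_k\otimes x_k\Big\|_{G(X)}\Big\|\sum_{k=1}^N\gamma_k\otimes y_k\Big\|_{G(X^* )}.$$ *)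

theory Defs
  imports "HOL-Probability.Probability" "HOL-Complex_Analysis.Complex_Analysis"
begin

section \<open>Complex Banach spaces\<close>

text \<open>The libraries only provide real normed spaces; the class adds a compatible complex scalar
  multiplication to a real Banach space.\<close>

class complex_banach = banach +
  fixes scaleC :: "complex \<Rightarrow> 'a \<Rightarrow> 'a" (infixr "*\<^sub>C" 75)
  assumes scaleC_add_right: "c *\<^sub>C (x + y) = c *\<^sub>C x + c *\<^sub>C y"
    and scaleC_add_left: "(c + d) *\<^sub>C x = c *\<^sub>C x + d *\<^sub>C x"
    and scaleC_scaleC: "c *\<^sub>C d *\<^sub>C x = (c * d) *\<^sub>C x"
    and scaleC_of_real: "complex_of_real r *\<^sub>C x = r *\<^sub>R x"
    and norm_scaleC: "norm (c *\<^sub>C x) = cmod c * norm x"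

instantiation complex :: complex_banach
begin

definition scaleC_complex :: "complex \<Rightarrow> complex \<Rightarrow> complex"
  where "scaleC_complex c z = c * z"

instance
  by standard (simp_all add: scaleC_complex_def algebra_simps norm_mult scaleR_conv_of_real)

end

lemma bounded_linear_scaleC: "bounded_linear (\<lambda>x::'a::complex_banach. c *\<^sub>C x)"
proof (rule bounded_linear_intro)
  fix x y :: 'a and r :: real
  show "c *\<^sub>C (x + y) = c *\<^sub>C x + c *\<^sub>C y"
    by (rule scaleC_add_right)
  show "c *\<^sub>C (r *\<^sub>R x) = r *\<^sub>R (c *\<^sub>C x)"
    by (simp add: scaleC_of_real[symmetric] scaleC_scaleC mult.commute)
  show "norm (c *\<^sub>C x) \<le> norm x * cmod c"
    by (simp add: norm_scaleC mult.commute)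
qed

text \<open>The real-linear bounded operators into a complex Banach space form a complex Banach space
  under pointwise operations.  The bounded complex-linear operators are a closed complex subspace
  of it, and carry the same operator norm.\<close>

instantiation blinfun :: (real_normed_vector, complex_banach) complex_banach
begin

definition scaleC_blinfun :: "complex \<Rightarrow> ('a \<Rightarrow>\<^sub>L 'b) \<Rightarrow> ('a \<Rightarrow>\<^sub>L 'b)"
  where "scaleC_blinfun c T = Blinfun (\<lambda>x. c *\<^sub>C blinfun_apply T x)"

lemma scaleC_blinfun_apply: "blinfun_apply (c *\<^sub>C T) x = c *\<^sub>C blinfun_apply T x"
  for T :: "'a \<Rightarrow>\<^sub>L 'b"
  unfolding scaleC_blinfun_def
  by (subst bounded_linear_Blinfun_apply)
    (auto intro: bounded_linear_compose[OF bounded_linear_scaleC] blinfun.bounded_linear_right)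

instance
proof
  fix c d :: complex and r :: real and S T :: "'a \<Rightarrow>\<^sub>L 'b"
  have le: "norm (a *\<^sub>C U) \<le> cmod a * norm U" for a and U :: "'a \<Rightarrow>\<^sub>L 'b"
    by (rule norm_blinfun_bound)
      (auto simp: scaleC_blinfun_apply norm_scaleC mult.assoc intro!: mult_left_mono norm_blinfun)
  show "c *\<^sub>C (S + T) = c *\<^sub>C S + c *\<^sub>C T"
    by (rule blinfun_eqI) (simp add: scaleC_blinfun_apply blinfun.add_left scaleC_add_right)
  show "(c + d) *\<^sub>C T = c *\<^sub>C T + d *\<^sub>C T"
    by (rule blinfun_eqI) (simp add: scaleC_blinfun_apply blinfun.add_left scaleC_add_left)
  show comp: "c *\<^sub>C d *\<^sub>C T = (c * d) *\<^sub>C T" for c d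
    by (rule blinfun_eqI) (simp add: scaleC_blinfun_apply scaleC_scaleC)
  show real: "complex_of_real r *\<^sub>C T = r *\<^sub>R T" for r
    by (rule blinfun_eqI) (simp add: scaleC_blinfun_apply blinfun.scaleR_left scaleC_of_real)
  show "norm (c *\<^sub>C T) = cmod c * norm T"
  proof (cases "c = 0")
    case True
    then show ?thesis using real[of 0] by simp
  next
    case False
    have "norm T = norm (inverse c *\<^sub>C c *\<^sub>C T)"
      using False real[of 1] by (simp add: comp)
    also have "\<dots> \<le> inverse (cmod c) * norm (c *\<^sub>C T)"
      using le[of "inverse c" "c *\<^sub>C T"] by (simp add: norm_inverse)
    finally have "cmod c * norm T \<le> norm (c *\<^sub>C T)"
      using False by (simp add: field_simps)
    with le show ?thesis by (metis antisym)
  qed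
qed

end

text \<open>The space \<open>\<L>(X, Y)\<close>; in particular \<open>X\<^sup>*\<close> for \<open>Y = \<complex>\<close>.\<close>

definition bounded_clinear :: "('a::complex_banach \<Rightarrow>\<^sub>L 'b::complex_banach) set"
  where "bounded_clinear = {T. \<forall>c x. blinfun_apply T (c *\<^sub>C x) = c *\<^sub>C blinfun_apply T x}"


section \<open>Unbounded operators\<close>

text \<open>A possibly unbounded operator \<open>A\<close> on \<open>X\<close> is represented by its graph:
  \<open>(x, y) \<in> A\<close> means that \<open>x\<close> is in the domain of \<open>A\<close> and \<open>A x = y\<close>.\<close>

definition linear_operator :: "('a::complex_banach \<times> 'a) set \<Rightarrow> bool"
  where "linear_operator A \<longleftrightarrow> single_valued A \<and> (0, 0) \<in> A \<and>
    (\<forall>x y u v. (x, y) \<in> A \<and> (u, v) \<in> A \<longrightarrow> (x + u, y + v) \<in> A) \<and>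
    (\<forall>c x y. (x, y) \<in> A \<longrightarrow> (c *\<^sub>C x, c *\<^sub>C y) \<in> A)"

definition graph_of :: "('a::complex_banach \<Rightarrow>\<^sub>L 'a) \<Rightarrow> ('a \<times> 'a) set"
  where "graph_of T = {(x, blinfun_apply T x) | x. True}"

text \<open>\<open>R\<close> is the everywhere defined bounded inverse of \<open>z I - A\<close>.\<close>

definition is_resolvent ::
    "('a::complex_banach \<times> 'a) set \<Rightarrow> complex \<Rightarrow> ('a \<Rightarrow>\<^sub>L 'a) \<Rightarrow> bool"
  where "is_resolvent A z R \<longleftrightarrow>
    R \<in> bounded_clinear \<and> {(z *\<^sub>C x - y, x) | x y. (x, y) \<in> A} = graph_of R"

definition resolvent_set :: "('a::complex_banach \<times> 'a) set \<Rightarrow> complex set"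
  where "resolvent_set A = {z. \<exists>R. is_resolvent A z R}"

definition op_spectrum :: "('a::complex_banach \<times> 'a) set \<Rightarrow> complex set"
  where "op_spectrum A = - resolvent_set A"

definition resolvent :: "('a::complex_banach \<times> 'a) set \<Rightarrow> complex \<Rightarrow> ('a \<Rightarrow>\<^sub>L 'a)"
  where "resolvent A z = (THE R. is_resolvent A z R)"

definition half_plane :: "real \<Rightarrow> complex set"
  where "half_plane \<alpha> = {z. Re z > \<alpha>}"

definition half_plane_type :: "real \<Rightarrow> ('a::complex_banach \<times> 'a) set \<Rightarrow> bool"
  where "half_plane_type \<omega> A \<longleftrightarrow>
    linear_operator A \<and> closed A \<and> closure (Domain A) = UNIV \<and>
    op_spectrum A \<subseteq> closure (half_plane \<omega>) \<and>
    (\<forall>\<alpha><\<omega>. bdd_above ((\<lambda>z. norm (resolvent A z)) ` {z. Re z \<le> \<alpha>}))"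


section \<open>Functional calculus on half-planes\<close>

text \<open>Elements of \<open>H\<^sup>\<infinity>\<close> are represented by total functions; only their values on the half-plane
  matter.\<close>

definition Hinf :: "real \<Rightarrow> (complex \<Rightarrow> complex) set"
  where "Hinf \<alpha> = {f. f holomorphic_on half_plane \<alpha> \<and> bounded (f ` half_plane \<alpha>)}"

definition Hinf_norm :: "real \<Rightarrow> (complex \<Rightarrow> complex) \<Rightarrow> real"
  where "Hinf_norm \<alpha> f = (SUP z\<in>half_plane \<alpha>. cmod (f z))"

text \<open>\<open>f(A)\<close> for \<open>f\<close> in \<open>Hinf \<alpha>\<close>, \<open>\<alpha> < \<omega>\<close>, decaying like \<open>|z| powr -(1 + s)\<close>, \<open>s > 0\<close>.  The integral
  does not depend on the abscissa \<open>\<delta> \<in> (\<alpha>, \<omega>)\<close>; the midpoint is used.  It is the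
  Henstock-Kurzweil integral because the library's Bochner integral requires a separable range
  type; for these continuous, absolutely integrable integrands the two coincide.\<close>

definition elem_calc ::
    "real \<Rightarrow> ('a::complex_banach \<times> 'a) set \<Rightarrow> real \<Rightarrow> (complex \<Rightarrow> complex) \<Rightarrow> ('a \<Rightarrow>\<^sub>L 'a)"
  where "elem_calc \<omega> A \<alpha> f = (let \<delta> = (\<alpha> + \<omega>) / 2 in
    - (1 / (2 * pi)) *\<^sub>R
      integral UNIV (\<lambda>t::real. f (Complex \<delta> t) *\<^sub>C resolvent A (Complex \<delta> t)))"

text \<open>For \<open>f\<close> in \<open>Hinf \<alpha>\<close>, the operator \<open>f(A) = e(A)\<^sup>-\<^sup>1 (e f)(A)\<close> with its natural domain, where
  \<open>e z = (\<mu> - z)\<^sup>-\<^sup>2\<close>.  It does not depend on \<open>\<mu> < \<alpha>\<close>; the value \<open>\<alpha> - 1\<close> is used.\<close>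

definition Hinf_calc ::
    "real \<Rightarrow> ('a::complex_banach \<times> 'a) set \<Rightarrow> real \<Rightarrow> (complex \<Rightarrow> complex) \<Rightarrow> ('a \<times> 'a) set"
  where "Hinf_calc \<omega> A \<alpha> f =
    (let e = (\<lambda>z. 1 / (complex_of_real (\<alpha> - 1) - z)\<^sup>2) in
      {(x, y). blinfun_apply (elem_calc \<omega> A \<alpha> e) y
             = blinfun_apply (elem_calc \<omega> A \<alpha> (\<lambda>z. e z * f z)) x})"

text \<open>For \<open>f\<close> in \<open>Hinf \<alpha>\<close> the \<open>m\<close>-th derivative is in \<open>Hinf \<beta>\<close> only for \<open>\<beta> > \<alpha>\<close>; the operator
  does not depend on \<open>\<beta> \<in> (\<alpha>, \<omega>)\<close>, and the midpoint is used.\<close>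

definition deriv_calc :: "real \<Rightarrow> ('a::complex_banach \<times> 'a) set \<Rightarrow> real \<Rightarrow> nat \<Rightarrow>
    (complex \<Rightarrow> complex) \<Rightarrow> ('a \<times> 'a) set"
  where "deriv_calc \<omega> A \<alpha> m f = Hinf_calc \<omega> A ((\<alpha> + \<omega>) / 2) ((deriv ^^ m) f)"

definition strong_bounded_calculus ::
    "nat \<Rightarrow> real \<Rightarrow> ('a::complex_banach \<times> 'a) set \<Rightarrow> bool"
  where "strong_bounded_calculus m \<omega> A \<longleftrightarrow>
    (\<exists>C>0. \<forall>\<alpha><\<omega>. \<forall>f\<in>Hinf \<alpha>. \<exists>S\<in>bounded_clinear. deriv_calc \<omega> A \<alpha> m f = graph_of S \<and>
      norm S \<le> C / (\<omega> - \<alpha>) ^ m * Hinf_norm \<alpha> f)"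


section \<open>Gaussian sums\<close>

text \<open>A standard complex Gaussian has density \<open>exp (- |z|\<^sup>2) / \<pi>\<close>, so that its second absolute
  moment is \<open>1\<close>.\<close>

definition complex_gaussian_sequence :: "'s measure \<Rightarrow> (nat \<Rightarrow> 's \<Rightarrow> complex) \<Rightarrow> bool"
  where "complex_gaussian_sequence M \<gamma> \<longleftrightarrow> prob_space M \<and>
    prob_space.indep_vars M (\<lambda>_. borel) \<gamma> UNIV \<and>
    (\<forall>n. distributed M lborel (\<gamma> n) (\<lambda>z. ennreal (exp (- (cmod z)\<^sup>2) / pi)))"

text \<open>The norm of \<open>\<Sum>k<N. \<gamma>\<^sub>k \<otimes> x\<^sub>k\<close> in \<open>G(X)\<close>, that is, in \<open>L\<^sup>2(M, X)\<close>.\<close>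

definition gauss_norm ::
    "'s measure \<Rightarrow> (nat \<Rightarrow> 's \<Rightarrow> complex) \<Rightarrow> nat \<Rightarrow> (nat \<Rightarrow> 'a::complex_banach) \<Rightarrow> real"
  where "gauss_norm M \<gamma> N x = sqrt (\<integral>s. (norm (\<Sum>k<N. \<gamma> k s *\<^sub>C x k))\<^sup>2 \<partial>M)"

definition Wgamma_bounded :: "'s measure \<Rightarrow> (nat \<Rightarrow> 's \<Rightarrow> complex) \<Rightarrow>
    ('a::complex_banach \<Rightarrow>\<^sub>L 'a) set \<Rightarrow> bool"
  where "Wgamma_bounded M \<gamma> \<T> \<longleftrightarrow>
    (\<exists>C. \<forall>(N::nat) T (x::nat \<Rightarrow> 'a) (y::nat \<Rightarrow> 'a \<Rightarrow>\<^sub>L complex).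
      (\<forall>n<N. T n \<in> \<T>) \<and> (\<forall>n<N. y n \<in> bounded_clinear) \<longrightarrow>
      (\<Sum>n<N. cmod (blinfun_apply (y n) (blinfun_apply (T n) (x n))))
        \<le> C * gauss_norm M \<gamma> N x * gauss_norm M \<gamma> N y)"

definition strong_Wgamma_bounded_calculus :: "'s measure \<Rightarrow> (nat \<Rightarrow> 's \<Rightarrow> complex) \<Rightarrow>
    nat \<Rightarrow> real \<Rightarrow> ('a::complex_banach \<times> 'a) set \<Rightarrow> bool"
  where "strong_Wgamma_bounded_calculus M \<gamma> m \<omega> A \<longleftrightarrow>
    strong_bounded_calculus m \<omega> A \<and>
    Wgamma_bounded M \<gamma> (\<Union>\<alpha>\<in>{..<\<omega>}. {(\<omega> - \<alpha>) ^ m *\<^sub>R S | S f.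
      f \<in> Hinf \<alpha> \<and> Hinf_norm \<alpha> f \<le> 1 \<and> S \<in> bounded_clinear \<and>
      deriv_calc \<omega> A \<alpha> m f = graph_of S})"

text \<open>The integrals are taken in \<open>[0, \<infinity>]\<close>, so the inequality includes their finiteness.\<close>

definition Wgamma_GFS :: "'s measure \<Rightarrow> (nat \<Rightarrow> 's \<Rightarrow> complex) \<Rightarrow>
    nat \<Rightarrow> real \<Rightarrow> ('a::complex_banach \<times> 'a) set \<Rightarrow> bool"
  where "Wgamma_GFS M \<gamma> m \<omega> A \<longleftrightarrow>
    (\<exists>C>0. \<forall>(N::nat) (\<alpha>::nat \<Rightarrow> real) (x::nat \<Rightarrow> 'a) (y::nat \<Rightarrow> 'a \<Rightarrow>\<^sub>L complex).
      (\<forall>k<N. \<alpha> k < \<omega>) \<and> (\<forall>k<N. y k \<in> bounded_clinear) \<longrightarrow>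
      (\<Sum>k<N. \<integral>\<^sup>+t. ennreal (cmod (blinfun_apply (y k)
          ((\<omega> - \<alpha> k) ^ m *\<^sub>R (blinfun_apply (resolvent A (Complex (\<alpha> k) t)) ^^ (m + 1)) (x k))))
        \<partial>lborel)
        \<le> ennreal (C * gauss_norm M \<gamma> N x * gauss_norm M \<gamma> N y))"


section \<open>Semigroups\<close>

definition C0_semigroup :: "(real \<Rightarrow> 'a::complex_banach \<Rightarrow>\<^sub>L 'a) \<Rightarrow> bool"
  where "C0_semigroup T \<longleftrightarrow>
    (\<forall>t\<ge>0. T t \<in> bounded_clinear) \<and> T 0 = id_blinfun \<and>
    (\<forall>s\<ge>0. \<forall>t\<ge>0. T (s + t) = T s o\<^sub>L T t) \<and>
    (\<forall>x. ((\<lambda>t. blinfun_apply (T t) x) \<longlongrightarrow> x) (at_right 0))"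

definition generator :: "(real \<Rightarrow> 'a::complex_banach \<Rightarrow>\<^sub>L 'a) \<Rightarrow> ('a \<times> 'a) set"
  where "generator T =
    {(x, y). ((\<lambda>t. (1 / t) *\<^sub>R (blinfun_apply (T t) x - x)) \<longlongrightarrow> y) (at_right 0)}"

definition neg_op :: "('a::complex_banach \<times> 'a) set \<Rightarrow> ('a \<times> 'a) set"
  where "neg_op A = {(x, - y) | x y. (x, y) \<in> A}"

definition of_Wgamma_type :: "'s measure \<Rightarrow> (nat \<Rightarrow> 's \<Rightarrow> complex) \<Rightarrow>
    real \<Rightarrow> (real \<Rightarrow> 'a::complex_banach \<Rightarrow>\<^sub>L 'a) \<Rightarrow> bool"
  where "of_Wgamma_type M \<gamma> \<omega> T \<longleftrightarrow> Wgamma_bounded M \<gamma> {exp (\<omega> * t) *\<^sub>R T t | t. t \<ge> 0}"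

end

theory Submission
  imports Defs "HOL-Real_Asymp.Real_Asymp"
begin

text \<open>
  Write \<open>R(z)\<close> for the resolvent of \<open>A\<close> and \<open>\<langle>x, y\<rangle>\<close> for the pairing of \<open>X\<close> and \<open>X\<^sup>*\<close>.  The conditions are
  compared through a cycle of implications, for every \<open>m \<ge> 1\<close>: property \<open>(W\<gamma>-GFS)\<close> of order \<open>m\<close> implies the strong
  \<open>W\<gamma>\<close>-bounded calculus of order \<open>m\<close>, this implies \<open>(W\<gamma>-GFS)\<close> of order \<open>m + 1\<close>, and this implies \<open>(W\<gamma>-GFS)\<close> of
  order \<open>m\<close>.  Hence all these properties are equivalent, for all \<open>m \<ge> 1\<close> at once.

  From the integral condition to the calculus.  Integrating by parts \<open>m\<close> times along a vertical line \<open>Re z = \<delta>\<close> moves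
  the derivatives from \<open>f\<close> to the resolvent, whose \<open>m\<close>-th derivative is \<open>\<plusminus> m! R(z)\<^bsup>m+1\<^esup>\<close>; so \<open>\<langle>f\<^sup>(\<^sup>m\<^sup>)(A) x, y\<rangle>\<close>
  is, up to the factor \<open>- m! / (2 \<pi>)\<close>, the integral of \<open>f(z) \<langle>R(z)\<^bsup>m+1\<^esup> x, y\<rangle>\<close> over the line.  As \<open>f\<close> is bounded, the
  integral condition controls it.  This is \<open>regularized_by_parts\<close>; the operator itself, which the calculus only defines
  as an unbounded one, is constructed from the bilinear form in \<open>weak_calculus_operator\<close>.

  From the calculus to the integral condition.  Put \<open>d = (\<omega> - \<alpha>) / 2\<close>.  For a grid of points \<open>\<zeta>\<^sub>j\<close> of mesh \<open>d\<close> on the line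
  \<open>Re z = \<alpha>\<close> and numbers \<open>|\<epsilon>\<^sub>j| \<le> 1\<close>, the function \<open>H(z) = \<Sum> \<epsilon>\<^sub>j / (\<zeta>\<^sub>j - z)\<^sup>2\<close> is bounded by \<open>3 \<pi> / d\<^sup>2\<close> for \<open>Re z > \<alpha> + d\<close>,
  however many points there are, and \<open>H\<^sup>(\<^sup>m\<^sup>)(A) = (m + 1)! \<Sum> \<epsilon>\<^sub>j R(\<zeta>\<^sub>j)\<^bsup>m+2\<^esup>\<close>.  Suitable \<open>\<epsilon>\<^sub>j\<close> turn the pairing into the
  sum of the \<open>|\<langle>R(\<zeta>\<^sub>j)\<^bsup>m+2\<^esup> x, y\<rangle>|\<close>, and the mean of these sums over all translates of the grid is the integral over the line
  (\<open>strong_imp_Wgamma_GFS_Suc\<close>).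

  Lowering the order.  \<open>R(z)\<^bsup>m+1\<^esup>\<close> is a primitive of \<open>- (m + 1) R(z)\<^bsup>m+2\<^esup>\<close> that vanishes strongly for \<open>Re z \<rightarrow> - \<infinity>\<close>, so it is an
  integral over a horizontal half-line.  If the positions on the half-lines are measured in units of \<open>\<omega> - \<alpha>\<^sub>k\<close>, the
  condition of order \<open>m + 1\<close> can be applied for each position to all terms together, with a gain of \<open>(1 + \<sigma>)\<^bsup>-(m+1)\<^esup>\<close>,
  which is integrable as \<open>m \<ge> 1\<close> (\<open>Wgamma_GFS_Suc_imp\<close>).

  The semigroup.  The derivative of \<open>f(z) = exp (- t z)\<close> is \<open>- t f(z)\<close>, so the calculus of order \<open>1\<close> on \<open>Re z > \<omega> - 1/t\<close>
  yields bounded operators \<open>T\<^sub>t\<close> such that \<open>exp (\<omega> t) T\<^sub>t\<close> is a multiple, with factor independent of \<open>t\<close>, of a member of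
  the \<open>W\<gamma>\<close>-bounded family.  On the range of \<open>R(\<mu>)\<^sup>4\<close> they have second-order Taylor expansions in \<open>t\<close>, with a remainder
  that is uniform for bounded times, by estimates under the integral; the semigroup law, strong continuity and
  the generator follow from these expansions, density and injectivity.

  Everything is done weakly.  Operators given by integrals are identified through their pairings with functionals, which
  separate points and compute norms by the Hahn--Banach theorem, so that only scalar holomorphic functions on vertical
  lines have to be integrated.
\<close>

section \<open>Norming functionals on complex Banach spaces\<close>

definition sublinear :: "('a::real_vector \<Rightarrow> real) \<Rightarrow> bool"
  where "sublinear p \<longleftrightarrow> (\<forall>x y. p (x + y) \<le> p x + p y) \<and> (\<forall>c\<ge>0. \<forall>x. p (c *\<^sub>R x) = c * p x)"

lemma sublinearD:
  assumes "sublinear p"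
  shows "p (x + y) \<le> p x + p y" "c \<ge> 0 \<Longrightarrow> p (c *\<^sub>R x) = c * p x" "p 0 = 0" "0 \<le> p x + p (- x)"
proof -
  show *: "p (x + y) \<le> p x + p y" "c \<ge> 0 \<Longrightarrow> p (c *\<^sub>R x) = c * p x" for x y c
    using assms by (auto simp: sublinear_def)
  show "p 0 = 0" using *(2)[of 0 0] by simp
  then show "0 \<le> p x + p (- x)" using *(1)[of x "- x"] by simp
qed

text \<open>With \<open>t = 0\<close> and \<open>t = 1\<close> in the infimum, the push of \<open>p\<close> in the direction \<open>v\<close> stays below \<open>p\<close> and
  drops to at most \<open>- p v\<close> at \<open>- v\<close>, so it is closer to being additive along \<open>v\<close>.\<close>

definition sublinear_push :: "('a::real_vector \<Rightarrow> real) \<Rightarrow> 'a \<Rightarrow> 'a \<Rightarrow> real"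
  where "sublinear_push p v x = (INF t\<in>{0..}. p (x + t *\<^sub>R v) - t * p v)"

lemma sublinear_push:
  fixes v :: "'a::real_vector"
  assumes p: "sublinear p"
  shows "sublinear (sublinear_push p v)"
    and "t \<ge> 0 \<Longrightarrow> sublinear_push p v x \<le> p (x + t *\<^sub>R v) - t * p v"
proof -
  have low: "- p (- x) \<le> p (x + t *\<^sub>R v) - t * p v" if "t \<ge> 0" for x t
    using sublinearD(1)[OF p, of "x + t *\<^sub>R v" "- x"] sublinearD(2)[OF p that, of v] by simp
  have bdd: "bdd_below ((\<lambda>t. p (x + t *\<^sub>R v) - t * p v) ` {0..})" for x
    using low by (intro bdd_belowI2) auto
  show le: "sublinear_push p v x \<le> p (x + t *\<^sub>R v) - t * p v" if "t \<ge> 0" for x t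
    unfolding sublinear_push_def using that by (intro cINF_lower bdd) auto
  have approx: "\<exists>t\<ge>0. p (x + t *\<^sub>R v) - t * p v < sublinear_push p v x + e" if "e > 0" for x e
  proof -
    have "\<exists>i\<in>{0..}. p (x + i *\<^sub>R v) - i * p v < sublinear_push p v x + e"
      using that cINF_less_iff[OF _ bdd[of x], of "sublinear_push p v x + e"]
      by (simp add: sublinear_push_def)
    then show ?thesis by auto
  qed
  have add: "sublinear_push p v (x + y) \<le> sublinear_push p v x + sublinear_push p v y" for x y
  proof (rule field_le_epsilon)
    fix e :: real assume "e > 0"
    then obtain s t where st: "s \<ge> 0" "p (x + s *\<^sub>R v) - s * p v < sublinear_push p v x + e/2"
        "t \<ge> 0" "p (y + t *\<^sub>R v) - t * p v < sublinear_push p v y + e/2"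
      using approx[of "e/2"] by (metis half_gt_zero)
    have "sublinear_push p v (x + y) \<le> p (x + y + (s + t) *\<^sub>R v) - (s + t) * p v"
      using st by (intro le) auto
    also have "x + y + (s + t) *\<^sub>R v = (x + s *\<^sub>R v) + (y + t *\<^sub>R v)" by (simp add: algebra_simps)
    also have "p \<dots> \<le> p (x + s *\<^sub>R v) + p (y + t *\<^sub>R v)" by (rule sublinearD[OF p])
    finally show "sublinear_push p v (x + y) \<le> sublinear_push p v x + sublinear_push p v y + e"
      using st by (simp add: algebra_simps)
  qed
  have scale_le: "sublinear_push p v (c *\<^sub>R x) \<le> c * sublinear_push p v x" if c: "c > 0" for c x
  proof (rule field_le_epsilon)
    fix e :: real assume "e > 0"
    then obtain s where s: "s \<ge> 0" "p (x + s *\<^sub>R v) - s * p v < sublinear_push p v x + e/c"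
      using approx[of "e/c" x] c by auto
    have "sublinear_push p v (c *\<^sub>R x) \<le> p (c *\<^sub>R x + (c * s) *\<^sub>R v) - (c * s) * p v"
      using s c by (intro le) auto
    also have "c *\<^sub>R x + (c * s) *\<^sub>R v = c *\<^sub>R (x + s *\<^sub>R v)" by (simp add: algebra_simps)
    also have "p \<dots> = c * p (x + s *\<^sub>R v)" using c by (intro sublinearD[OF p]) auto
    also have "c * p (x + s *\<^sub>R v) - (c * s) * p v = c * (p (x + s *\<^sub>R v) - s * p v)"
      by (simp add: algebra_simps)
    also have "\<dots> \<le> c * (sublinear_push p v x + e/c)" using s c by (intro mult_left_mono) auto
    finally show "sublinear_push p v (c *\<^sub>R x) \<le> c * sublinear_push p v x + e"
      using c by (simp add: algebra_simps)
  qed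
  have zero: "sublinear_push p v 0 = 0"
  proof (rule antisym)
    show "sublinear_push p v 0 \<le> 0" using le[of 0 0] sublinearD(3)[OF p] by simp
    show "0 \<le> sublinear_push p v 0"
      unfolding sublinear_push_def using sublinearD[OF p]
      by (intro cINF_greatest) auto
  qed
  show "sublinear (sublinear_push p v)"
    unfolding sublinear_def
  proof (intro conjI allI impI add)
    fix c :: real and x assume "c \<ge> 0"
    show "sublinear_push p v (c *\<^sub>R x) = c * sublinear_push p v x"
    proof (cases "c = 0")
      case True then show ?thesis using zero by simp
    next
      case False
      with \<open>c \<ge> 0\<close> have c: "c > 0" by simp
      have "sublinear_push p v x \<le> inverse c * sublinear_push p v (c *\<^sub>R x)"
        using scale_le[of "inverse c" "c *\<^sub>R x"] c by simp
      then have "c * sublinear_push p v x \<le> sublinear_push p v (c *\<^sub>R x)"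
        using c by (simp add: field_simps)
      with scale_le[OF c] show ?thesis by (simp add: antisym)
    qed
  qed
qed

text \<open>Two members of the chain can be replaced by the smaller one, so subadditivity survives the
  pointwise infimum; this is the chain condition for Zorn's lemma.\<close>

lemma sublinear_Inf_chain:
  assumes C: "C \<noteq> {}" "\<And>p. p \<in> C \<Longrightarrow> sublinear p"
    and chain: "\<And>p q. p \<in> C \<Longrightarrow> q \<in> C \<Longrightarrow> p \<le> q \<or> q \<le> p"
    and bdd: "\<And>x. bdd_below ((\<lambda>p. p x) ` C)"
  shows "sublinear (\<lambda>x. INF p\<in>C. p x)"
  unfolding sublinear_def
proof (intro conjI allI impI)
  let ?m = "\<lambda>x. INF p\<in>C. p x"
  have approx: "\<exists>p\<in>C. p x < ?m x + e" if "e > 0" for x e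
    using that cINF_less_iff[OF C(1) bdd[of x], of "?m x + e"] by simp
  fix x y
  show "?m (x + y) \<le> ?m x + ?m y"
  proof (rule field_le_epsilon)
    fix e :: real assume "e > 0"
    then obtain p q where pq: "p \<in> C" "p x < ?m x + e/2" "q \<in> C" "q y < ?m y + e/2"
      using approx by (metis half_gt_zero)
    obtain r where r: "r \<in> C" "r \<le> p" "r \<le> q" using chain[of p q] pq by auto
    have "?m (x + y) \<le> r (x + y)" using r by (intro cINF_lower bdd) auto
    also have "\<dots> \<le> r x + r y" using C r by (intro sublinearD) auto
    also have "\<dots> \<le> p x + q y" using r by (intro add_mono) (auto simp: le_fun_def)
    finally show "?m (x + y) \<le> ?m x + ?m y + e" using pq by simp
  qed
next
  fix c :: real and x assume c: "0 \<le> c"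
  have "(INF p\<in>C. p (c *\<^sub>R x)) = (INF p\<in>C. c * p x)"
    using C c by (intro INF_cong) (auto simp: sublinearD)
  also have "\<dots> = c * (INF p\<in>C. p x)"
  proof (cases "c = 0")
    case True then show ?thesis using C by simp
  next
    case False
    with c have c: "c > 0" by simp
    obtain b where b: "\<And>p. p \<in> C \<Longrightarrow> b \<le> p x" using bdd[of x] by (auto simp: bdd_below_def)
    show ?thesis
    proof (rule antisym)
      have "(INF p\<in>C. c * p x) / c \<le> (INF p\<in>C. p x)"
      proof (rule cINF_greatest[OF C(1)])
        fix p assume "p \<in> C"
        then have "(INF p\<in>C. c * p x) \<le> c * p x"
          using b c by (intro cINF_lower bdd_belowI2[of _ "c * b"]) auto
        then show "(INF p\<in>C. c * p x) / c \<le> p x" using c by (simp add: field_simps)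
      qed
      then show "(INF p\<in>C. c * p x) \<le> c * (INF p\<in>C. p x)" using c by (simp add: field_simps)
      show "c * (INF p\<in>C. p x) \<le> (INF p\<in>C. c * p x)"
        using c by (intro cINF_greatest C mult_left_mono cINF_lower bdd) auto
    qed
  qed
  finally show "(INF p\<in>C. p (c *\<^sub>R x)) = c * (INF p\<in>C. p x)" .
qed

lemma minimal_sublinear_below:
  fixes q :: "'a::real_vector \<Rightarrow> real"
  assumes q: "sublinear q"
  shows "\<exists>p. sublinear p \<and> p \<le> q \<and> (\<forall>p'. sublinear p' \<and> p' \<le> p \<longrightarrow> p' = p)"
proof -
  define S where "S = {p. sublinear p \<and> p \<le> q}"
  let ?P = "\<lambda>p r::'a \<Rightarrow> real. r \<le> p"
  have "\<exists>m\<in>S. \<forall>a\<in>S. ?P m a \<longrightarrow> a = m"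
  proof (rule predicate_Zorn)
    show "partial_order_on S (relation_of ?P S)"
      by (auto simp: partial_order_on_def preorder_on_def refl_on_def trans_def antisym_def relation_of_def
          intro: order.trans)
    fix C assume C: "C \<in> Chains (relation_of ?P S)"
    then have CS: "p \<in> S" if "p \<in> C" for p
      using that by (auto simp: Chains_def relation_of_def)
    have chain: "p \<le> r \<or> r \<le> p" if "p \<in> C" "r \<in> C" for p r
      using that C by (auto simp: Chains_def relation_of_def)
    show "\<exists>u\<in>S. \<forall>a\<in>C. ?P a u"
    proof (cases "C = {}")
      case True
      then show ?thesis using q by (auto simp: S_def)
    next
      case False
      have bdd: "bdd_below ((\<lambda>p. p x) ` C)" for x
      proof (rule bdd_belowI2)
        fix p assume "p \<in> C"
        then have "sublinear p" "p (- x) \<le> q (- x)" using CS by (auto simp: S_def le_fun_def)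
        then show "- q (- x) \<le> p x" using sublinearD(4)[of p x] by linarith
      qed
      have "sublinear (\<lambda>x. INF p\<in>C. p x)"
        using CS chain by (intro sublinear_Inf_chain False bdd) (auto simp: S_def)
      moreover have low: "(\<lambda>x. INF p\<in>C. p x) \<le> p" if "p \<in> C" for p
        using that by (auto simp: le_fun_def intro!: cINF_lower bdd)
      moreover have "(\<lambda>x. INF p\<in>C. p x) \<le> q"
      proof -
        obtain p where "p \<in> C" using False by auto
        then show ?thesis using low[of p] CS[of p] by (auto simp: S_def)
      qed
      ultimately show ?thesis by (intro bexI[of _ "\<lambda>x. INF p\<in>C. p x"]) (auto simp: S_def)
    qed
  qed
  then show ?thesis by (auto simp: S_def intro: order.trans)
qed

text \<open>Pushing a minimal functional in any direction cannot lower it, and the inequality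
  \<open>p x \<le> p (x + v) - p v\<close> that results is the missing half of additivity.\<close>

lemma minimal_sublinear_linear:
  assumes p: "sublinear p" and min: "\<And>p'. sublinear p' \<Longrightarrow> p' \<le> p \<Longrightarrow> p' = p"
  shows "linear p"
proof -
  have push: "sublinear_push p v = p" for v
  proof (rule min[OF sublinear_push(1)[OF p]])
    show "sublinear_push p v \<le> p"
      using sublinear_push(2)[OF p, of 0 v] by (auto simp: le_fun_def)
  qed
  have add: "p (x + v) = p x + p v" for x v
    using sublinear_push(2)[OF p, of 1 v x] sublinearD(1)[OF p, of x v] by (simp add: push)
  have minus: "p (- x) = - p x" for x
    using add[of x "- x"] sublinearD(3)[OF p] by simp
  have "p (c *\<^sub>R x) = c * p x" for c x
  proof (cases "c \<ge> 0")
    case False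
    then have "p (- (- c *\<^sub>R x)) = - (- c * p x)"
      unfolding minus using sublinearD(2)[OF p, of "- c" x] by simp
    then show ?thesis by simp
  qed (rule sublinearD(2)[OF p])
  with add show ?thesis by (intro linearI) auto
qed

lemma scaleC_zero_left [simp]: "0 *\<^sub>C (x::'a::complex_banach) = 0"
  using scaleC_of_real[of 0 x] by simp

lemma scaleC_one [simp]: "1 *\<^sub>C (x::'a::complex_banach) = x"
  using scaleC_of_real[of 1 x] by simp

lemma scaleC_zero_right [simp]: "c *\<^sub>C (0::'a::complex_banach) = 0"
  using norm_scaleC[of c "0::'a"] by simp

lemma scaleC_minus_left: "(- c) *\<^sub>C (x::'a::complex_banach) = - (c *\<^sub>C x)"
  using scaleC_add_left[of c "- c" x] by (simp add: eq_neg_iff_add_eq_0 add.commute)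

lemma scaleC_minus_right: "c *\<^sub>C (- x::'a::complex_banach) = - (c *\<^sub>C x)"
  using scaleC_add_right[of c x "- x"] by (simp add: eq_neg_iff_add_eq_0 add.commute)

lemma scaleC_diff_left: "(c - d) *\<^sub>C (x::'a::complex_banach) = c *\<^sub>C x - d *\<^sub>C x"
  using scaleC_add_left[of c "- d" x] by (simp add: scaleC_minus_left)

lemma scaleC_diff_right: "c *\<^sub>C (x - y::'a::complex_banach) = c *\<^sub>C x - c *\<^sub>C y"
  using scaleC_add_right[of c x "- y"] by (simp add: scaleC_minus_right)

lemma bounded_clinear_scaleC:
  "T \<in> bounded_clinear \<Longrightarrow> blinfun_apply T (c *\<^sub>C x) = c *\<^sub>C blinfun_apply T x"
  by (simp add: bounded_clinear_def)

abbreviation dual :: "('a::complex_banach \<Rightarrow>\<^sub>L complex) set"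
  where "dual \<equiv> bounded_clinear"

lemma functional_scaleC:
  "y \<in> dual \<Longrightarrow> blinfun_apply y (c *\<^sub>C x) = c * blinfun_apply (y :: _ \<Rightarrow>\<^sub>L complex) x"
  by (simp add: bounded_clinear_def scaleC_complex_def)

lemma bounded_clinear_compose:
  "S \<in> bounded_clinear \<Longrightarrow> T \<in> bounded_clinear \<Longrightarrow> S o\<^sub>L T \<in> bounded_clinear"
  by (simp add: bounded_clinear_def)

lemma cnj_sgn_mult: "cnj (sgn z) * z = complex_of_real (cmod z)"
proof (cases "z = 0")
  case False
  have "cnj (sgn z) * z = of_real (cmod z ^ 2) / of_real (cmod z)"
    unfolding complex_norm_square by (simp add: sgn_eq mult.commute)
  then show ?thesis using False by (simp add: power2_eq_square)
qed simp

text \<open>The Hahn--Banach theorem in the form that is used below.  A minimal sublinear functional below the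
  push of the norm in the direction \<open>x\<close> is real-linear and takes the value \<open>norm x\<close> at \<open>x\<close>;
  \<open>p v - \<i> p (\<i> v)\<close> is then complex-linear, and rotating \<open>v\<close> by a phase shows that
  its norm is still at most \<open>1\<close>.\<close>

lemma norming_functional:
  fixes x :: "'a::complex_banach"
  obtains y :: "'a \<Rightarrow>\<^sub>L complex"
  where "y \<in> dual" "norm y \<le> 1" "norm x \<le> cmod (blinfun_apply y x)"
proof -
  have nrm: "sublinear (norm :: 'a \<Rightarrow> real)"
    by (auto simp: sublinear_def norm_triangle_ineq)
  obtain p where p: "sublinear p" "p \<le> sublinear_push norm x"
      and "\<And>p'. sublinear p' \<Longrightarrow> p' \<le> p \<Longrightarrow> p' = p"
    using minimal_sublinear_below[OF sublinear_push(1)[OF nrm, of x]] by blast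
  then interpret linear p by (intro minimal_sublinear_linear)
  have le: "p v \<le> norm v" for v
    using le_funD[OF p(2), of v] sublinear_push(2)[OF nrm, of 0 x v] by simp
  have low: "norm x \<le> p x"
    using p(2) sublinear_push(2)[OF nrm, of 1 x "- x"] neg[of x]
    by (auto simp: le_fun_def dest!: spec[of _ "- x"])
  define F where "F v = Complex (p v) (- p (\<i> *\<^sub>C v))" for v
  have Fi: "F (\<i> *\<^sub>C v) = \<i> * F v" for v
    by (simp add: F_def scaleC_scaleC scaleC_minus_left neg complex_eq_iff)
  have Fr: "F (r *\<^sub>R v) = of_real r * F v" for r v
  proof -
    have "\<i> *\<^sub>C r *\<^sub>R v = r *\<^sub>R \<i> *\<^sub>C v"
      by (simp add: scaleC_of_real[symmetric] scaleC_scaleC mult.commute)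
    then show ?thesis by (simp add: F_def scale complex_eq_iff)
  qed
  have Fadd: "F (v + w) = F v + F w" for v w
    by (simp add: F_def add scaleC_add_right complex_eq_iff)
  have FC: "F (c *\<^sub>C v) = c * F v" for c v
  proof -
    have "c *\<^sub>C v = Re c *\<^sub>R v + Im c *\<^sub>R \<i> *\<^sub>C v"
      unfolding scaleC_of_real[symmetric] scaleC_scaleC scaleC_add_left[symmetric]
      by (rule arg_cong[of _ _ "\<lambda>c. c *\<^sub>C v"]) (simp add: complex_eq_iff)
    then have "F (c *\<^sub>C v) = (of_real (Re c) + of_real (Im c) * \<i>) * F v"
      by (simp add: Fadd Fr Fi algebra_simps)
    also have "of_real (Re c) + of_real (Im c) * \<i> = c" by (simp add: complex_eq_iff)
    finally show ?thesis .
  qed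
  have Fle: "cmod (F v) \<le> norm v" for v
  proof (cases "F v = 0")
    case False
    define c where "c = cnj (sgn (F v))"
    have c: "cmod c = 1" using False by (simp add: c_def norm_sgn)
    have "F (c *\<^sub>C v) = of_real (cmod (F v))"
      by (simp add: FC c_def cnj_sgn_mult)
    then have "cmod (F v) = p (c *\<^sub>C v)" by (simp add: F_def complex_eq_iff)
    also have "\<dots> \<le> norm v" using le[of "c *\<^sub>C v"] by (simp add: norm_scaleC c)
    finally show ?thesis .
  qed simp
  have bl: "bounded_linear F"
    by (rule bounded_linear_intro[of _ 1]) (auto simp: Fadd Fr Fle scaleR_conv_of_real)
  show thesis
  proof (rule that[of "Blinfun F"])
    show "Blinfun F \<in> bounded_clinear"
      using bl by (simp add: bounded_clinear_def bounded_linear_Blinfun_apply FC scaleC_complex_def)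
    show "norm (Blinfun F) \<le> 1"
      using bl Fle by (intro norm_blinfun_bound) (auto simp: bounded_linear_Blinfun_apply)
    show "norm x \<le> cmod (blinfun_apply (Blinfun F) x)"
      using low abs_Re_le_cmod[of "F x"] bl by (simp add: bounded_linear_Blinfun_apply F_def)
  qed
qed

lemma norm_le_by_functionals:
  fixes x :: "'a::complex_banach"
  assumes "\<And>y :: 'a \<Rightarrow>\<^sub>L complex. y \<in> dual \<Longrightarrow> cmod (blinfun_apply y x) \<le> C * norm y"
    and "C \<ge> 0"
  shows "norm x \<le> C"
proof -
  obtain y :: "'a \<Rightarrow>\<^sub>L complex" where y: "y \<in> dual" "norm y \<le> 1" "norm x \<le> cmod (blinfun_apply y x)"
    by (rule norming_functional)
  have "norm x \<le> C * norm y" using y assms(1)[of y] by linarith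
  also have "\<dots> \<le> C * 1" using y assms(2) by (intro mult_left_mono)
  finally show ?thesis by simp
qed

lemma functionals_separate:
  fixes u v :: "'a::complex_banach"
  assumes "\<And>y :: 'a \<Rightarrow>\<^sub>L complex. y \<in> dual \<Longrightarrow> blinfun_apply y u = blinfun_apply y v"
  shows "u = v"
proof -
  have "norm (u - v) \<le> 0"
    by (rule norm_le_by_functionals) (simp_all add: assms blinfun.diff_right)
  then show ?thesis by simp
qed

text \<open>A bounded bilinear form on \<open>X \<times> X\<^sup>*\<close> comes from an operator on \<open>X\<close>, and not only from one into the
  bidual, as soon as it does so on a dense set: the vectors that represent it form a
  closed subspace, because functionals compute the norm.\<close>

lemma weak_operator:
  fixes B :: "'a::complex_banach \<Rightarrow> ('a \<Rightarrow>\<^sub>L complex) \<Rightarrow> complex"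
  assumes add: "\<And>x x' y. y \<in> dual \<Longrightarrow> B (x + x') y = B x y + B x' y"
    and scale: "\<And>c x y. y \<in> dual \<Longrightarrow> B (c *\<^sub>C x) y = c * B x y"
    and bound: "\<And>x y. y \<in> dual \<Longrightarrow> cmod (B x y) \<le> K * norm x * norm y" and K: "K \<ge> 0"
    and dense: "closure D = UNIV"
    and repr: "\<And>x. x \<in> D \<Longrightarrow> \<exists>u. \<forall>y\<in>dual. blinfun_apply y u = B x y"
  obtains S where "S \<in> bounded_clinear" "norm S \<le> K"
    "\<And>x y. y \<in> dual \<Longrightarrow> blinfun_apply y (blinfun_apply S x) = B x y"
proof -
  have diff: "B (x - x') y = B x y - B x' y" if "y \<in> dual" for x x' y
    using add[OF that, of "x - x'" x'] by simp
  have ex: "\<exists>u. \<forall>y\<in>dual. blinfun_apply y u = B x y" for x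
  proof -
    have "x \<in> closure D" using dense by simp
    then obtain X where X: "\<And>n. X n \<in> D" "X \<longlonglongrightarrow> x" unfolding closure_sequential by blast
    have "\<forall>n. \<exists>u. \<forall>y\<in>dual. blinfun_apply y u = B (X n) y"
      using repr X(1) by blast
    then obtain U where "\<forall>n. \<forall>y\<in>dual. blinfun_apply y (U n) = B (X n) y"
      by (rule choice[THEN exE])
    then have U: "\<And>n y. y \<in> dual \<Longrightarrow> blinfun_apply y (U n) = B (X n) y" by blast
    have UX: "norm (U m - U n) \<le> K * norm (X m - X n)" for m n
    proof (rule norm_le_by_functionals)
      fix y :: "'a \<Rightarrow>\<^sub>L complex" assume y: "y \<in> dual"
      have "blinfun_apply y (U m - U n) = B (X m - X n) y"
        by (simp add: blinfun.diff_right U[OF y] diff[OF y])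
      then show "cmod (blinfun_apply y (U m - U n)) \<le> K * norm (X m - X n) * norm y"
        using bound[OF y] by simp
    qed (use K in simp)
    have "Cauchy U"
    proof (rule metric_CauchyI)
      fix e :: real assume e: "e > 0"
      have "Cauchy X" using X(2) by (rule LIMSEQ_imp_Cauchy)
      then obtain N where N: "\<And>m n. m \<ge> N \<Longrightarrow> n \<ge> N \<Longrightarrow> dist (X m) (X n) < e / (K + 1)"
        using e K metric_CauchyD[of X "e / (K+1)"] by (metis add_nonneg_pos divide_pos_pos zero_less_one)
      show "\<exists>M. \<forall>m\<ge>M. \<forall>n\<ge>M. dist (U m) (U n) < e"
      proof (intro exI[of _ N] allI impI)
        fix m n assume "m \<ge> N" "n \<ge> N"
        have "dist (U m) (U n) \<le> K * dist (X m) (X n)" using UX by (simp add: dist_norm)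
        also have "\<dots> \<le> K * (e / (K + 1))" using N[OF \<open>m \<ge> N\<close> \<open>n \<ge> N\<close>] K by (intro mult_left_mono) auto
        also have "\<dots> < e" using K e by (simp add: field_simps)
        finally show "dist (U m) (U n) < e" .
      qed
    qed
    then obtain u where u: "U \<longlonglongrightarrow> u" using Cauchy_convergent_iff convergent_def by blast
    have "blinfun_apply y u = B x y" if y: "y \<in> dual" for y
    proof (rule LIMSEQ_unique)
      show "(\<lambda>n. blinfun_apply y (U n)) \<longlonglongrightarrow> blinfun_apply y u" by (intro tendsto_intros u)
      have "(\<lambda>n. B (X n) y - B x y) \<longlonglongrightarrow> 0"
      proof (rule Lim_null_comparison[OF always_eventually])
        show "\<forall>n. norm (B (X n) y - B x y) \<le> K * norm (X n - x) * norm y"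
          using bound[OF y] by (simp add: diff[OF y, symmetric])
        have "(\<lambda>n. K * norm (X n - x) * norm y) \<longlonglongrightarrow> K * norm (x - x) * norm y"
          by (intro tendsto_intros X)
        then show "(\<lambda>n. K * norm (X n - x) * norm y) \<longlonglongrightarrow> 0" by simp
      qed
      then show "(\<lambda>n. blinfun_apply y (U n)) \<longlonglongrightarrow> B x y"
        using U[OF y] by (simp add: LIM_zero_iff)
    qed
    then show ?thesis by blast
  qed
  then obtain S where S: "\<And>x y. y \<in> dual \<Longrightarrow> blinfun_apply y (S x) = B x y" by metis
  have SC: "S (c *\<^sub>C x) = c *\<^sub>C S x" for c x
    by (rule functionals_separate) (simp add: S scale functional_scaleC)
  have Sadd: "S (x + x') = S x + S x'" for x x'
    by (rule functionals_separate) (simp add: S add blinfun.add_right)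
  have Sle: "norm (S x) \<le> K * norm x" for x
    by (rule norm_le_by_functionals) (use K in \<open>simp_all add: S bound\<close>)
  have bl: "bounded_linear S"
    using Sle SC[of "complex_of_real _"]
    by (intro bounded_linear_intro[of _ K]) (auto simp: Sadd scaleC_of_real mult.commute)
  show thesis
  proof (rule that[of "Blinfun S"])
    show "Blinfun S \<in> bounded_clinear" using bl by (simp add: bounded_clinear_def bounded_linear_Blinfun_apply SC)
    show "norm (Blinfun S) \<le> K" using bl K Sle by (intro norm_blinfun_bound) (auto simp: bounded_linear_Blinfun_apply)
    show "blinfun_apply y (blinfun_apply (Blinfun S) x) = B x y" if "y \<in> dual" for x y
      using bl S that by (simp add: bounded_linear_Blinfun_apply)
  qed
qed

section \<open>Integrals of holomorphic functions along vertical lines\<close>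

definition line_integral :: "real \<Rightarrow> (complex \<Rightarrow> complex) \<Rightarrow> complex"
  where "line_integral \<delta> F = (\<integral>t. F (Complex \<delta> t) \<partial>lborel)"

definition strip :: "real \<Rightarrow> real \<Rightarrow> complex set"
  where "strip a b = {z. a < Re z \<and> Re z < b}"

text \<open>On a strip, all estimates are uniform on closed substrips only.  This makes the two classes below
  stable under differentiation, by Cauchy's estimate on discs of a fixed radius.\<close>

definition strip_bounded :: "real \<Rightarrow> real \<Rightarrow> (complex \<Rightarrow> complex) \<Rightarrow> bool"
  where "strip_bounded a b F \<longleftrightarrow> F holomorphic_on strip a b \<and>
    (\<forall>a' b'. a < a' \<and> b' < b \<longrightarrow> (\<exists>C. \<forall>z. a' \<le> Re z \<and> Re z \<le> b' \<longrightarrow> cmod (F z) \<le> C))"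

definition strip_decay :: "real \<Rightarrow> real \<Rightarrow> (complex \<Rightarrow> complex) \<Rightarrow> bool"
  where "strip_decay a b F \<longleftrightarrow> F holomorphic_on strip a b \<and>
    (\<forall>a' b'. a < a' \<and> b' < b \<longrightarrow>
      (\<exists>C. \<forall>z. a' \<le> Re z \<and> Re z \<le> b' \<longrightarrow> cmod (F z) \<le> C / (1 + (Im z)\<^sup>2)))"

lemma open_strip [simp]: "open (strip a b)"
proof -
  have "strip a b = {z. a < Re z} \<inter> {z. Re z < b}" by (auto simp: strip_def)
  then show ?thesis by (simp add: open_Int open_halfspace_Re_gt open_halfspace_Re_lt)
qed

lemma open_half_plane [simp]: "open (half_plane a)"
  by (simp add: half_plane_def open_halfspace_Re_gt)

lemma one_plus_square_pos: "0 < 1 + (t::real)\<^sup>2"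
  by (simp add: add_pos_nonneg)

lemma integrable_inverse_one_plus_square:
  "integrable lborel (\<lambda>t::real. C / (1 + t\<^sup>2))"
proof -
  have "integrable lborel (\<lambda>t::real. inverse (1 + t\<^sup>2))"
    using integrable_inverse_1_plus_square by (simp add: set_integrable_def)
  then show ?thesis by (simp add: divide_inverse)
qed

lemma line_continuous:
  assumes "F holomorphic_on S" "\<And>t. Complex \<delta> t \<in> S"
  shows "continuous_on UNIV (\<lambda>t. F (Complex \<delta> t))"
proof (rule continuous_on_compose2[OF holomorphic_on_imp_continuous_on[OF assms(1)]])
  show "continuous_on UNIV (Complex \<delta>)"
    unfolding Complex_eq by (intro continuous_intros)
qed (use assms in auto)

lemma line_measurable:
  assumes "continuous_on UNIV (\<lambda>t. f (Complex \<delta> t) :: complex)"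
  shows "(\<lambda>t. f (Complex \<delta> t)) \<in> borel_measurable lborel"
  using borel_measurable_continuous_onI[OF assms] by simp

lemma integrable_of_decay:
  fixes f :: "real \<Rightarrow> 'b::{banach, second_countable_topology}"
  assumes "continuous_on UNIV f" "\<And>t. norm (f t) \<le> C / (1 + t\<^sup>2)"
  shows "integrable lborel f"
proof (rule Bochner_Integration.integrable_bound[OF integrable_inverse_one_plus_square[of C]])
  show "f \<in> borel_measurable lborel" using borel_measurable_continuous_onI[OF assms(1)] by simp
  have "norm (f t) \<le> norm (C / (1 + t\<^sup>2))" for t using assms(2)[of t] by (simp only: real_norm_def)
  then show "AE t in lborel. norm (f t) \<le> norm (C / (1 + t\<^sup>2))" by simp
qed

lemma norm_integral_le:
  fixes f :: "'c \<Rightarrow> 'b::{banach, second_countable_topology}"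
  assumes "integrable N f" "integrable N g" "\<And>t. norm (f t) \<le> g t"
  shows "norm (integral\<^sup>L N f) \<le> integral\<^sup>L N g"
proof -
  have "norm (integral\<^sup>L N f) \<le> (\<integral>t. norm (f t) \<partial>N)" by (rule integral_norm_bound)
  also have "\<dots> \<le> integral\<^sup>L N g" by (intro integral_mono integrable_norm assms)
  finally show ?thesis .
qed

lemma strip_decayD:
  assumes "strip_decay a b F"
  shows "F holomorphic_on strip a b"
    and "a < a' \<Longrightarrow> b' < b \<Longrightarrow>
      \<exists>C\<ge>0. \<forall>z. a' \<le> Re z \<and> Re z \<le> b' \<longrightarrow> cmod (F z) \<le> C / (1 + (Im z)\<^sup>2)"
proof -
  show "F holomorphic_on strip a b" using assms by (simp add: strip_decay_def)
  assume "a < a'" "b' < b"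
  then obtain C where C: "\<And>z. a' \<le> Re z \<and> Re z \<le> b' \<Longrightarrow> cmod (F z) \<le> C / (1 + (Im z)\<^sup>2)"
    using assms unfolding strip_decay_def by blast
  have "C / (1 + (Im z)\<^sup>2) \<le> \<bar>C\<bar> / (1 + (Im z)\<^sup>2)" for z
    using one_plus_square_pos[of "Im z"] by (intro divide_right_mono) auto
  then show "\<exists>C\<ge>0. \<forall>z. a' \<le> Re z \<and> Re z \<le> b' \<longrightarrow> cmod (F z) \<le> C / (1 + (Im z)\<^sup>2)"
    using C by (intro exI[of _ "\<bar>C\<bar>"]) (fastforce intro: order.trans)
qed

lemma strip_decay_integrable:
  assumes "strip_decay a b F" "a < \<delta>" "\<delta> < b"
  shows "integrable lborel (\<lambda>t. F (Complex \<delta> t))"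
proof -
  obtain C where C: "\<And>z. \<delta> \<le> Re z \<and> Re z \<le> \<delta> \<Longrightarrow> cmod (F z) \<le> C / (1 + (Im z)\<^sup>2)"
    using strip_decayD(2)[OF assms(1), of \<delta> \<delta>] assms by blast
  show ?thesis
  proof (rule integrable_of_decay)
    show "continuous_on UNIV (\<lambda>t. F (Complex \<delta> t))"
      using assms by (intro line_continuous[OF strip_decayD(1)[OF assms(1)]]) (simp add: strip_def)
    show "norm (F (Complex \<delta> t)) \<le> C / (1 + t\<^sup>2)" for t
      using C[of "Complex \<delta> t"] by simp
  qed
qed

lemma strip_decay_mult:
  assumes F: "strip_bounded a b F" and G: "strip_decay a b G"
  shows "strip_decay a b (\<lambda>z. F z * G z)"
  unfolding strip_decay_def
proof (intro conjI allI impI)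
  show "(\<lambda>z. F z * G z) holomorphic_on strip a b"
    using F G by (intro holomorphic_intros) (auto simp: strip_bounded_def strip_decay_def)
  fix a' b' assume ab: "a < a' \<and> b' < b"
  obtain C where C: "\<And>z. a' \<le> Re z \<and> Re z \<le> b' \<Longrightarrow> cmod (F z) \<le> C"
    using F ab unfolding strip_bounded_def by blast
  obtain D where D: "D \<ge> 0" "\<And>z. a' \<le> Re z \<and> Re z \<le> b' \<Longrightarrow> cmod (G z) \<le> D / (1 + (Im z)\<^sup>2)"
    using strip_decayD(2)[OF G, of a' b'] ab by blast
  show "\<exists>C. \<forall>z. a' \<le> Re z \<and> Re z \<le> b' \<longrightarrow> cmod (F z * G z) \<le> C / (1 + (Im z)\<^sup>2)"
  proof (intro exI[of _ "C * D"] allI impI)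
    fix z assume z: "a' \<le> Re z \<and> Re z \<le> b'"
    have "cmod (F z) * cmod (G z) \<le> C * (D / (1 + (Im z)\<^sup>2))"
      using C[OF z] D(2)[OF z] order.trans[OF norm_ge_zero C[OF z]] by (intro mult_mono) auto
    then show "cmod (F z * G z) \<le> C * D / (1 + (Im z)\<^sup>2)" by (simp add: norm_mult)
  qed
qed

lemma one_plus_square_near:
  fixes s t :: real
  assumes "\<bar>s - t\<bar> \<le> 1"
  shows "1 + t\<^sup>2 \<le> 3 * (1 + s\<^sup>2)"
proof -
  have "\<bar>t\<bar> \<le> \<bar>s\<bar> + 1" using assms by linarith
  then have "t\<^sup>2 \<le> (\<bar>s\<bar> + 1)\<^sup>2" by (metis abs_ge_zero abs_le_square_iff abs_of_nonneg add_nonneg_nonneg zero_le_one)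
  also have "\<dots> = s\<^sup>2 + 2 * \<bar>s\<bar> + 1" by (simp add: power2_eq_square algebra_simps abs_mult_self_eq)
  finally have "t\<^sup>2 \<le> s\<^sup>2 + 2 * \<bar>s\<bar> + 1" .
  moreover have "2 * \<bar>s\<bar> \<le> s\<^sup>2 + 1"
    using zero_le_power2[of "\<bar>s\<bar> - 1"] by (simp add: power2_eq_square algebra_simps)
  ultimately show ?thesis using zero_le_power2[of s] by argo
qed

lemma decay_near:
  fixes s t C :: real
  assumes "\<bar>s - t\<bar> \<le> 1" "C \<ge> 0"
  shows "C / (1 + s\<^sup>2) \<le> 3 * C / (1 + t\<^sup>2)"
proof -
  have "C * (1 + t\<^sup>2) \<le> C * (3 * (1 + s\<^sup>2))"
    by (intro mult_left_mono one_plus_square_near assms)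
  then show ?thesis using one_plus_square_pos[of s] one_plus_square_pos[of t]
    by (simp add: divide_simps mult_ac)
qed

text \<open>The radius of the discs is chosen once for the whole substrip; it is at most \<open>1\<close>, so that
  \<open>1 + (Im z)\<^sup>2\<close> varies by a factor of at most \<open>3\<close> on each disc.\<close>

lemma strip_Cauchy_estimate:
  assumes hol: "F holomorphic_on strip a b" and "a < a'" "b' < b"
  obtains \<rho> where "\<rho> > 0" "\<rho> \<le> 1" "a < a' - \<rho>" "b' + \<rho> < b"
    "\<And>z B. \<lbrakk>a' \<le> Re z; Re z \<le> b'; \<And>w. cmod (z - w) = \<rho> \<Longrightarrow> cmod (F w) \<le> B\<rbrakk>
      \<Longrightarrow> cmod (deriv F z) \<le> B / \<rho>"
proof -
  define \<rho> where "\<rho> = min 1 (min ((a' - a) / 2) ((b - b') / 2))"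
  have \<rho>: "\<rho> > 0" "\<rho> \<le> 1" "\<rho> \<le> (a' - a) / 2" "\<rho> \<le> (b - b') / 2"
    using assms by (auto simp: \<rho>_def min_def)
  show thesis
  proof (rule that[OF \<rho>(1,2)])
    show "a < a' - \<rho>" "b' + \<rho> < b" using \<rho> assms(2,3) by (auto simp: field_simps)
    fix z B assume z: "a' \<le> Re z" "Re z \<le> b'" and B: "\<And>w. cmod (z - w) = \<rho> \<Longrightarrow> cmod (F w) \<le> B"
    have sub: "cball z \<rho> \<subseteq> strip a b"
    proof
      fix w assume "w \<in> cball z \<rho>"
      then have "\<bar>Re z - Re w\<bar> \<le> \<rho>"
        using abs_Re_le_cmod[of "z - w"] by (auto simp: dist_norm)
      then show "w \<in> strip a b" using z \<rho> assms(2,3) by (auto simp: strip_def field_simps)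
    qed
    have "cmod ((deriv ^^ 1) F z) \<le> fact 1 * B / \<rho> ^ 1"
    proof (rule Cauchy_inequality)
      show "F holomorphic_on ball z \<rho>" using hol sub ball_subset_cball holomorphic_on_subset by blast
      show "continuous_on (cball z \<rho>) F"
        using hol sub holomorphic_on_subset holomorphic_on_imp_continuous_on by blast
    qed (use B \<rho> in auto)
    then show "cmod (deriv F z) \<le> B / \<rho>" by simp
  qed
qed

lemma strip_bounded_deriv:
  assumes F: "strip_bounded a b F"
  shows "strip_bounded a b (deriv F)"
  unfolding strip_bounded_def
proof (intro conjI allI impI)
  have hol: "F holomorphic_on strip a b" using F by (simp add: strip_bounded_def)
  then show "deriv F holomorphic_on strip a b" by (intro holomorphic_deriv) auto
  fix a' b' assume ab: "a < a' \<and> b' < b"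
  then obtain \<rho> where \<rho>: "\<rho> > 0" "\<rho> \<le> 1" "a < a' - \<rho>" "b' + \<rho> < b"
      "\<And>z B. \<lbrakk>a' \<le> Re z; Re z \<le> b'; \<And>w. cmod (z - w) = \<rho> \<Longrightarrow> cmod (F w) \<le> B\<rbrakk> \<Longrightarrow> cmod (deriv F z) \<le> B / \<rho>"
    using strip_Cauchy_estimate[OF hol] by metis
  obtain C where C: "\<And>z. a' - \<rho> \<le> Re z \<and> Re z \<le> b' + \<rho> \<Longrightarrow> cmod (F z) \<le> C"
    using F \<rho> unfolding strip_bounded_def by blast
  have "cmod (deriv F z) \<le> C / \<rho>" if z: "a' \<le> Re z \<and> Re z \<le> b'" for z
  proof (rule \<rho>(5))
    fix w assume "cmod (z - w) = \<rho>"
    then have "\<bar>Re z - Re w\<bar> \<le> \<rho>" using abs_Re_le_cmod[of "z - w"] by auto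
    then show "cmod (F w) \<le> C" using z by (intro C) auto
  qed (use z in auto)
  then show "\<exists>C. \<forall>z. a' \<le> Re z \<and> Re z \<le> b' \<longrightarrow> cmod (deriv F z) \<le> C" by blast
qed

lemma strip_decay_deriv:
  assumes F: "strip_decay a b F"
  shows "strip_decay a b (deriv F)"
  unfolding strip_decay_def
proof (intro conjI allI impI)
  have hol: "F holomorphic_on strip a b" using F by (simp add: strip_decay_def)
  then show "deriv F holomorphic_on strip a b" by (intro holomorphic_deriv) auto
  fix a' b' assume ab: "a < a' \<and> b' < b"
  then obtain \<rho> where \<rho>: "\<rho> > 0" "\<rho> \<le> 1" "a < a' - \<rho>" "b' + \<rho> < b"
      "\<And>z B. \<lbrakk>a' \<le> Re z; Re z \<le> b'; \<And>w. cmod (z - w) = \<rho> \<Longrightarrow> cmod (F w) \<le> B\<rbrakk> \<Longrightarrow> cmod (deriv F z) \<le> B / \<rho>"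
    using strip_Cauchy_estimate[OF hol] by metis
  obtain C where C: "C \<ge> 0" "\<And>z. a' - \<rho> \<le> Re z \<and> Re z \<le> b' + \<rho> \<Longrightarrow> cmod (F z) \<le> C / (1 + (Im z)\<^sup>2)"
    using strip_decayD(2)[OF F, of "a' - \<rho>" "b' + \<rho>"] \<rho> by blast
  have "cmod (deriv F z) \<le> (3 * C / \<rho>) / (1 + (Im z)\<^sup>2)" if z: "a' \<le> Re z \<and> Re z \<le> b'" for z
  proof -
    have "cmod (deriv F z) \<le> (3 * C / (1 + (Im z)\<^sup>2)) / \<rho>"
    proof (rule \<rho>(5))
      fix w assume w: "cmod (z - w) = \<rho>"
      then have "\<bar>Re z - Re w\<bar> \<le> \<rho>" using abs_Re_le_cmod[of "z - w"] by auto
      then have "cmod (F w) \<le> C / (1 + (Im w)\<^sup>2)" using z by (intro C) auto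
      also have "\<dots> \<le> 3 * C / (1 + (Im z)\<^sup>2)"
        using abs_Im_le_cmod[of "z - w"] w \<rho>(2) C(1) by (intro decay_near) auto
      finally show "cmod (F w) \<le> 3 * C / (1 + (Im z)\<^sup>2)" .
    qed (use z in auto)
    then show ?thesis by (simp add: mult.commute)
  qed
  then show "\<exists>C. \<forall>z. a' \<le> Re z \<and> Re z \<le> b' \<longrightarrow> cmod (deriv F z) \<le> C / (1 + (Im z)\<^sup>2)" by blast
qed

lemma strip_decay_Taylor:
  assumes F: "strip_decay a b F" and \<delta>: "a < \<delta>" "\<delta> < b"
  obtains C r where "C \<ge> 0" "r > 0" "a < \<delta> - r" "\<delta> + r < b"
    "\<And>h t. cmod h \<le> r \<Longrightarrow>
      cmod (F (Complex \<delta> t + h) - F (Complex \<delta> t) - h * deriv F (Complex \<delta> t))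
        \<le> (C * (cmod h)\<^sup>2) / (1 + t\<^sup>2)"
proof -
  define r where "r = min 1 (min ((\<delta> - a) / 2) ((b - \<delta>) / 2))"
  have r: "r > 0" "r \<le> 1" "r \<le> (\<delta> - a) / 2" "r \<le> (b - \<delta>) / 2" using \<delta> by (auto simp: r_def min_def)
  then have r': "a < \<delta> - r" "\<delta> + r < b" using \<delta> by (auto simp: field_simps)
  obtain C where C: "C \<ge> 0" "\<And>z. \<delta> - r \<le> Re z \<and> Re z \<le> \<delta> + r \<Longrightarrow> cmod (deriv (deriv F) z) \<le> C / (1 + (Im z)\<^sup>2)"
    using strip_decayD(2)[OF strip_decay_deriv[OF strip_decay_deriv[OF F]] r'] by blast
  show thesis
  proof (rule that[of "3 * C" r])
    fix h t assume h: "cmod h \<le> r"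
    let ?z = "Complex \<delta> t"
    let ?S = "cball ?z r"
    have near: "\<bar>Re x - \<delta>\<bar> \<le> r" "\<bar>Im x - t\<bar> \<le> r" if "x \<in> ?S" for x
      using that abs_Re_le_cmod[of "?z - x"] abs_Im_le_cmod[of "?z - x"] by (auto simp: dist_norm)
    have sub: "?S \<subseteq> strip a b" using near r' by (fastforce simp: strip_def)
    have "cmod ((\<lambda>i. (deriv ^^ i) F) 0 (?z + h) - (\<Sum>i\<le>1. (\<lambda>i. (deriv ^^ i) F) i ?z * (?z + h - ?z) ^ i / fact i))
        \<le> (3 * C / (1 + t\<^sup>2)) * cmod (?z + h - ?z) ^ Suc 1 / fact 1"
    proof (rule complex_Taylor[of ?S])
      fix i x assume x: "x \<in> ?S"
      have "(deriv ^^ i) F holomorphic_on strip a b"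
        by (rule holomorphic_higher_deriv[OF strip_decayD(1)[OF F]]) auto
      then show "((deriv ^^ i) F has_field_derivative (deriv ^^ Suc i) F x) (at x within ?S)"
        using x sub holomorphic_derivI[of "(deriv ^^ i) F" "strip a b" x]
        by (auto intro: has_field_derivative_at_within)
    next
      fix x assume x: "x \<in> ?S"
      then have "cmod (deriv (deriv F) x) \<le> C / (1 + (Im x)\<^sup>2)" using near[OF x] by (intro C) auto
      also have "\<dots> \<le> 3 * C / (1 + t\<^sup>2)" using near[OF x] r C(1) by (intro decay_near) auto
      finally show "cmod ((deriv ^^ Suc 1) F x) \<le> 3 * C / (1 + t\<^sup>2)" by simp
    qed (use h r in \<open>auto simp: dist_norm\<close>)
    then show "cmod (F (?z + h) - F ?z - h * deriv F ?z) \<le> (3 * C * (cmod h)\<^sup>2) / (1 + t\<^sup>2)"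
      by (simp add: power2_eq_square algebra_simps)
  qed (use C r r' in auto)
qed

text \<open>The translation \<open>h\<close> is complex on purpose.  A purely imaginary \<open>h\<close> does not change the integral
  along the line, so the first-order term must vanish; a real \<open>h\<close> moves the line, and
  the integral then changes by \<open>O(h\<^sup>2)\<close> only.  Both consequences together replace Cauchy's theorem
  for the strip.\<close>

lemma strip_decay_difference_quotient:
  assumes F: "strip_decay a b F" and \<delta>: "a < \<delta>" "\<delta> < b"
  obtains C r where "r > 0" "a < \<delta> - r" "\<delta> + r < b"
    "\<And>h. cmod h \<le> r \<Longrightarrow>
      cmod (line_integral (\<delta> + Re h) F - line_integral \<delta> F - h * line_integral \<delta> (deriv F))
        \<le> C * (cmod h)\<^sup>2"
proof -
  obtain C r where C: "C \<ge> 0" "r > 0" "a < \<delta> - r" "\<delta> + r < b"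
    "\<And>h t. cmod h \<le> r \<Longrightarrow>
      cmod (F (Complex \<delta> t + h) - F (Complex \<delta> t) - h * deriv F (Complex \<delta> t))
        \<le> (C * (cmod h)\<^sup>2) / (1 + t\<^sup>2)"
    by (rule strip_decay_Taylor[OF F \<delta>]) blast
  define I where "I = (\<integral>t. 1 / (1 + (t::real)\<^sup>2) \<partial>lborel)"
  show thesis
  proof (rule that[OF C(2,3,4)])
    fix h assume h: "cmod h \<le> r"
    have Re: "a < \<delta> + Re h" "\<delta> + Re h < b" using abs_Re_le_cmod[of h] h C(3,4) by auto
    have shift: "(\<lambda>t. F (Complex \<delta> t + h)) = (\<lambda>t. F (Complex (\<delta> + Re h) (Im h + 1 * t)))"
      by (rule ext, rule arg_cong[of _ _ F]) (simp add: complex_eq_iff)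
    have i1: "integrable lborel (\<lambda>t. F (Complex \<delta> t + h))"
      unfolding shift using strip_decay_integrable[OF F Re]
      by (intro lborel_integrable_real_affine) auto
    have i0: "integrable lborel (\<lambda>t. F (Complex \<delta> t))" by (rule strip_decay_integrable[OF F \<delta>])
    have i2: "integrable lborel (\<lambda>t. deriv F (Complex \<delta> t))"
      by (rule strip_decay_integrable[OF strip_decay_deriv[OF F] \<delta>])
    have "line_integral (\<delta> + Re h) F = (\<integral>t. F (Complex \<delta> t + h) \<partial>lborel)"
      unfolding shift line_integral_def by (subst lborel_integral_real_affine[of 1 _ "Im h"]) auto
    then have "line_integral (\<delta> + Re h) F - line_integral \<delta> F - h * line_integral \<delta> (deriv F)
        = (\<integral>t. F (Complex \<delta> t + h) - F (Complex \<delta> t) - h * deriv F (Complex \<delta> t) \<partial>lborel)"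
      using i0 i1 i2 by (simp add: line_integral_def)
    also have "cmod \<dots> \<le> (\<integral>t. (C * (cmod h)\<^sup>2) / (1 + t\<^sup>2) \<partial>lborel)"
      by (intro norm_integral_le) (use C(5)[OF h] integrable_inverse_one_plus_square i0 i1 i2 in auto)
    also have "\<dots> = (\<integral>t. (C * (cmod h)\<^sup>2) * (1 / (1 + t\<^sup>2)) \<partial>lborel)" by simp
    also have "\<dots> = (C * I) * (cmod h)\<^sup>2" 
      unfolding I_def by (subst integral_mult_right_zero) (simp add: mult_ac)
    finally show "cmod (line_integral (\<delta> + Re h) F - line_integral \<delta> F - h * line_integral \<delta> (deriv F))
        \<le> (C * I) * (cmod h)\<^sup>2" .
  qed
qed

lemma line_integral_deriv_eq_0:
  assumes F: "strip_decay a b F" and \<delta>: "a < \<delta>" "\<delta> < b"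
  shows "line_integral \<delta> (deriv F) = 0"
proof -
  obtain C r where C: "r > 0" "a < \<delta> - r" "\<delta> + r < b"
    "\<And>h. cmod h \<le> r \<Longrightarrow>
      cmod (line_integral (\<delta> + Re h) F - line_integral \<delta> F - h * line_integral \<delta> (deriv F))
        \<le> C * (cmod h)\<^sup>2"
    by (rule strip_decay_difference_quotient[OF F \<delta>]) blast
  have le: "cmod (line_integral \<delta> (deriv F)) \<le> C * \<eta>" if "0 < \<eta>" "\<eta> \<le> r" for \<eta>
    using C(4)[of "Complex 0 \<eta>"] that
    by (simp add: norm_mult complex_norm power2_eq_square mult.assoc[symmetric])
  have "cmod (line_integral \<delta> (deriv F)) \<le> C * 0"
  proof (rule tendsto_lowerbound)
    show "((\<lambda>\<eta>. C * \<eta>) \<longlongrightarrow> C * 0) (at_right 0)" by (intro tendsto_intros)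
    show "\<forall>\<^sub>F \<eta> in at_right 0. cmod (line_integral \<delta> (deriv F)) \<le> C * \<eta>"
      using C(1) le by (auto simp: eventually_at_right_field intro!: exI[of _ r])
  qed simp
  then show ?thesis by simp
qed

lemma quadratic_expansion_derivative:
  fixes f :: "real \<Rightarrow> 'b::real_normed_vector"
  assumes "r > 0" "\<And>y. y \<in> S \<Longrightarrow> \<bar>y - x\<bar> < r \<Longrightarrow> norm (f y - f x - (y - x) *\<^sub>R v) \<le> C * (y - x)\<^sup>2"
  shows "(f has_vector_derivative v) (at x within S)"
  unfolding has_vector_derivative_def has_derivative_within_alt
proof (intro conjI allI impI bounded_linear_scaleR_left)
  fix e :: real assume e: "e > 0"
  show "\<exists>d>0. \<forall>y\<in>S. norm (y - x) < d \<longrightarrow> norm (f y - f x - (y - x) *\<^sub>R v) \<le> e * norm (y - x)"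
  proof (intro exI[of _ "min r (e / (\<bar>C\<bar> + 1))"] conjI ballI impI)
    fix y assume y: "y \<in> S" "norm (y - x) < min r (e / (\<bar>C\<bar> + 1))"
    have "norm (f y - f x - (y - x) *\<^sub>R v) \<le> C * (y - x)\<^sup>2" using y by (intro assms) auto
    also have "\<dots> \<le> (\<bar>C\<bar> + 1) * (y - x)\<^sup>2" by (intro mult_right_mono) auto
    also have "\<dots> = ((\<bar>C\<bar> + 1) * \<bar>y - x\<bar>) * \<bar>y - x\<bar>" by (simp add: power2_eq_square abs_mult_self_eq)
    also have "(\<bar>C\<bar> + 1) * \<bar>y - x\<bar> \<le> e" using y by (simp add: field_simps)
    finally show "norm (f y - f x - (y - x) *\<^sub>R v) \<le> e * norm (y - x)" by (simp add: mult_right_mono)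
  qed (use assms(1) e in auto)
qed

lemma quadratic_modulus_constant:
  fixes f :: "real \<Rightarrow> 'b::real_normed_vector"
  assumes "convex S"
    and quad: "\<And>x. x \<in> S \<Longrightarrow> \<exists>C r. r > 0 \<and> (\<forall>y\<in>S. \<bar>y - x\<bar> < r \<longrightarrow> norm (f y - f x) \<le> C * (y - x)\<^sup>2)"
    and "x \<in> S" "y \<in> S"
  shows "f x = f y"
proof -
  have "(f has_vector_derivative 0) (at x within S)" if x: "x \<in> S" for x
  proof -
    obtain C r where "r > 0" "\<And>y. y \<in> S \<Longrightarrow> \<bar>y - x\<bar> < r \<Longrightarrow> norm (f y - f x) \<le> C * (y - x)\<^sup>2"
      using quad[OF x] by blast
    then show ?thesis by (intro quadratic_expansion_derivative[of r]) auto
  qed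
  then obtain c where "\<forall>x\<in>S. f x = c"
    using has_derivative_zero_constant[OF assms(1), of f] by (auto simp: has_vector_derivative_def)
  then show ?thesis using assms(3,4) by simp
qed

lemma line_integral_shift:
  assumes F: "strip_decay a b F" and "a < \<delta>" "\<delta> < b" "a < \<delta>'" "\<delta>' < b"
  shows "line_integral \<delta> F = line_integral \<delta>' F"
proof (rule quadratic_modulus_constant[of "{a<..<b}" "\<lambda>\<delta>. line_integral \<delta> F"])
  fix x assume "x \<in> {a<..<b}"
  then have x: "a < x" "x < b" by auto
  obtain C r where C: "r > 0" "a < x - r" "x + r < b"
    "\<And>h. cmod h \<le> r \<Longrightarrow>
      cmod (line_integral (x + Re h) F - line_integral x F - h * line_integral x (deriv F))
        \<le> C * (cmod h)\<^sup>2"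
    by (rule strip_decay_difference_quotient[OF F x]) blast
  show "\<exists>C r. r > 0 \<and> (\<forall>y\<in>{a<..<b}. \<bar>y - x\<bar> < r \<longrightarrow>
      norm (line_integral y F - line_integral x F) \<le> C * (y - x)\<^sup>2)"
  proof (rule exI[of _ C], rule exI[of _ r], intro conjI ballI impI C(1))
    fix y assume "\<bar>y - x\<bar> < r"
    then show "norm (line_integral y F - line_integral x F) \<le> C * (y - x)\<^sup>2"
      using C(4)[of "of_real (y - x)"] line_integral_deriv_eq_0[OF F x]
      by (simp add: norm_of_real del: of_real_diff)
  qed
qed (use assms in auto)

lemma line_integral_by_parts:
  assumes p: "strip_bounded a b p" and h: "strip_decay a b h" and \<delta>: "a < \<delta>" "\<delta> < b"
  shows "line_integral \<delta> (\<lambda>z. deriv p z * h z) = - line_integral \<delta> (\<lambda>z. p z * deriv h z)"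
proof -
  have in_strip: "Complex \<delta> t \<in> strip a b" for t using \<delta> by (simp add: strip_def)
  have d: "deriv (\<lambda>z. p z * h z) z = p z * deriv h z + deriv p z * h z" if "z \<in> strip a b" for z
  proof (rule deriv_mult)
    show "p field_differentiable at z" "h field_differentiable at z"
      using p h that holomorphic_on_imp_differentiable_at[of _ "strip a b" z]
      by (auto simp: strip_bounded_def strip_decay_def)
  qed
  have i: "integrable lborel (\<lambda>t. p (Complex \<delta> t) * deriv h (Complex \<delta> t))"
    "integrable lborel (\<lambda>t. deriv p (Complex \<delta> t) * h (Complex \<delta> t))"
    using strip_decay_integrable[OF strip_decay_mult[OF p strip_decay_deriv[OF h]] \<delta>]
      strip_decay_integrable[OF strip_decay_mult[OF strip_bounded_deriv[OF p] h] \<delta>] by auto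
  have "0 = line_integral \<delta> (deriv (\<lambda>z. p z * h z))"
    using line_integral_deriv_eq_0[OF strip_decay_mult[OF p h] \<delta>] by simp
  also have "\<dots> = line_integral \<delta> (\<lambda>z. p z * deriv h z) + line_integral \<delta> (\<lambda>z. deriv p z * h z)"
    unfolding line_integral_def by (simp add: d[OF in_strip] i)
  finally show ?thesis by (simp add: eq_neg_iff_add_eq_0 add.commute)
qed

lemma strip_bounded_higher_deriv:
  "strip_bounded a b p \<Longrightarrow> strip_bounded a b ((deriv ^^ m) p)"
  by (induction m) (auto intro: strip_bounded_deriv)

lemma line_integral_by_parts_iterated:
  assumes p: "strip_bounded a b p" and h: "strip_decay a b h" and \<delta>: "a < \<delta>" "\<delta> < b"
  shows "line_integral \<delta> (\<lambda>z. (deriv ^^ m) p z * h z)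
    = (- 1) ^ m * line_integral \<delta> (\<lambda>z. p z * (deriv ^^ m) h z)"
  using h
proof (induction m arbitrary: h)
  case (Suc m)
  have "line_integral \<delta> (\<lambda>z. (deriv ^^ Suc m) p z * h z)
      = - line_integral \<delta> (\<lambda>z. (deriv ^^ m) p z * deriv h z)"
    using line_integral_by_parts[OF strip_bounded_higher_deriv[OF p, of m] Suc.prems \<delta>] by simp
  also have "\<dots> = - ((- 1) ^ m * line_integral \<delta> (\<lambda>z. p z * (deriv ^^ m) (deriv h) z))"
    by (subst Suc.IH[OF strip_decay_deriv[OF Suc.prems]]) simp
  finally show ?case by (simp add: funpow_swap1)
qed simp

lemma higher_deriv_eqI:
  assumes "open S" "\<And>z. z \<in> S \<Longrightarrow> f z = D 0 z"
    and "\<And>i z. z \<in> S \<Longrightarrow> (D i has_field_derivative D (Suc i) z) (at z)" and "z \<in> S"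
  shows "(deriv ^^ n) f z = D n z"
  using \<open>z \<in> S\<close>
proof (induction n arbitrary: z)
  case (Suc n)
  have "((deriv ^^ n) f has_field_derivative D (Suc n) z) (at z)"
    by (rule has_field_derivative_transform_within_open[OF assms(3) \<open>open S\<close>])
      (use Suc in auto)
  then show ?case by (simp add: DERIV_imp_deriv)
qed (use assms in auto)

lemma shifted_square_bound:
  fixes \<mu> z :: complex
  assumes "0 < \<epsilon>" "\<epsilon> \<le> cmod (\<mu> - z)"
  shows "1 + (cmod z)\<^sup>2 \<le> ((1 + 2 * (cmod \<mu>)\<^sup>2) / \<epsilon>\<^sup>2 + 2) * (cmod (\<mu> - z))\<^sup>2"
proof -
  let ?w = "cmod (\<mu> - z)"
  have "cmod z \<le> cmod \<mu> + ?w" using norm_triangle_ineq4[of \<mu> "\<mu> - z"] by simp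
  then have "(cmod z)\<^sup>2 \<le> (cmod \<mu> + ?w)\<^sup>2" by (intro power_mono) auto
  also have "\<dots> \<le> 2 * (cmod \<mu>)\<^sup>2 + 2 * ?w\<^sup>2"
    using zero_le_power2[of "cmod \<mu> - ?w"] by (simp add: power2_eq_square algebra_simps)
  finally have 1: "1 + (cmod z)\<^sup>2 \<le> (1 + 2 * (cmod \<mu>)\<^sup>2) * 1 + 2 * ?w\<^sup>2" by simp
  have "1 \<le> ?w\<^sup>2 / \<epsilon>\<^sup>2" using assms by (simp add: field_simps power_mono)
  then have "(1 + 2 * (cmod \<mu>)\<^sup>2) * 1 \<le> (1 + 2 * (cmod \<mu>)\<^sup>2) * (?w\<^sup>2 / \<epsilon>\<^sup>2)"
    by (intro mult_left_mono) auto
  with 1 show ?thesis by (simp add: field_simps)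
qed

lemma inverse_square_decay:
  fixes \<mu> z :: complex
  assumes "0 < \<epsilon>" "\<epsilon> \<le> cmod (\<mu> - z)"
  shows "cmod (1 / (\<mu> - z)\<^sup>2) \<le> ((1 + 2 * (cmod \<mu>)\<^sup>2) / \<epsilon>\<^sup>2 + 2) / (1 + (cmod z)\<^sup>2)"
proof -
  have "cmod (\<mu> - z) > 0" using assms by linarith
  then show ?thesis using shifted_square_bound[OF assms] one_plus_square_pos[of "cmod z"]
    by (simp add: norm_divide norm_power divide_simps)
qed

definition half_plane_decay :: "real \<Rightarrow> (complex \<Rightarrow> complex) \<Rightarrow> bool"
  where "half_plane_decay a F \<longleftrightarrow> F holomorphic_on half_plane a \<and>
    (\<exists>C. \<forall>z\<in>half_plane a. cmod (F z) \<le> C / (1 + (cmod z)\<^sup>2))"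

lemma half_plane_decay_strip:
  assumes "half_plane_decay a F"
  shows "strip_decay a b F"
  unfolding strip_decay_def
proof (intro conjI allI impI)
  show "F holomorphic_on strip a b"
    using assms unfolding half_plane_decay_def
    by (auto elim: holomorphic_on_subset simp: strip_def half_plane_def)
  fix a' b' assume ab: "a < a' \<and> b' < b"
  obtain C where C: "\<And>z. z \<in> half_plane a \<Longrightarrow> cmod (F z) \<le> C / (1 + (cmod z)\<^sup>2)"
    using assms unfolding half_plane_decay_def by blast
  show "\<exists>C. \<forall>z. a' \<le> Re z \<and> Re z \<le> b' \<longrightarrow> cmod (F z) \<le> C / (1 + (Im z)\<^sup>2)"
  proof (intro exI[of _ "\<bar>C\<bar>"] allI impI)
    fix z assume "a' \<le> Re z \<and> Re z \<le> b'"
    then have "cmod (F z) \<le> C / (1 + (cmod z)\<^sup>2)" using ab by (intro C) (auto simp: half_plane_def)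
    also have "\<dots> \<le> \<bar>C\<bar> / (1 + (Im z)\<^sup>2)"
      using abs_Im_le_cmod[of z] one_plus_square_pos[of "Im z"] one_plus_square_pos[of "cmod z"]
      by (intro frac_le) (auto simp: cmod_power2)
    finally show "cmod (F z) \<le> \<bar>C\<bar> / (1 + (Im z)\<^sup>2)" .
  qed
qed

lemma half_plane_decay_mult:
  assumes F: "F holomorphic_on half_plane a" "\<And>z. z \<in> half_plane a \<Longrightarrow> cmod (F z) \<le> K"
    and G: "half_plane_decay a G"
  shows "half_plane_decay a (\<lambda>z. F z * G z)"
  unfolding half_plane_decay_def
proof (intro conjI)
  show "(\<lambda>z. F z * G z) holomorphic_on half_plane a"
    using F G by (intro holomorphic_intros) (auto simp: half_plane_decay_def)
  obtain C where C: "\<And>z. z \<in> half_plane a \<Longrightarrow> cmod (G z) \<le> C / (1 + (cmod z)\<^sup>2)"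
    using G unfolding half_plane_decay_def by blast
  have "cmod (F z * G z) \<le> (K * C) / (1 + (cmod z)\<^sup>2)" if z: "z \<in> half_plane a" for z
  proof -
    have "cmod (F z) * cmod (G z) \<le> K * (C / (1 + (cmod z)\<^sup>2))"
      using F(2)[OF z] C[OF z] order.trans[OF norm_ge_zero F(2)[OF z]] by (intro mult_mono) auto
    then show ?thesis by (simp add: norm_mult)
  qed
  then show "\<exists>C. \<forall>z\<in>half_plane a. cmod (F z * G z) \<le> C / (1 + (cmod z)\<^sup>2)" by blast
qed

lemma half_plane_dist:
  "z \<in> half_plane a \<Longrightarrow> a - Re \<mu> \<le> cmod (\<mu> - z)"
  using abs_Re_le_cmod[of "\<mu> - z"] by (auto simp: half_plane_def)

lemma half_plane_decay_inverse_square: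
  assumes "Re \<mu> < a"
  shows "half_plane_decay a (\<lambda>z. 1 / (\<mu> - z)\<^sup>2)"
  unfolding half_plane_decay_def
proof (intro conjI exI ballI)
  show "(\<lambda>z. 1 / (\<mu> - z)\<^sup>2) holomorphic_on half_plane a"
    using assms by (intro holomorphic_intros) (auto simp: half_plane_def)
  fix z assume "z \<in> half_plane a"
  then show "cmod (1 / (\<mu> - z)\<^sup>2) \<le> ((1 + 2 * (cmod \<mu>)\<^sup>2) / (a - Re \<mu>)\<^sup>2 + 2) / (1 + (cmod z)\<^sup>2)"
    using assms half_plane_dist by (intro inverse_square_decay) auto
qed

lemma half_plane_decay_divide:
  assumes F: "half_plane_decay a F" and "Re \<mu> < a"
  shows "half_plane_decay a (\<lambda>z. F z / (\<mu> - z))"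
proof -
  have "half_plane_decay a (\<lambda>z. 1 / (\<mu> - z) * F z)"
  proof (rule half_plane_decay_mult[OF _ _ F])
    show "(\<lambda>z. 1 / (\<mu> - z)) holomorphic_on half_plane a"
      using assms by (intro holomorphic_intros) (auto simp: half_plane_def)
    fix z assume "z \<in> half_plane a"
    then show "cmod (1 / (\<mu> - z)) \<le> 1 / (a - Re \<mu>)"
      using assms half_plane_dist[of z a \<mu>] by (auto simp: norm_divide intro!: frac_le)
  qed
  then show ?thesis by simp
qed

lemma half_plane_decay_divide_power:
  assumes F: "half_plane_decay a F" and \<mu>: "Re \<mu> < a"
  shows "half_plane_decay a (\<lambda>z. F z / (\<mu> - z) ^ k)"
proof (induction k)
  case (Suc k)
  then show ?case using half_plane_decay_divide[OF Suc.IH \<mu>] by (simp add: mult.commute)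
qed (simp add: F)

text \<open>The line can be moved to the right without changing the integral, and far to the right the integrand
  tends to \<open>0\<close> under a fixed integrable majorant.\<close>

lemma line_integral_half_plane_eq_0:
  assumes F: "half_plane_decay a F" and "a < \<delta>"
  shows "line_integral \<delta> F = 0"
proof -
  obtain C where C: "\<And>z. z \<in> half_plane a \<Longrightarrow> cmod (F z) \<le> C / (1 + (cmod z)\<^sup>2)"
    using F unfolding half_plane_decay_def by blast
  have C': "cmod (F (Complex s t)) \<le> \<bar>C\<bar> / (1 + s\<^sup>2 + t\<^sup>2)" if "s > a" for s t
  proof -
    have "cmod (F (Complex s t)) \<le> C / (1 + (cmod (Complex s t))\<^sup>2)"
      using that by (intro C) (auto simp: half_plane_def)
    also have "\<dots> = C / (1 + s\<^sup>2 + t\<^sup>2)" by (simp add: cmod_power2 add.assoc)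
    also have "\<dots> \<le> \<bar>C\<bar> / (1 + s\<^sup>2 + t\<^sup>2)" by (intro divide_right_mono) auto
    finally show ?thesis .
  qed
  have const: "line_integral \<delta> F = line_integral (\<delta> + real n) F" for n
    using assms by (intro line_integral_shift[OF half_plane_decay_strip[OF F, of "\<delta> + real n + 1"]]) auto
  have "(\<lambda>n. line_integral (\<delta> + real n) F) \<longlonglongrightarrow> (\<integral>t. 0 \<partial>(lborel :: real measure))"
    unfolding line_integral_def
  proof (rule integral_dominated_convergence[OF _ _ integrable_inverse_one_plus_square[of "\<bar>C\<bar>"]])
    fix n
    show "(\<lambda>t. F (Complex (\<delta> + real n) t)) \<in> borel_measurable lborel"
    proof (rule line_measurable[OF line_continuous])
      show "F holomorphic_on half_plane a" using F by (simp add: half_plane_decay_def)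
    qed (use assms in \<open>auto simp: half_plane_def\<close>)
    have "cmod (F (Complex (\<delta> + real n) t)) \<le> \<bar>C\<bar> / (1 + t\<^sup>2)" for t
    proof -
      have "\<bar>C\<bar> / (1 + (\<delta> + real n)\<^sup>2 + t\<^sup>2) \<le> \<bar>C\<bar> / (1 + t\<^sup>2)"
        using one_plus_square_pos[of t] by (intro divide_left_mono mult_pos_pos) (auto simp: add_pos_nonneg)
      then show ?thesis using C'[of "\<delta> + real n" t] assms by linarith
    qed
    then show "AE t in lborel. norm (F (Complex (\<delta> + real n) t)) \<le> \<bar>C\<bar> / (1 + t\<^sup>2)" by simp
  next
    have "(\<lambda>n. F (Complex (\<delta> + real n) t)) \<longlonglongrightarrow> 0" for t
    proof (rule Lim_null_comparison[OF always_eventually])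
      show "\<forall>n. norm (F (Complex (\<delta> + real n) t)) \<le> \<bar>C\<bar> / (1 + (\<delta> + real n)\<^sup>2 + t\<^sup>2)"
        using C' assms by auto
      show "(\<lambda>n. \<bar>C\<bar> / (1 + (\<delta> + real n)\<^sup>2 + t\<^sup>2)) \<longlonglongrightarrow> 0"
        by real_asymp
    qed
    then show "AE t in lborel. (\<lambda>n. F (Complex (\<delta> + real n) t)) \<longlonglongrightarrow> 0" by simp
  qed auto
  then have "(\<lambda>n::nat. line_integral \<delta> F) \<longlonglongrightarrow> 0" using const by simp
  then show ?thesis by (simp add: LIMSEQ_const_iff)
qed

lemma line_integral_reflect: "line_integral \<delta> F = line_integral (- \<delta>) (\<lambda>z. F (- z))"
proof -
  have "line_integral \<delta> F = (\<integral>t. F (Complex \<delta> (0 + (-1) * t)) \<partial>lborel)"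
    unfolding line_integral_def by (subst lborel_integral_real_affine[of "-1" _ 0]) auto
  also have "(\<lambda>t. F (Complex \<delta> (0 + (-1) * t))) = (\<lambda>t. F (- Complex (- \<delta>) t))"
    by (rule ext, rule arg_cong[of _ _ F]) (simp add: complex_eq_iff)
  finally show ?thesis by (simp add: line_integral_def)
qed

lemma line_integral_left_half_plane_eq_0:
  assumes "F holomorphic_on {z. Re z < b}" "\<And>z. Re z < b \<Longrightarrow> cmod (F z) \<le> C / (1 + (cmod z)\<^sup>2)"
    and "\<delta> < b"
  shows "line_integral \<delta> F = 0"
proof -
  have "(F \<circ> uminus) holomorphic_on half_plane (- b)"
    using assms(1) by (intro holomorphic_on_compose_gen[of uminus _ F "{z. Re z < b}"] holomorphic_intros)
      (auto simp: half_plane_def)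
  then have "half_plane_decay (- b) (\<lambda>z. F (- z))"
    using assms(2)[of "- _"] unfolding half_plane_decay_def
    by (auto simp: half_plane_def o_def intro!: exI[of _ C])
  then show ?thesis
    using assms(3) line_integral_half_plane_eq_0[of "- b" "\<lambda>z. F (- z)" "- \<delta>"]
    by (simp add: line_integral_reflect[of \<delta>])
qed

lemma integral_inverse_one_plus_square: "(\<integral>t. inverse (1 + (t::real)\<^sup>2) \<partial>lborel) = pi"
  using LBINT_inverse_1_plus_square
  by (simp add: interval_lebesgue_integral_def set_lebesgue_integral_def)

text \<open>The point \<open>2 \<delta> - \<mu>\<close> is the mirror image of \<open>\<mu>\<close> in the line, so the difference is a multiple of the
  Poisson kernel.  All other line integrals that get evaluated below are zero or reduce to this one.\<close>

lemma line_integral_Poisson: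
  assumes "\<mu> < \<delta>"
  shows "line_integral \<delta> (\<lambda>z. 1 / (of_real \<mu> - z) - 1 / (of_real (2 * \<delta> - \<mu>) - z)) = - 2 * of_real pi"
proof -
  define a where "a = \<delta> - \<mu>"
  have a: "a > 0" using assms by (simp add: a_def)
  have eq: "1 / (of_real \<mu> - Complex \<delta> t) - 1 / (of_real (2 * \<delta> - \<mu>) - Complex \<delta> t)
      = of_real (- 2 * a * inverse (a\<^sup>2 + t\<^sup>2))" for t
  proof -
    have m: "of_real \<mu> - Complex \<delta> t = - Complex a t" "of_real (2 * \<delta> - \<mu>) - Complex \<delta> t = Complex a (- t)"
      by (auto simp: complex_eq_iff a_def)
    have nz: "Complex a t \<noteq> 0" "Complex a (- t) \<noteq> 0" using a by (auto simp: complex_eq_iff)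
    have "1 / (- Complex a t) - 1 / Complex a (- t) = - (Complex a (- t) + Complex a t) / (Complex a t * Complex a (- t))"
      using nz by (simp add: field_simps)
    also have "Complex a t * Complex a (- t) = of_real (a\<^sup>2 + t\<^sup>2)"
      by (simp add: complex_eq_iff power2_eq_square)
    also have "Complex a (- t) + Complex a t = of_real (2 * a)" by (simp add: complex_eq_iff)
    finally show ?thesis unfolding m by (simp add: divide_inverse)
  qed
  have "(\<integral>t. - 2 * a * inverse (a\<^sup>2 + (t::real)\<^sup>2) \<partial>lborel) = \<bar>a\<bar> *\<^sub>R (\<integral>t. - 2 * a * inverse (a\<^sup>2 + (0 + a * t)\<^sup>2) \<partial>lborel)"
    using a by (intro lborel_integral_real_affine) auto
  also have "(\<lambda>t. - 2 * a * inverse (a\<^sup>2 + (0 + a * t)\<^sup>2)) = (\<lambda>t. (- 2 / a) * inverse (1 + t\<^sup>2))"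
  proof
    fix t
    have "a\<^sup>2 + (0 + a * t)\<^sup>2 = a\<^sup>2 * (1 + t\<^sup>2)" by (simp add: power2_eq_square algebra_simps)
    then show "- 2 * a * inverse (a\<^sup>2 + (0 + a * t)\<^sup>2) = (- 2 / a) * inverse (1 + t\<^sup>2)"
      using a by (simp add: inverse_mult_distrib power2_eq_square divide_inverse)
  qed
  also have "\<bar>a\<bar> *\<^sub>R (\<integral>t. (- 2 / a) * inverse (1 + (t::real)\<^sup>2) \<partial>lborel) = - 2 * pi"
    unfolding integral_mult_right_zero integral_inverse_one_plus_square using a by simp
  finally have J: "(\<integral>t. - 2 * a * inverse (a\<^sup>2 + (t::real)\<^sup>2) \<partial>lborel) = - 2 * pi" .
  show ?thesis
    unfolding line_integral_def eq integral_complex_of_real J by simp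
qed

section \<open>Vector-valued integrals and powers of linear fractions\<close>

lemma bounded_linear_scaleC_left: "bounded_linear (\<lambda>c. c *\<^sub>C (x::'a::complex_banach))"
proof (rule bounded_linear_intro)
  show "(r *\<^sub>R c) *\<^sub>C x = r *\<^sub>R (c *\<^sub>C x)" for r c
    by (simp add: scaleR_conv_of_real scaleC_scaleC[symmetric] scaleC_of_real)
  show "norm (c *\<^sub>C x) \<le> norm c * norm x" for c by (simp add: norm_scaleC)
qed (rule scaleC_add_left)

lemma bounded_bilinear_scaleC: "bounded_bilinear (\<lambda>c (x::'a::complex_banach). c *\<^sub>C x)"
proof
  show "(r *\<^sub>R c) *\<^sub>C x = r *\<^sub>R (c *\<^sub>C x)" "c *\<^sub>C (r *\<^sub>R x) = r *\<^sub>R (c *\<^sub>C x)" for r c and x :: 'a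
    by (simp_all add: scaleR_conv_of_real scaleC_of_real[symmetric, where 'a='a] scaleC_scaleC mult.commute)
  show "\<exists>K. \<forall>c (x::'a). norm (c *\<^sub>C x) \<le> norm c * norm x * K"
    by (intro exI[of _ 1]) (simp add: norm_scaleC)
qed (simp_all add: scaleC_add_left scaleC_add_right)

lemma continuous_on_scaleC:
  fixes f :: "'c::topological_space \<Rightarrow> 'a::complex_banach"
  assumes "continuous_on S c" "continuous_on S f"
  shows "continuous_on S (\<lambda>t. c t *\<^sub>C f t)"
  by (rule bounded_bilinear.continuous_on[OF bounded_bilinear_scaleC assms])

lemma graph_of_eq_iff: "graph_of S = graph_of T \<longleftrightarrow> S = T"
proof
  assume "graph_of S = graph_of T"
  then have "(x, blinfun_apply S x) \<in> graph_of T" for x by (auto simp: graph_of_def)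
  then have "blinfun_apply S x = blinfun_apply T x" for x by (auto simp: graph_of_def)
  then show "S = T" by (rule blinfun_eqI)
qed simp

text \<open>Compare with the integral of the majorant in the Cauchy criterion for improper integrals; only the
  completeness of the range is used.\<close>

lemma integrable_on_of_decay:
  fixes f :: "real \<Rightarrow> 'b::banach"
  assumes cont: "continuous_on UNIV f" and le: "\<And>t. norm (f t) \<le> C / (1 + t\<^sup>2)"
  shows "f integrable_on UNIV"
proof -
  define g where "g t = C / (1 + t\<^sup>2)" for t :: real
  have g: "g integrable_on UNIV"
    unfolding g_def by (rule integrable_on_lborel[OF integrable_inverse_one_plus_square])
  have gi: "g integrable_on cbox a b" for a b
    by (rule integrable_on_subcbox[OF g]) simp
  have fi: "f integrable_on cbox a b" for a b
    by (rule integrable_continuous[OF continuous_on_subset[OF cont]]) simp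
  show ?thesis
  proof (rule iffD2[OF integrable_alt_subset], intro conjI allI impI)
    show "(\<lambda>x. if x \<in> UNIV then f x else 0) integrable_on cbox a b" for a b using fi by simp
    fix e :: real assume e: "e > 0"
    have "\<forall>e>0. \<exists>B>0. \<forall>a b c d. ball 0 B \<subseteq> cbox a b \<and> cbox a b \<subseteq> cbox c d \<longrightarrow>
        norm (integral (cbox a b) g - integral (cbox c d) g) < e"
      using conjunct2[OF iffD1[OF integrable_alt_subset g]] by (simp only: UNIV_I if_True)
    then obtain B where B: "B > 0" "\<And>a b c d. ball 0 B \<subseteq> cbox a b \<Longrightarrow> cbox a b \<subseteq> cbox c d \<Longrightarrow>
        norm (integral (cbox a b) g - integral (cbox c d) g) < e"
      using e by meson
    show "\<exists>B>0. \<forall>a b c d. ball 0 B \<subseteq> cbox a b \<and> cbox a b \<subseteq> cbox c d \<longrightarrow>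
        norm (integral (cbox a b) (\<lambda>x. if x \<in> UNIV then f x else 0) -
          integral (cbox c d) (\<lambda>x. if x \<in> UNIV then f x else 0)) < e"
    proof (intro exI[of _ B] conjI allI impI B(1))
      fix a b c d :: real assume sub: "ball 0 B \<subseteq> cbox a b \<and> cbox a b \<subseteq> cbox c d"
      have "0 \<in> ball (0::real) B" using B(1) by simp
      with sub have "0 \<in> cbox a b" by blast
      then have abcd: "c \<le> a" "a \<le> b" "b \<le> d" using sub by auto
      have split: "integral (cbox c d) h = integral {c..a} h + integral (cbox a b) h + integral {b..d} h"
        if "\<And>a b. h integrable_on cbox a b" for h :: "real \<Rightarrow> 'c::banach"
      proof -
        have "integral {c..d} h = integral {c..b} h + integral {b..d} h"
          using that[of c d] abcd by (intro Henstock_Kurzweil_Integration.integral_combine[symmetric]) auto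
        also have "integral {c..b} h = integral {c..a} h + integral {a..b} h"
          using that[of c b] abcd by (intro Henstock_Kurzweil_Integration.integral_combine[symmetric]) auto
        finally show ?thesis by simp
      qed
      have le': "norm (integral {u..v} f) \<le> integral {u..v} g" for u v
        using fi[of u v] gi[of u v] le
        by (intro Henstock_Kurzweil_Integration.integral_norm_bound_integral) (auto simp: g_def)
      have "norm (integral (cbox a b) f - integral (cbox c d) f) \<le> norm (integral {c..a} f) + norm (integral {b..d} f)"
        unfolding split[of f, OF fi] 
        using norm_triangle_ineq4[of "- integral {b..d} f" "integral {c..a} f"] by (simp add: add.commute)
      also have "\<dots> \<le> integral {c..a} g + integral {b..d} g" by (intro add_mono le')
      also have "\<dots> = - (integral (cbox a b) g - integral (cbox c d) g)"
        unfolding split[of g, OF gi] by simp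
      also have "\<dots> \<le> norm (integral (cbox a b) g - integral (cbox c d) g)" by (simp only: real_norm_def)
      also have "\<dots> < e" using sub by (intro B) auto
      finally show "norm (integral (cbox a b) (\<lambda>x. if x \<in> UNIV then f x else 0) -
          integral (cbox c d) (\<lambda>x. if x \<in> UNIV then f x else 0)) < e" by simp
    qed
  qed
qed

lemma inverse_power_has_field_derivative:
  fixes \<mu> z :: complex
  assumes "z \<noteq> \<mu>"
  shows "((\<lambda>z. c / (\<mu> - z) ^ k) has_field_derivative of_nat k * c / (\<mu> - z) ^ Suc k) (at z)"
proof -
  have "((\<lambda>z. inverse (\<mu> - z)) has_field_derivative (inverse (\<mu> - z))\<^sup>2) (at z)"
    using assms by (auto intro!: derivative_eq_intros simp: power2_eq_square)
  note * = DERIV_cmult[OF DERIV_power[OF this, of k], of c]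
  have eq: "c * (of_nat k * ((inverse (\<mu> - z))\<^sup>2 * inverse (\<mu> - z) ^ (k - Suc 0)))
      = of_nat k * c / (\<mu> - z) ^ Suc k"
    by (cases k) (simp_all add: power2_eq_square divide_inverse power_inverse)
  show ?thesis
    using * unfolding eq by (simp only: divide_inverse power_inverse)
qed

lemma half_plane_decay_inverse_power:
  assumes "Re \<mu> < a" "k \<ge> 2"
  shows "half_plane_decay a (\<lambda>z. 1 / (\<mu> - z) ^ k)"
  using \<open>k \<ge> 2\<close>
proof (induction k rule: dec_induct)
  case (step k)
  then show ?case using half_plane_decay_divide[OF step.IH assms(1)] by (simp add: mult.commute)
qed (rule half_plane_decay_inverse_square[OF assms(1)])

section \<open>Resolvents of operators of half-plane type\<close>

locale half_plane_operator =
  fixes A :: "('a::complex_banach \<times> 'a) set" and \<omega> :: real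
  assumes half_plane_type: "half_plane_type \<omega> A"
begin

abbreviation R :: "complex \<Rightarrow> 'a \<Rightarrow>\<^sub>L 'a" where "R \<equiv> resolvent A"

abbreviation Rpow :: "complex \<Rightarrow> nat \<Rightarrow> 'a \<Rightarrow> 'a" where "Rpow z n \<equiv> blinfun_apply (R z) ^^ n"

lemma is_resolvent:
  assumes "Re z < \<omega>"
  shows "is_resolvent A z (R z)"
proof -
  have "closure (half_plane \<omega>) \<subseteq> {z. \<omega> \<le> Re z}"
    by (rule closure_minimal) (auto simp: half_plane_def closed_halfspace_Re_ge)
  then have "z \<in> resolvent_set A"
    using half_plane_type assms by (fastforce simp: half_plane_type_def op_spectrum_def)
  then obtain T where T: "is_resolvent A z T" by (auto simp: resolvent_set_def)
  then have "T' = T" if "is_resolvent A z T'" for T'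
    using that by (simp add: is_resolvent_def graph_of_eq_iff[symmetric])
  with T show ?thesis unfolding resolvent_def by (rule theI)
qed

lemma R_clinear: "Re z < \<omega> \<Longrightarrow> R z \<in> bounded_clinear"
  using is_resolvent by (simp add: is_resolvent_def)

lemma R_scaleC: "Re z < \<omega> \<Longrightarrow> R z (c *\<^sub>C x) = c *\<^sub>C R z x"
  by (rule bounded_clinear_scaleC[OF R_clinear])

lemma R_of_graph:
  assumes "Re z < \<omega>" "(x, u) \<in> A"
  shows "R z (z *\<^sub>C x - u) = x"
proof -
  have "(z *\<^sub>C x - u, x) \<in> graph_of (R z)"
    using is_resolvent[OF assms(1)] assms(2) unfolding is_resolvent_def by blast
  then show ?thesis by (auto simp: graph_of_def)
qed

lemma R_in_graph:
  assumes "Re z < \<omega>"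
  shows "(R z u, z *\<^sub>C R z u - u) \<in> A"
proof -
  have "(u, R z u) \<in> {(z *\<^sub>C x - y, x) | x y. (x, y) \<in> A}"
    using is_resolvent[OF assms] by (auto simp: is_resolvent_def graph_of_def)
  then obtain y where "(R z u, y) \<in> A" "u = z *\<^sub>C R z u - y" by auto
  moreover from this(2) have "y = z *\<^sub>C R z u - u" by (metis diff_diff_eq2 diff_add_cancel add_diff_cancel_left')
  ultimately show ?thesis by simp
qed

lemma resolvent_identity:
  assumes "Re z < \<omega>" "Re w < \<omega>"
  shows "R z x - R w x = (w - z) *\<^sub>C R z (R w x)"
proof -
  have "R w x = R z (z *\<^sub>C R w x - (w *\<^sub>C R w x - x))"
    using R_of_graph[OF assms(1) R_in_graph[OF assms(2)]] by simp
  also have "z *\<^sub>C R w x - (w *\<^sub>C R w x - x) = x - (w - z) *\<^sub>C R w x"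
    by (simp add: scaleC_diff_left)
  also have "R z \<dots> = R z x - (w - z) *\<^sub>C R z (R w x)"
    by (simp add: blinfun.diff_right R_scaleC[OF assms(1)])
  finally have eq: "R w x = R z x - (w - z) *\<^sub>C R z (R w x)" .
  have "u - v = t" if "v = u - t" for u v t :: 'a using that by simp
  from this[OF eq] show ?thesis .
qed

lemma R_commute:
  assumes "Re z < \<omega>" "Re w < \<omega>"
  shows "R z (R w x) = R w (R z x)"
proof (cases "z = w")
  case False
  have "(w - z) *\<^sub>C R z (R w x) = - ((z - w) *\<^sub>C R w (R z x))"
    unfolding resolvent_identity[OF assms, symmetric] resolvent_identity[OF assms(2,1), symmetric] by simp
  also have "\<dots> = (w - z) *\<^sub>C R w (R z x)" by (simp add: scaleC_minus_left[symmetric])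
  finally have "(w - z) *\<^sub>C (R z (R w x) - R w (R z x)) = 0" by (simp add: scaleC_diff_right)
  then have "cmod (w - z) * norm (R z (R w x) - R w (R z x)) = 0" by (simp only: norm_scaleC[symmetric] norm_zero)
  then show ?thesis using False by simp
qed simp

lemma R_power_commute:
  assumes "Re z < \<omega>" "Re w < \<omega>"
  shows "Rpow z n (R w x) = R w (Rpow z n x)"
  by (induction n) (simp_all add: R_commute[OF assms])

text \<open>The partial fraction form of the resolvent identity: applying \<open>R \<mu>\<close> gains a factor
  \<open>1 / (\<mu> - z)\<close> up to a term in which \<open>z\<close> occurs only in that factor.\<close>

lemma R_R_expand:
  assumes "Re z < \<omega>" "Re \<mu> < \<omega>" "z \<noteq> \<mu>" and y: "y \<in> dual"
  shows "blinfun_apply y (R z (R \<mu> x)) = (blinfun_apply y (R z x) - blinfun_apply y (R \<mu> x)) / (\<mu> - z)"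
proof -
  have "blinfun_apply y (R z x) - blinfun_apply y (R \<mu> x) = (\<mu> - z) * blinfun_apply y (R z (R \<mu> x))"
    unfolding functional_scaleC[OF y, symmetric] resolvent_identity[OF assms(1,2), symmetric]
    by (simp add: blinfun.diff_right)
  then show ?thesis using assms(3) by simp
qed

lemma R_inj:
  assumes z: "Re z < \<omega>" and eq: "R z u = R z v"
  shows "u = v"
proof -
  have "single_valued A" using half_plane_type by (simp add: half_plane_type_def linear_operator_def)
  then have "z *\<^sub>C R z u - u = z *\<^sub>C R z v - v"
    using R_in_graph[OF z, of u] R_in_graph[OF z, of v] eq by (auto dest: single_valuedD)
  then show ?thesis using eq by simp
qed

lemma R_power_inj:
  assumes z: "Re z < \<omega>" and eq: "Rpow z n u = Rpow z n v"
  shows "u = v"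
  using eq by (induction n) (auto dest: R_inj[OF z])

lemma R_dense:
  assumes z: "Re z < \<omega>"
  shows "closure (range (R z)) = UNIV"
proof -
  have "Domain A \<subseteq> range (R z)"
  proof
    fix x assume "x \<in> Domain A"
    then obtain u where "(x, u) \<in> A" by auto
    from R_of_graph[OF z this] show "x \<in> range (R z)" by (metis rangeI)
  qed
  then have "closure (Domain A) \<subseteq> closure (range (R z))" by (rule closure_mono)
  then show ?thesis using half_plane_type by (simp add: half_plane_type_def top.extremum_unique)
qed

lemma R_power_dense:
  assumes z: "Re z < \<omega>"
  shows "closure (range (\<lambda>x. Rpow z n x)) = UNIV"
proof (induction n)
  case (Suc n)
  have "range (R z) = (R z) ` closure (range (\<lambda>x. Rpow z n x))" using Suc by simp
  also have "\<dots> \<subseteq> closure ((R z) ` range (\<lambda>x. Rpow z n x))"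
    by (intro image_closure_subset closure_subset continuous_intros blinfun.continuous_on) auto
  also have "(R z) ` range (\<lambda>x. Rpow z n x) = range (\<lambda>x. Rpow z (Suc n) x)" by auto
  finally have "closure (range (R z)) \<subseteq> closure (range (\<lambda>x. Rpow z (Suc n) x))"
    by (simp add: closure_minimal)
  then show ?case using R_dense[OF z] by auto
qed simp

lemma R_bound:
  assumes "\<delta> < \<omega>"
  obtains M where "M > 0" "\<And>z. Re z \<le> \<delta> \<Longrightarrow> norm (R z) \<le> M"
proof -
  have "bdd_above ((\<lambda>z. norm (R z)) ` {z. Re z \<le> \<delta>})"
    using half_plane_type assms by (simp add: half_plane_type_def)
  then obtain M where "\<And>z. Re z \<le> \<delta> \<Longrightarrow> norm (R z) \<le> M" by (auto simp: bdd_above_def)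
  then show thesis by (intro that[of "max M 1"]) (auto simp: le_max_iff_disj)
qed

lemma norm_R_diff:
  assumes "Re z < \<omega>" "Re w < \<omega>"
  shows "norm (R w - R z) \<le> cmod (w - z) * norm (R z) * norm (R w)"
proof (rule norm_blinfun_bound)
  fix x
  have "norm (blinfun_apply (R w - R z) x) = cmod (z - w) * norm (R w (R z x))"
    using resolvent_identity[OF assms(2,1), of x] by (simp add: blinfun.diff_left norm_scaleC)
  also have "\<dots> \<le> cmod (w - z) * (norm (R w) * (norm (R z) * norm x))"
    by (subst norm_minus_commute)
      (intro mult_left_mono order.trans[OF norm_blinfun] mult_left_mono norm_blinfun norm_ge_zero)
  finally show "norm (blinfun_apply (R w - R z) x) \<le> cmod (w - z) * norm (R z) * norm (R w) * norm x"
    by (simp add: mult_ac)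
qed simp

lemma R_has_derivative:
  assumes z: "Re z < \<omega>"
  shows "(R has_derivative (\<lambda>h. h *\<^sub>C (- (R z o\<^sub>L R z)))) (at z)"
  unfolding has_derivative_at_alt
proof (intro conjI allI impI bounded_linear_scaleC_left)
  fix e :: real assume e: "e > 0"
  define \<delta> where "\<delta> = (Re z + \<omega>) / 2"
  have \<delta>: "Re z < \<delta>" "\<delta> < \<omega>" using z by (auto simp: \<delta>_def)
  obtain M where M: "M > 0" "\<And>w. Re w \<le> \<delta> \<Longrightarrow> norm (R w) \<le> M" using R_bound[OF \<delta>(2)] by blast
  let ?d = "min (\<delta> - Re z) (e / (M * M * M))"
  show "\<exists>d>0. \<forall>w. norm (w - z) < d \<longrightarrow>
      norm (R w - R z - (w - z) *\<^sub>C (- (R z o\<^sub>L R z))) \<le> e * norm (w - z)"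
  proof (intro exI[of _ ?d] conjI allI impI)
    fix w assume w: "norm (w - z) < ?d"
    then have Rew: "Re w \<le> \<delta>" using abs_Re_le_cmod[of "w - z"] by auto
    then have Rew': "Re w < \<omega>" using \<delta> by linarith
    have "R w - R z - (w - z) *\<^sub>C (- (R z o\<^sub>L R z)) = (z - w) *\<^sub>C ((R w - R z) o\<^sub>L R z)"
    proof (rule blinfun_eqI)
      fix x
      have "R w x - R z x = (z - w) *\<^sub>C R w (R z x)" by (rule resolvent_identity[OF Rew' z])
      then show "blinfun_apply (R w - R z - (w - z) *\<^sub>C (- (R z o\<^sub>L R z))) x
          = blinfun_apply ((z - w) *\<^sub>C ((R w - R z) o\<^sub>L R z)) x"
        using scaleC_minus_left[of "w - z" "R z (R z x)"]
        by (simp add: blinfun.diff_left blinfun.add_left scaleC_blinfun_apply blinfun.minus_left scaleC_diff_right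
            scaleC_minus_right)
    qed
    also have "norm \<dots> \<le> cmod (z - w) * (norm (R w - R z) * norm (R z))"
      by (simp add: norm_scaleC mult_left_mono norm_blinfun_compose)
    also have "\<dots> \<le> cmod (z - w) * ((cmod (w - z) * norm (R z) * norm (R w)) * norm (R z))"
      using norm_R_diff[OF z Rew'] by (intro mult_left_mono mult_right_mono) auto
    also have "\<dots> \<le> cmod (z - w) * ((cmod (w - z) * M * M) * M)"
      using M Rew \<delta> by (intro mult_left_mono mult_mono) auto
    also have "\<dots> = (cmod (w - z) * (M * M * M)) * norm (w - z)" by (simp add: norm_minus_commute mult_ac)
    also have "cmod (w - z) * (M * M * M) \<le> e" using w M(1) by (simp add: pos_less_divide_eq less_imp_le)
    finally show "norm (R w - R z - (w - z) *\<^sub>C (- (R z o\<^sub>L R z))) \<le> e * norm (w - z)"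
      by (simp add: mult_right_mono)
  qed (use \<delta> e M in auto)
qed

lemma R_power_has_derivative:
  assumes z: "Re z < \<omega>"
  shows "((\<lambda>z. Rpow z n x) has_derivative (\<lambda>h. h *\<^sub>C (- (of_nat n *\<^sub>C Rpow z (Suc n) x)))) (at z)"
proof (induction n)
  case (Suc n)
  have pc: "Rpow z n (R z v) = R z (Rpow z n v)" for v by (rule R_power_commute[OF z z])
  have "((\<lambda>w. R w (Rpow w n x)) has_derivative
      (\<lambda>h. R z (h *\<^sub>C (- (of_nat n *\<^sub>C Rpow z (Suc n) x))) + blinfun_apply (h *\<^sub>C (- (R z o\<^sub>L R z))) (Rpow z n x))) (at z)"
    by (rule bounded_bilinear.FDERIV[OF bounded_bilinear_blinfun_apply R_has_derivative[OF z] Suc])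
  moreover have "R z (h *\<^sub>C (- (of_nat n *\<^sub>C Rpow z (Suc n) x))) + blinfun_apply (h *\<^sub>C (- (R z o\<^sub>L R z))) (Rpow z n x)
      = h *\<^sub>C (- (of_nat (Suc n) *\<^sub>C Rpow z (Suc (Suc n)) x))" for h
    by (simp add: R_scaleC[OF z] blinfun.minus_right blinfun.minus_left scaleC_blinfun_apply
        scaleC_minus_right scaleC_add_left scaleC_add_right scaleC_diff_right pc)
  ultimately show ?case by simp
qed simp

lemma R_power_weak_derivative:
  assumes z: "Re z < \<omega>" and y: "y \<in> dual"
  shows "((\<lambda>z. blinfun_apply y (Rpow z n x)) has_field_derivative
    - (of_nat n * blinfun_apply y (Rpow z (Suc n) x))) (at z)"
proof -
  have "((\<lambda>z. blinfun_apply y (Rpow z n x)) has_derivative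
      (\<lambda>h. blinfun_apply y (h *\<^sub>C (- (of_nat n *\<^sub>C Rpow z (Suc n) x))))) (at z)"
    by (rule bounded_linear.has_derivative[OF blinfun.bounded_linear_right R_power_has_derivative[OF z]])
  moreover have "(\<lambda>h. blinfun_apply y (h *\<^sub>C (- (of_nat n *\<^sub>C Rpow z (Suc n) x))))
      = (*) (- (of_nat n * blinfun_apply y (Rpow z (Suc n) x)))"
    by (rule ext) (simp add: functional_scaleC[OF y] blinfun.minus_right del: funpow.simps)
  ultimately show ?thesis by (simp add: has_field_derivative_def)
qed

lemma R_power_weak_holomorphic:
  assumes y: "y \<in> dual"
  shows "(\<lambda>z. blinfun_apply y (Rpow z n x)) holomorphic_on {z. Re z < \<omega>}"
  using R_power_weak_derivative[OF _ y]
  by (subst holomorphic_on_open) (auto simp: open_halfspace_Re_lt simp del: funpow.simps)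

lemma norm_R_power:
  assumes "\<And>z. Re z \<le> \<delta> \<Longrightarrow> norm (R z) \<le> M" "Re z \<le> \<delta>"
  shows "norm (Rpow z n x) \<le> M ^ n * norm x"
proof (induction n)
  case (Suc n)
  have "norm (Rpow z (Suc n) x) \<le> norm (R z) * norm (Rpow z n x)" by (simp add: norm_blinfun)
  also have "\<dots> \<le> M * (M ^ n * norm x)"
    using Suc assms(1)[OF assms(2)] order.trans[OF norm_ge_zero assms(1)[OF assms(2)]]
    by (intro mult_mono) auto
  finally show ?case by (simp add: mult_ac)
qed simp

lemma R_power_strip_bounded:
  assumes y: "y \<in> dual"
  shows "strip_bounded a \<omega> (\<lambda>z. blinfun_apply y (Rpow z n x))"
  unfolding strip_bounded_def
proof (intro conjI allI impI)
  show "(\<lambda>z. blinfun_apply y (Rpow z n x)) holomorphic_on strip a \<omega>"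
    by (rule holomorphic_on_subset[OF R_power_weak_holomorphic[OF y]]) (auto simp: strip_def)
  fix a' b' assume "a < a' \<and> b' < \<omega>"
  then have "b' < \<omega>" ..
  then obtain M where M: "M > 0" "\<And>z. Re z \<le> b' \<Longrightarrow> norm (R z) \<le> M" by (rule R_bound) blast
  show "\<exists>C. \<forall>z. a' \<le> Re z \<and> Re z \<le> b' \<longrightarrow> cmod (blinfun_apply y (Rpow z n x)) \<le> C"
  proof (intro exI[of _ "norm y * (M ^ n * norm x)"] allI impI)
    fix z assume "a' \<le> Re z \<and> Re z \<le> b'"
    then show "cmod (blinfun_apply y (Rpow z n x)) \<le> norm y * (M ^ n * norm x)"
      using M by (intro order.trans[OF norm_blinfun] mult_left_mono norm_R_power[of b']) auto
  qed
qed

lemma R_strip_bounded: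
  assumes y: "y \<in> dual"
  shows "strip_bounded a \<omega> (\<lambda>z. blinfun_apply y (R z x))"
  using R_power_strip_bounded[OF y, of a 1 x] by simp

text \<open>The resolvent is only bounded on the left, but on the range of another resolvent the resolvent
  identity gives decay, and this range is dense.\<close>

lemma R_vanishes:
  assumes \<delta>: "\<delta> < \<omega>" and e: "e > 0"
  shows "\<exists>K. \<forall>z. Re z \<le> \<delta> \<and> K \<le> cmod z \<longrightarrow> norm (R z x) < e"
proof -
  obtain M where M: "M > 0" "\<And>z. Re z \<le> \<delta> \<Longrightarrow> norm (R z) \<le> M" using R_bound[OF \<delta>] by blast
  define \<mu> where "\<mu> = complex_of_real \<delta>"
  have \<mu>: "Re \<mu> < \<omega>" using \<delta> by (simp add: \<mu>_def)
  have "x \<in> closure (range (R \<mu>))" using R_dense[OF \<mu>] by simp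
  then obtain v where v: "dist (R \<mu> v) x < e / (2 * M)"
    unfolding closure_approachable using e M(1) by (metis divide_pos_pos mult_pos_pos rangeE zero_less_numeral)
  define K where "K = cmod \<mu> + (4 * M * norm v + 1) / e + 1"
  show ?thesis
  proof (intro exI[of _ K] allI impI)
    fix z assume z: "Re z \<le> \<delta> \<and> K \<le> cmod z"
    then have Rz: "Re z < \<omega>" using \<delta> by linarith
    have far: "(4 * M * norm v + 1) / e + 1 \<le> cmod (\<mu> - z)"
      using z norm_triangle_ineq2[of z \<mu>] by (simp add: K_def norm_minus_commute)
    have pos: "0 \<le> (4 * M * norm v + 1) / e" using M e by simp
    have "cmod (\<mu> - z) * norm (R z (R \<mu> v)) = norm (R z v - R \<mu> v)"
      unfolding resolvent_identity[OF Rz \<mu>] by (simp add: norm_scaleC)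
    also have "\<dots> \<le> M * norm v + M * norm v"
      using M(2)[of z] M(2)[of \<mu>] z
      by (intro order.trans[OF norm_triangle_ineq4] add_mono order.trans[OF norm_blinfun] mult_right_mono)
         (auto simp: \<mu>_def)
    also have "\<dots> < (e / 2) * ((4 * M * norm v + 1) / e + 1)" using e by (simp add: field_simps add_pos_pos)
    also have "\<dots> \<le> (e / 2) * cmod (\<mu> - z)" using far e by (intro mult_left_mono) auto
    finally have "cmod (\<mu> - z) * norm (R z (R \<mu> v)) < cmod (\<mu> - z) * (e / 2)" by (simp add: mult.commute)
    then have 1: "norm (R z (R \<mu> v)) < e / 2" using far pos by (subst (asm) mult_less_cancel_left_pos) linarith+
    have "norm (R z (x - R \<mu> v)) \<le> M * norm (x - R \<mu> v)"
      using M(2)[of z] z by (intro order.trans[OF norm_blinfun] mult_right_mono) auto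
    also have "\<dots> < M * (e / (2 * M))" using v M(1) by (intro mult_strict_left_mono) (auto simp: dist_norm norm_minus_commute)
    also have "\<dots> = e / 2" using M by simp
    finally have 2: "norm (R z (x - R \<mu> v)) < e / 2" .
    have "R z x = R z (R \<mu> v) + R z (x - R \<mu> v)" by (simp add: blinfun.diff_right)
    then show "norm (R z x) < e" using 1 2 norm_triangle_ineq[of "R z (R \<mu> v)" "R z (x - R \<mu> v)"] by simp
  qed
qed


section \<open>The elementary functional calculus\<close>

text \<open>From here on, operators given by vector-valued integrals are only handled through their pairings
  with functionals, which are Lebesgue integrals of scalar holomorphic functions.\<close>

lemma elem_calc_weak:
  assumes F: "strip_decay a \<omega> F" and \<alpha>: "a \<le> \<alpha>" "\<alpha> < \<omega>" and y: "y \<in> dual"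
  shows "blinfun_apply y (blinfun_apply (elem_calc \<omega> A \<alpha> F) x)
    = - (1 / (2 * of_real pi)) * line_integral ((\<alpha> + \<omega>) / 2) (\<lambda>z. F z * blinfun_apply y (R z x))"
proof -
  define \<delta> where "\<delta> = (\<alpha> + \<omega>) / 2"
  have \<delta>: "a < \<delta>" "\<delta> < \<omega>" using \<alpha> by (auto simp: \<delta>_def)
  let ?f = "\<lambda>t. F (Complex \<delta> t) *\<^sub>C R (Complex \<delta> t)"
  obtain M where M: "M > 0" "\<And>z. Re z \<le> \<delta> \<Longrightarrow> norm (R z) \<le> M" using R_bound[OF \<delta>(2)] by blast
  obtain C where C: "C \<ge> 0" "\<And>z. \<delta> \<le> Re z \<and> Re z \<le> \<delta> \<Longrightarrow> cmod (F z) \<le> C / (1 + (Im z)\<^sup>2)"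
    using strip_decayD(2)[OF F, of \<delta> \<delta>] \<delta> by blast
  have "continuous_on {z. Re z < \<omega>} R"
    using R_has_derivative by (intro continuous_at_imp_continuous_on) (auto dest: has_derivative_continuous)
  then have contR: "continuous_on UNIV (\<lambda>t. R (Complex \<delta> t))"
    by (rule continuous_on_compose2) (use \<delta> in \<open>auto simp: Complex_eq intro!: continuous_intros\<close>)
  have contF: "continuous_on UNIV (\<lambda>t. F (Complex \<delta> t))"
    using \<delta> by (intro line_continuous[OF strip_decayD(1)[OF F]]) (simp add: strip_def)
  have int: "?f integrable_on UNIV"
  proof (rule integrable_on_of_decay[of _ "C * M"])
    show "continuous_on UNIV ?f" by (rule continuous_on_scaleC[OF contF contR])
    fix t
    have "cmod (F (Complex \<delta> t)) * norm (R (Complex \<delta> t)) \<le> (C / (1 + t\<^sup>2)) * M"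
      using C(2)[of "Complex \<delta> t"] M(2)[of "Complex \<delta> t"] C(1) by (intro mult_mono) auto
    then show "norm (?f t) \<le> C * M / (1 + t\<^sup>2)" by (simp add: norm_scaleC)
  qed
  have bl: "bounded_linear (\<lambda>T. blinfun_apply y (blinfun_apply T x))"
    by (intro bounded_linear_compose[OF blinfun.bounded_linear_right] blinfun.bounded_linear_left)
  have comp: "(\<lambda>T. blinfun_apply y (blinfun_apply T x)) \<circ> ?f = (\<lambda>t. F (Complex \<delta> t) * blinfun_apply y (R (Complex \<delta> t) x))"
    by (rule ext) (simp add: scaleC_blinfun_apply functional_scaleC[OF y])
  have "integrable lborel (\<lambda>t. (\<lambda>z. blinfun_apply y (R z x) * F z) (Complex \<delta> t))"
    by (rule strip_decay_integrable[OF strip_decay_mult[OF R_strip_bounded[OF y] F] \<delta>])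
  then have "blinfun_apply y (blinfun_apply (integral UNIV ?f) x)
      = line_integral \<delta> (\<lambda>z. F z * blinfun_apply y (R z x))"
    unfolding integral_linear[OF int bl, symmetric] comp line_integral_def
    by (intro integral_lborel) (simp add: mult.commute)
  then show ?thesis
    unfolding elem_calc_def Let_def \<delta>_def[symmetric]
    by (simp add: blinfun.minus_left blinfun.scaleR_left blinfun.minus_right blinfun.scaleR_right scaleR_conv_of_real)
qed

text \<open>Multiplicativity of the elementary calculus when one factor is \<open>1 / (\<mu> - z)\<close>.  The term of the partial fraction that does not contain the
  resolvent integrates to \<open>0\<close> because it decays in a right half-plane.\<close>

lemma line_integral_mult_R:
  assumes F: "half_plane_decay a F" and \<mu>: "Re \<mu> < a" and \<delta>: "a < \<delta>" "\<delta> < \<omega>" and y: "y \<in> dual"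
  shows "line_integral \<delta> (\<lambda>z. F z * blinfun_apply y (R \<mu> (R z x)))
    = line_integral \<delta> (\<lambda>z. F z / (\<mu> - z) * blinfun_apply y (R z x))"
proof -
  have F': "half_plane_decay a (\<lambda>z. F z / (\<mu> - z))" by (rule half_plane_decay_divide[OF F \<mu>])
  have eq: "F z * blinfun_apply y (R \<mu> (R z x))
      = blinfun_apply y (R z x) * (F z / (\<mu> - z)) - blinfun_apply y (R \<mu> x) * (F z / (\<mu> - z))"
    if "z = Complex \<delta> t" for z t
  proof -
    have z: "Re z < \<omega>" "Re \<mu> < \<omega>" "z \<noteq> \<mu>" using that \<mu> \<delta> by auto
    then show ?thesis
      unfolding R_commute[OF z(2,1)] R_R_expand[OF z y] by (simp add: diff_divide_distrib algebra_simps)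
  qed
  have "integrable lborel (\<lambda>t. (\<lambda>z. blinfun_apply y (R z x) * (F z / (\<mu> - z))) (Complex \<delta> t))"
    by (rule strip_decay_integrable[OF strip_decay_mult[OF R_strip_bounded[OF y] half_plane_decay_strip[OF F']] \<delta>])
  moreover have "integrable lborel (\<lambda>t. (\<lambda>z. F z / (\<mu> - z)) (Complex \<delta> t))"
    by (rule strip_decay_integrable[OF half_plane_decay_strip[OF F'] \<delta>])
  ultimately have "line_integral \<delta> (\<lambda>z. F z * blinfun_apply y (R \<mu> (R z x)))
      = line_integral \<delta> (\<lambda>z. blinfun_apply y (R z x) * (F z / (\<mu> - z)))
        - blinfun_apply y (R \<mu> x) * line_integral \<delta> (\<lambda>z. F z / (\<mu> - z))"
    unfolding line_integral_def by (simp add: eq[OF refl] del: times_divide_eq_right)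
  then show ?thesis using line_integral_half_plane_eq_0[OF F' \<delta>(1)] by (simp add: mult.commute)
qed

lemma line_integral_mult_R_power:
  assumes F: "half_plane_decay a F" and \<mu>: "Re \<mu> < a" and \<delta>: "a < \<delta>" "\<delta> < \<omega>" and y: "y \<in> dual"
  shows "line_integral \<delta> (\<lambda>z. F z * blinfun_apply y (Rpow \<mu> k (R z x)))
    = line_integral \<delta> (\<lambda>z. F z / (\<mu> - z) ^ k * blinfun_apply y (R z x))"
proof (induction k arbitrary: x)
  case (Suc k)
  have \<mu>': "Re \<mu> < \<omega>" using \<mu> \<delta> by simp
  have "line_integral \<delta> (\<lambda>z. F z * blinfun_apply y (Rpow \<mu> (Suc k) (R z x)))
      = line_integral \<delta> (\<lambda>z. F z * blinfun_apply y (Rpow \<mu> k (R z (R \<mu> x))))"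
    unfolding line_integral_def using \<delta> R_commute[OF \<mu>', of "Complex \<delta> _" x]
    by (intro Bochner_Integration.integral_cong) (simp_all add: funpow_swap1)
  also have "\<dots> = line_integral \<delta> (\<lambda>z. F z / (\<mu> - z) ^ k * blinfun_apply y (R z (R \<mu> x)))"
    by (rule Suc.IH)
  also have "\<dots> = line_integral \<delta> (\<lambda>z. F z / (\<mu> - z) ^ k * blinfun_apply y (R \<mu> (R z x)))"
    unfolding line_integral_def using \<delta> R_commute[OF \<mu>', of "Complex \<delta> _" x]
    by (intro Bochner_Integration.integral_cong) simp_all
  also have "\<dots> = line_integral \<delta> (\<lambda>z. F z / (\<mu> - z) ^ k / (\<mu> - z) * blinfun_apply y (R z x))"
    by (rule line_integral_mult_R[OF half_plane_decay_divide_power[OF F \<mu>] \<mu> \<delta> y])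
  finally show ?case by (simp add: mult.commute)
qed simp

end

section \<open>Derivatives in the functional calculus\<close>

lemma Hinf_strip_bounded:
  assumes "f \<in> Hinf \<alpha>"
  shows "strip_bounded \<alpha> b f"
  unfolding strip_bounded_def
proof (intro conjI allI impI)
  show "f holomorphic_on strip \<alpha> b"
    using assms by (auto simp: Hinf_def strip_def half_plane_def elim: holomorphic_on_subset)
  fix a' b' assume a: "\<alpha> < a' \<and> b' < b"
  obtain K where "\<And>z. z \<in> half_plane \<alpha> \<Longrightarrow> cmod (f z) \<le> K"
    using assms by (auto simp: Hinf_def bounded_iff)
  then show "\<exists>C. \<forall>z. a' \<le> Re z \<and> Re z \<le> b' \<longrightarrow> cmod (f z) \<le> C"
    using a by (intro exI[of _ K]) (auto simp: half_plane_def)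
qed

lemma Hinf_norm_bound:
  assumes "f \<in> Hinf \<alpha>" "z \<in> half_plane \<alpha>"
  shows "cmod (f z) \<le> Hinf_norm \<alpha> f"
proof -
  obtain K where "\<And>z. z \<in> half_plane \<alpha> \<Longrightarrow> cmod (f z) \<le> K"
    using assms by (auto simp: Hinf_def bounded_iff)
  then show ?thesis unfolding Hinf_norm_def
    by (intro cSUP_upper assms bdd_aboveI2)
qed

lemma Hinf_norm_nonneg: "f \<in> Hinf \<alpha> \<Longrightarrow> 0 \<le> Hinf_norm \<alpha> f"
  by (rule order.trans[OF norm_ge_zero Hinf_norm_bound[of f \<alpha> "Complex (\<alpha> + 1) 0"]])
    (simp_all add: half_plane_def)

lemma HinfI:
  assumes "f holomorphic_on half_plane \<alpha>" "\<And>z. z \<in> half_plane \<alpha> \<Longrightarrow> cmod (f z) \<le> K"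
  shows "f \<in> Hinf \<alpha>" "Hinf_norm \<alpha> f \<le> K"
proof -
  show "f \<in> Hinf \<alpha>" using assms by (auto simp: Hinf_def bounded_iff)
  have "half_plane \<alpha> \<noteq> {}" by (auto simp: half_plane_def intro!: exI[of _ "Complex (\<alpha> + 1) 0"])
  then show "Hinf_norm \<alpha> f \<le> K" unfolding Hinf_norm_def using assms(2) by (intro cSUP_least)
qed

lemma strip_bounded_subset:
  assumes "strip_bounded a b F" "a \<le> a'" "b' \<le> b"
  shows "strip_bounded a' b' F"
  unfolding strip_bounded_def
proof (intro conjI allI impI)
  show "F holomorphic_on strip a' b'"
    using assms by (auto simp: strip_bounded_def strip_def elim!: holomorphic_on_subset)
  fix a'' b'' assume "a' < a'' \<and> b'' < b'"
  then have "a < a'' \<and> b'' < b" using assms by auto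
  then show "\<exists>C. \<forall>z. a'' \<le> Re z \<and> Re z \<le> b'' \<longrightarrow> cmod (F z) \<le> C"
    using assms(1) unfolding strip_bounded_def by blast
qed

context half_plane_operator begin

text \<open>The elementary calculus sends \<open>(\<mu> - z)\<^sup>-\<^sup>2\<close> to \<open>R(\<mu>)\<^sup>2\<close>.  Expanding the resolvent at \<open>\<mu>\<close> leaves a
  function \<open>h\<close> that is holomorphic to the left of the line and decays quadratically, a multiple of
  \<open>(\<mu> - z)\<^sup>-\<^sup>2\<close>, which closes to the right, and a Poisson kernel.\<close>

lemma line_integral_regularizer:
  assumes \<mu>: "\<mu> < \<delta>" and \<delta>: "\<delta> < \<omega>" and y: "y \<in> dual"
  shows "line_integral \<delta> (\<lambda>z. 1 / (of_real \<mu> - z)\<^sup>2 * blinfun_apply y (R z x))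
    = - 2 * of_real pi * blinfun_apply y (R (of_real \<mu>) (R (of_real \<mu>) x))"
proof -
  let ?\<mu> = "complex_of_real \<mu>" let ?\<nu> = "complex_of_real (2 * \<delta> - \<mu>)"
  have R\<mu>: "Re ?\<mu> < \<omega>" using \<mu> \<delta> by simp
  define r where "r z = blinfun_apply y (R z x)" for z
  define q where "q z = blinfun_apply y (R z (R ?\<mu> (R ?\<mu> x)))" for z
  define c1 where "c1 = blinfun_apply y (R ?\<mu> x)"
  define c2 where "c2 = blinfun_apply y (R ?\<mu> (R ?\<mu> x))"
  define h where "h z = q z + c2 / (?\<nu> - z)" for z
  define P where "P z = 1 / (?\<mu> - z) - 1 / (?\<nu> - z)" for z
  define e where "e z = 1 / (?\<mu> - z)\<^sup>2" for z
  \<comment> \<open>The bound \<open>b\<close> lies to the right of the line and to the left of \<open>\<omega>\<close> and of the pole at \<open>2 \<delta> - \<mu>\<close>.\<close>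
  define b where "b = (\<delta> + min \<omega> (2 * \<delta> - \<mu>)) / 2"
  have b: "\<delta> < b" "b < \<omega>" "b < 2 * \<delta> - \<mu>" using \<mu> \<delta> by (auto simp: b_def min_def)
  have expand: "q z = r z * e z - c1 * e z - c2 / (?\<mu> - z)" if "Re z < \<omega>" "z \<noteq> ?\<mu>" for z
  proof -
    have "q z = ((r z - c1) / (?\<mu> - z) - c2) / (?\<mu> - z)"
      using that R_R_expand[OF that(1) R\<mu> that(2) y] by (simp add: q_def r_def c1_def c2_def)
    also have "\<dots> = r z * e z - c1 * e z - c2 / (?\<mu> - z)"
      by (simp add: e_def diff_divide_distrib power2_eq_square)
    finally show ?thesis .
  qed
  then have eq: "r z * e z = h z + c1 * e z + c2 * P z" if "Re z < \<omega>" "z \<noteq> ?\<mu>" for z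
    using that by (simp add: h_def P_def algebra_simps)
  have Pe: "P z = (?\<nu> - ?\<mu>) * (1 / ((?\<mu> - z) * (?\<nu> - z)))" if "z \<noteq> ?\<mu>" "z \<noteq> ?\<nu>" for z
    using that by (simp add: P_def field_simps)
  have pos: "0 < 2 * \<delta> - \<mu> - b" using b by simp
  define K\<mu> where "K\<mu> = (1 + 2 * (cmod ?\<mu>)\<^sup>2) / 1\<^sup>2 + 2"
  define K\<nu> where "K\<nu> = (1 + 2 * (cmod ?\<nu>)\<^sup>2) / (2 * \<delta> - \<mu> - b)\<^sup>2 + 2"
  have far\<nu>: "2 * \<delta> - \<mu> - b \<le> cmod (?\<nu> - z)" if "Re z \<le> b" for z
    using abs_Re_le_cmod[of "?\<nu> - z"] that by auto
  have K\<nu>: "cmod (1 / (?\<nu> - z)\<^sup>2) \<le> K\<nu> / (1 + (cmod z)\<^sup>2)" if "Re z \<le> b" for z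
    unfolding K\<nu>_def by (rule inverse_square_decay[OF pos far\<nu>[OF that]])
  have K\<mu>: "cmod (e z) \<le> K\<mu> / (1 + (cmod z)\<^sup>2)" if "1 \<le> cmod (?\<mu> - z)" for z
    unfolding K\<mu>_def e_def using that by (intro inverse_square_decay) auto
  have P_le: "cmod (P z) \<le> cmod (?\<nu> - ?\<mu>) * ((K\<mu> + K\<nu>) / (1 + (cmod z)\<^sup>2))"
    if z: "Re z \<le> b" "\<epsilon> \<le> cmod (?\<mu> - z)" "\<epsilon> > 0" and eK: "cmod (e z) \<le> K\<mu> / (1 + (cmod z)\<^sup>2)" for z \<epsilon> K\<mu>
  proof -
    have nz: "z \<noteq> ?\<mu>" "z \<noteq> ?\<nu>" using far\<nu>[OF z(1)] pos z(2,3) by auto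
    have am: "u * v \<le> u\<^sup>2 + v\<^sup>2" for u v :: real
      using sum_squares_bound[of u v] sum_power2_ge_zero[of u v] by linarith
    have "cmod (1 / ((?\<mu> - z) * (?\<nu> - z))) \<le> cmod (e z) + cmod (1 / (?\<nu> - z)\<^sup>2)"
      using am[of "cmod (1 / (?\<mu> - z))" "cmod (1 / (?\<nu> - z))"]
      by (simp add: e_def norm_mult norm_divide norm_power power_divide)
    also have "\<dots> \<le> (K\<mu> + K\<nu>) / (1 + (cmod z)\<^sup>2)"
      using eK K\<nu>[OF z(1)] by (simp add: add_divide_distrib)
    finally show ?thesis unfolding Pe[OF nz] by (simp only: norm_mult mult_left_mono norm_ge_zero)
  qed
  obtain M where M: "M > 0" "\<And>z. Re z \<le> b \<Longrightarrow> norm (R z) \<le> M" using R_bound[OF b(2)] by blast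
  have y_R: "cmod (blinfun_apply y (R z v)) \<le> norm y * (M * norm v)" if "Re z \<le> b" for z v
    using M(2)[OF that]
    by (intro order.trans[OF norm_blinfun] mult_left_mono mult_right_mono) auto
  define C where "C = norm y * (M * norm x) * K\<mu> + cmod c1 * K\<mu> + cmod c2 * (cmod (?\<nu> - ?\<mu>) * (K\<mu> + K\<nu>))"
  define D where "D = (norm y * (M * norm (R ?\<mu> (R ?\<mu> x))) + cmod c2 / (2 * \<delta> - \<mu> - b)) * (1 + (1 + cmod ?\<mu>)\<^sup>2)"
  have h_le: "cmod (h z) \<le> max C D / (1 + (cmod z)\<^sup>2)" if z: "Re z < b" for z
  \<comment> \<open>Away from \<open>\<mu>\<close> the expansion gives the decay; near \<open>\<mu>\<close> its terms are singular, but \<open>h\<close> itself is bounded.\<close>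
  proof (cases "1 \<le> cmod (?\<mu> - z)")
    case True
    then have zn: "z \<noteq> ?\<mu>" by auto
    have hz: "h z = r z * e z - c1 * e z - c2 * P z"
      using eq[of z] z b zn by (simp add: algebra_simps)
    have "cmod (h z) \<le> cmod (r z * e z) + cmod (c1 * e z) + cmod (c2 * P z)"
      unfolding hz by (intro order.trans[OF norm_triangle_ineq4] add_mono norm_triangle_ineq4 order.refl)
    also have "\<dots> \<le> norm y * (M * norm x) * (K\<mu> / (1 + (cmod z)\<^sup>2)) + cmod c1 * (K\<mu> / (1 + (cmod z)\<^sup>2))
        + cmod c2 * (cmod (?\<nu> - ?\<mu>) * ((K\<mu> + K\<nu>) / (1 + (cmod z)\<^sup>2)))"
      unfolding norm_mult using z K\<mu>[OF True] P_le[of z 1 K\<mu>] True y_R[of z x] M(1)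
      by (intro add_mono mult_mono) (auto simp: r_def)
    also have "\<dots> = C / (1 + (cmod z)\<^sup>2)" by (simp add: C_def add_divide_distrib algebra_simps)
    also have "\<dots> \<le> max C D / (1 + (cmod z)\<^sup>2)" using one_plus_square_pos[of "cmod z"] by (intro divide_right_mono) auto
    finally show ?thesis .
  next
    case False
    then have "cmod z \<le> 1 + cmod ?\<mu>" using norm_triangle_ineq4[of ?\<mu> "?\<mu> - z"] by simp
    then have z1: "1 + (cmod z)\<^sup>2 \<le> 1 + (1 + cmod ?\<mu>)\<^sup>2" by (intro add_left_mono power_mono) auto
    have "cmod (c2 / (?\<nu> - z)) \<le> cmod c2 / (2 * \<delta> - \<mu> - b)"
      unfolding norm_divide using far\<nu>[of z] z pos by (intro divide_left_mono mult_pos_pos) auto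
    then have "cmod (h z) \<le> norm y * (M * norm (R ?\<mu> (R ?\<mu> x))) + cmod c2 / (2 * \<delta> - \<mu> - b)"
      unfolding h_def using y_R[of z] z
      by (intro order.trans[OF norm_triangle_ineq] add_mono) (auto simp: q_def)
    then have "cmod (h z) * (1 + (cmod z)\<^sup>2) \<le> D"
      unfolding D_def using z1 by (intro mult_mono) (auto intro: order.trans[OF norm_ge_zero])
    then have "cmod (h z) \<le> D / (1 + (cmod z)\<^sup>2)" using one_plus_square_pos[of "cmod z"] by (simp add: field_simps)
    also have "\<dots> \<le> max C D / (1 + (cmod z)\<^sup>2)" using one_plus_square_pos[of "cmod z"] by (intro divide_right_mono) auto
    finally show ?thesis .
  qed
  have h_hol: "h holomorphic_on {z. Re z < b}"
    unfolding h_def q_def using b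
    by (intro holomorphic_intros holomorphic_on_subset[OF R_power_weak_holomorphic[OF y, of 1, simplified]]) auto
  have h0: "line_integral \<delta> h = 0"
    by (rule line_integral_left_half_plane_eq_0[OF h_hol h_le b(1)])
  have e_decay: "half_plane_decay ((\<mu> + \<delta>) / 2) e"
    unfolding e_def using \<mu> by (intro half_plane_decay_inverse_square) simp
  have e0: "line_integral \<delta> e = 0"
    using \<mu> by (intro line_integral_half_plane_eq_0[OF e_decay]) simp
  have i1: "integrable lborel (\<lambda>t. e (Complex \<delta> t))"
    using \<mu> by (intro strip_decay_integrable[OF half_plane_decay_strip[OF e_decay, of "\<delta> + 1"]]) auto
  have i2: "integrable lborel (\<lambda>t. (\<lambda>z. r z * e z) (Complex \<delta> t))"
    using \<mu> \<delta> R_strip_bounded[OF y, of "(\<mu> + \<delta>) / 2" x] unfolding r_def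
    by (intro strip_decay_integrable[OF strip_decay_mult[OF _ half_plane_decay_strip[OF e_decay, of \<omega>]]]) auto
  have i3: "integrable lborel (\<lambda>t. h (Complex \<delta> t))"
  proof (rule integrable_of_decay)
    show "continuous_on UNIV (\<lambda>t. h (Complex \<delta> t))" by (rule line_continuous[OF h_hol]) (use b in simp)
    fix t
    have "cmod (h (Complex \<delta> t)) \<le> max C D / (1 + (cmod (Complex \<delta> t))\<^sup>2)"
      using b by (intro h_le) simp
    also have "\<dots> \<le> \<bar>max C D\<bar> / (1 + t\<^sup>2)"
      using one_plus_square_pos[of t] by (intro frac_le) (auto simp: cmod_power2)
    finally show "norm (h (Complex \<delta> t)) \<le> \<bar>max C D\<bar> / (1 + t\<^sup>2)" .
  qed
  have eqt: "c2 * P (Complex \<delta> t) = r (Complex \<delta> t) * e (Complex \<delta> t) - h (Complex \<delta> t) - c1 * e (Complex \<delta> t)" for t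
    using eq[of "Complex \<delta> t"] \<mu> \<delta> by (auto simp: complex_eq_iff)
  have "c2 * line_integral \<delta> P = (\<integral>t. c2 * P (Complex \<delta> t) \<partial>lborel)"
    unfolding line_integral_def by simp
  also have "\<dots> = line_integral \<delta> (\<lambda>z. r z * e z) - line_integral \<delta> h - c1 * line_integral \<delta> e"
    unfolding line_integral_def eqt using i1 i2 i3 by simp
  finally have "line_integral \<delta> (\<lambda>z. r z * e z) = c2 * (- 2 * of_real pi)"
    unfolding h0 e0 P_def line_integral_Poisson[OF \<mu>] by simp
  then show ?thesis by (simp add: r_def e_def c2_def mult.commute)
qed

lemma elem_calc_regularizer:
  assumes "\<alpha> < \<omega>"
  shows "elem_calc \<omega> A \<alpha> (\<lambda>z. 1 / (complex_of_real (\<alpha> - 1) - z)\<^sup>2)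
    = R (of_real (\<alpha> - 1)) o\<^sub>L R (of_real (\<alpha> - 1))"
proof (rule blinfun_eqI, rule functionals_separate)
  fix x and y :: "'a \<Rightarrow>\<^sub>L complex" assume y: "y \<in> dual"
  have "strip_decay \<alpha> \<omega> (\<lambda>z. 1 / (complex_of_real (\<alpha> - 1) - z)\<^sup>2)"
    by (intro half_plane_decay_strip half_plane_decay_inverse_square) simp
  from elem_calc_weak[OF this order.refl assms y, of x] line_integral_regularizer[of "\<alpha> - 1" "(\<alpha> + \<omega>) / 2" y x] assms y
  show "blinfun_apply y (blinfun_apply (elem_calc \<omega> A \<alpha> (\<lambda>z. 1 / (complex_of_real (\<alpha> - 1) - z)\<^sup>2)) x)
      = blinfun_apply y (blinfun_apply (R (of_real (\<alpha> - 1)) o\<^sub>L R (of_real (\<alpha> - 1))) x)"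
    by simp
qed

lemma regularized_higher_deriv_decay:
  assumes f: "f \<in> Hinf \<alpha>" and \<beta>: "\<alpha> < \<beta>" and \<mu>: "Re \<mu> < \<beta>"
  shows "strip_decay \<beta> b (\<lambda>z. 1 / (\<mu> - z)\<^sup>2 * (deriv ^^ m) f z)"
proof -
  have "strip_decay \<beta> b (\<lambda>z. (deriv ^^ m) f z * (1 / (\<mu> - z)\<^sup>2))"
  proof (rule strip_decay_mult)
    show "strip_bounded \<beta> b ((deriv ^^ m) f)"
      by (rule strip_bounded_higher_deriv, rule strip_bounded_subset[OF Hinf_strip_bounded[OF f, of b]])
        (use \<beta> in auto)
    show "strip_decay \<beta> b (\<lambda>z. 1 / (\<mu> - z)\<^sup>2)"
      by (rule half_plane_decay_strip, rule half_plane_decay_inverse_square[OF \<mu>])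
  qed
  then show ?thesis by (simp only: mult.commute)
qed

text \<open>The regularizer being the injective operator \<open>R(\<mu>)\<^sup>2\<close>, a bounded operator is \<open>f\<^sup>(\<^sup>m\<^sup>)(A)\<close> if and only if
  it satisfies the regularized identity, tested against functionals.\<close>

lemma deriv_calc_eq_graph_iff:
  fixes \<alpha> :: real
  defines "\<beta> \<equiv> (\<alpha> + \<omega>) / 2"
  defines "\<mu> \<equiv> complex_of_real (\<beta> - 1)"
  assumes \<alpha>: "\<alpha> < \<omega>" and f: "f \<in> Hinf \<alpha>"
  shows "deriv_calc \<omega> A \<alpha> m f = graph_of S \<longleftrightarrow>
    (\<forall>x. \<forall>y\<in>dual. blinfun_apply y (R \<mu> (R \<mu> (S x))) = - (1 / (2 * of_real pi)) *
      line_integral ((\<beta> + \<omega>) / 2) (\<lambda>z. 1 / (\<mu> - z)\<^sup>2 * (deriv ^^ m) f z * blinfun_apply y (R z x)))"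
    (is "_ \<longleftrightarrow> ?rhs")
proof -
  have \<beta>: "\<alpha> < \<beta>" "\<beta> < \<omega>" using \<alpha> by (auto simp: \<beta>_def)
  have R\<mu>: "Re \<mu> < \<omega>" using \<beta> by (simp add: \<mu>_def)
  let ?F = "\<lambda>z. 1 / (\<mu> - z)\<^sup>2 * (deriv ^^ m) f z"
  let ?E = "elem_calc \<omega> A \<beta> ?F"
  have calc: "deriv_calc \<omega> A \<alpha> m f = {(x, u). R \<mu> (R \<mu> u) = ?E x}"
    using elem_calc_regularizer[OF \<beta>(2)]
    by (simp add: deriv_calc_def Hinf_calc_def Let_def \<beta>_def[symmetric] \<mu>_def del: of_real_diff)
  have decay: "strip_decay \<beta> \<omega> ?F"
    by (rule regularized_higher_deriv_decay[OF f \<beta>(1)]) (simp add: \<mu>_def)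
  have E: "blinfun_apply y (?E x) = - (1 / (2 * of_real pi)) *
      line_integral ((\<beta> + \<omega>) / 2) (\<lambda>z. ?F z * blinfun_apply y (R z x))"
    if "y \<in> dual" for x y
    by (rule elem_calc_weak[OF decay order.refl \<beta>(2) that])
  have "deriv_calc \<omega> A \<alpha> m f = graph_of S \<longleftrightarrow> (\<forall>x. R \<mu> (R \<mu> (S x)) = ?E x)"
  proof
    assume "deriv_calc \<omega> A \<alpha> m f = graph_of S"
    moreover have "(x, blinfun_apply S x) \<in> graph_of S" for x by (auto simp: graph_of_def)
    ultimately show "\<forall>x. R \<mu> (R \<mu> (S x)) = ?E x" unfolding calc by auto
  next
    assume "\<forall>x. R \<mu> (R \<mu> (S x)) = ?E x"
    then have "R \<mu> (R \<mu> u) = ?E x \<longleftrightarrow> u = S x" for u x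
      by (metis R_inj[OF R\<mu>])
    then show "deriv_calc \<omega> A \<alpha> m f = graph_of S" unfolding calc by (auto simp: graph_of_def)
  qed
  also have "\<dots> \<longleftrightarrow> ?rhs"
    using E by (metis (no_types, lifting) functionals_separate)
  finally show ?thesis .
qed

text \<open>The central formula: \<open>m\<close> integrations by parts move the derivatives from \<open>f\<close> to the resolvent,
  and \<open>m\<close> derivatives of \<open>R(z)\<close> produce \<open>R(z)\<^bsup>m+1\<^esup>\<close>.  On the right-hand side \<open>f\<close> itself appears, so this
  is where \<open>\<parallel>f\<parallel>\<close> can enter instead of \<open>\<parallel>f\<^sup>(\<^sup>m\<^sup>)\<parallel>\<close>.  Expanding \<open>R(z)/(\<mu> - z)\<^sup>2\<close> at \<open>\<mu>\<close> also
  produces powers of \<open>1/(\<mu> - z)\<close>; after at least one differentiation all of them are at least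
  quadratic, hence integrate to \<open>0\<close> against \<open>f\<close> by closing the line to the right.\<close>

lemma regularized_by_parts:
  assumes f: "f \<in> Hinf \<alpha>" and \<mu>: "Re \<mu> < a" and a: "\<alpha> \<le> a" "a < \<delta>" "\<delta> < \<omega>"
    and m: "m \<ge> 1" and y: "y \<in> dual"
  shows "line_integral \<delta> (\<lambda>z. 1 / (\<mu> - z)\<^sup>2 * (deriv ^^ m) f z * blinfun_apply y (R z x))
    = fact m * line_integral \<delta> (\<lambda>z. f z * blinfun_apply y (Rpow z (Suc m) (R \<mu> (R \<mu> x))))"
proof -
  have R\<mu>: "Re \<mu> < \<omega>" using \<mu> a by simp
  define w where "w = R \<mu> (R \<mu> x)"
  define c1 where "c1 = blinfun_apply y (R \<mu> x)"
  define c2 where "c2 = blinfun_apply y w"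
  define H where "H z = blinfun_apply y (R z x) * (1 / (\<mu> - z)\<^sup>2)" for z
  define q where "q n z = blinfun_apply y (Rpow z n w)" for n z
  define D where "D i z = (- 1) ^ i * fact i * q (Suc i) z
      + (c1 * fact (Suc i) / (\<mu> - z) ^ Suc (Suc i) + c2 * fact i / (\<mu> - z) ^ Suc i)" for i z
  have sb: "strip_bounded a \<omega> f"
    by (rule strip_bounded_subset[OF Hinf_strip_bounded[OF f, of \<omega>]]) (use a in auto)
  have H: "strip_decay a \<omega> H"
    unfolding H_def using \<mu>
    by (intro strip_decay_mult R_strip_bounded[OF y] half_plane_decay_strip half_plane_decay_inverse_square)
  have H0: "H z = D 0 z" if "z \<in> strip a \<omega>" for z
  proof -
    have z: "Re z < \<omega>" "z \<noteq> \<mu>" using that \<mu> by (auto simp: strip_def)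
    then have "q 1 z = (((blinfun_apply y (R z x)) - c1) / (\<mu> - z) - c2) / (\<mu> - z)"
      using R_R_expand[OF z(1) R\<mu> z(2) y] by (simp add: q_def w_def c1_def c2_def)
    also have "\<dots> = H z - c1 / (\<mu> - z)\<^sup>2 - c2 / (\<mu> - z)"
      by (simp add: H_def diff_divide_distrib power2_eq_square)
    finally show ?thesis by (simp add: D_def power2_eq_square)
  qed
  have D: "(D i has_field_derivative D (Suc i) z) (at z)" if "z \<in> strip a \<omega>" for i z
  proof -
    have z: "Re z < \<omega>" "z \<noteq> \<mu>" using that \<mu> by (auto simp: strip_def)
    have d1: "(q (Suc i) has_field_derivative - (of_nat (Suc i) * q (Suc (Suc i)) z)) (at z)"
      unfolding q_def by (rule R_power_weak_derivative[OF z(1) y])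
    have "(D i has_field_derivative (- 1) ^ i * fact i * (- (of_nat (Suc i) * q (Suc (Suc i)) z))
        + (of_nat (Suc (Suc i)) * (c1 * fact (Suc i)) / (\<mu> - z) ^ Suc (Suc (Suc i))
          + of_nat (Suc i) * (c2 * fact i) / (\<mu> - z) ^ Suc (Suc i))) (at z)"
      unfolding D_def
      by (intro DERIV_add DERIV_cmult d1 inverse_power_has_field_derivative z(2))
    also have "(- 1) ^ i * fact i * (- (of_nat (Suc i) * q (Suc (Suc i)) z))
        + (of_nat (Suc (Suc i)) * (c1 * fact (Suc i)) / (\<mu> - z) ^ Suc (Suc (Suc i))
          + of_nat (Suc i) * (c2 * fact i) / (\<mu> - z) ^ Suc (Suc i)) = D (Suc i) z"
    proof -
      have f1: "of_nat (Suc (Suc i)) * (c1 * fact (Suc i)) = c1 * fact (Suc (Suc i))"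
        and f2: "of_nat (Suc i) * (c2 * fact i) = c2 * fact (Suc i)"
        by (simp_all add: fact_Suc[of "Suc i"] fact_Suc[of i] mult_ac del: of_nat_Suc)
      have "(- 1) ^ i * fact i * (- (of_nat (Suc i) * q (Suc (Suc i)) z)) = (- 1) ^ Suc i * fact (Suc i) * q (Suc (Suc i)) z"
        by (simp add: fact_Suc[of i] del: of_nat_Suc)
      then show ?thesis unfolding D_def f1 f2 by simp
    qed
    finally show ?thesis .
  qed
  have in_strip: "Complex \<delta> t \<in> strip a \<omega>" for t using a by (simp add: strip_def)
  have hd: "(deriv ^^ m) H (Complex \<delta> t) = D m (Complex \<delta> t)" for t
    by (rule higher_deriv_eqI[OF open_strip H0 D in_strip])
  have \<delta>: "a < \<delta>" "\<delta> < \<omega>" using a by auto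
  have fdec: "half_plane_decay a (\<lambda>z. f z * (1 / (\<mu> - z) ^ k))" if "k \<ge> 2" for k
  proof (rule half_plane_decay_mult)
    show "f holomorphic_on half_plane a"
      using f a by (auto simp: Hinf_def half_plane_def elim!: holomorphic_on_subset)
    show "cmod (f z) \<le> Hinf_norm \<alpha> f" if "z \<in> half_plane a" for z
      using that a by (intro Hinf_norm_bound[OF f]) (auto simp: half_plane_def)
  qed (rule half_plane_decay_inverse_power[OF \<mu> that])
  have zero: "line_integral \<delta> (\<lambda>z. f z * (1 / (\<mu> - z) ^ k)) = 0"
    and int: "integrable lborel (\<lambda>t. f (Complex \<delta> t) * (1 / (\<mu> - Complex \<delta> t) ^ k))" if "k \<ge> 2" for k
    using line_integral_half_plane_eq_0[OF fdec[OF that] \<delta>(1)]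
      strip_decay_integrable[OF half_plane_decay_strip[OF fdec[OF that], of \<omega>] \<delta>] by auto
  have strip_decay_hd: "strip_decay a \<omega> ((deriv ^^ k) H)" for k
    by (induction k) (auto intro: H strip_decay_deriv)
  have intD: "integrable lborel (\<lambda>t. f (Complex \<delta> t) * D m (Complex \<delta> t))"
    using strip_decay_integrable[OF strip_decay_mult[OF sb strip_decay_hd[of m]] \<delta>] by (simp add: hd)
  have split: "(- 1) ^ m * fact m * (f (Complex \<delta> t) * q (Suc m) (Complex \<delta> t))
      = f (Complex \<delta> t) * D m (Complex \<delta> t)
        - ((c1 * fact (Suc m)) * (f (Complex \<delta> t) * (1 / (\<mu> - Complex \<delta> t) ^ Suc (Suc m)))
          + (c2 * fact m) * (f (Complex \<delta> t) * (1 / (\<mu> - Complex \<delta> t) ^ Suc m)))" for t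
    unfolding D_def distrib_left by (simp del: fact_Suc power_Suc add: mult_ac)
  have "(- 1) ^ m * fact m * line_integral \<delta> (\<lambda>z. f z * q (Suc m) z)
      = (\<integral>t. (- 1) ^ m * fact m * (f (Complex \<delta> t) * q (Suc m) (Complex \<delta> t)) \<partial>lborel)"
    unfolding line_integral_def by (rule integral_mult_right_zero[symmetric])
  also have "\<dots> = line_integral \<delta> (\<lambda>z. f z * D m z)
      - ((c1 * fact (Suc m)) * line_integral \<delta> (\<lambda>z. f z * (1 / (\<mu> - z) ^ Suc (Suc m)))
        + (c2 * fact m) * line_integral \<delta> (\<lambda>z. f z * (1 / (\<mu> - z) ^ Suc m)))"
    unfolding split line_integral_def
    using intD int[of "Suc (Suc m)"] int[of "Suc m"] m
    by (subst Bochner_Integration.integral_diff) (auto simp del: times_divide_eq_right fact_Suc power_Suc)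
  also have "\<dots> = line_integral \<delta> (\<lambda>z. f z * D m z)"
    using zero[of "Suc (Suc m)"] zero[of "Suc m"] m by (simp del: times_divide_eq_right fact_Suc power_Suc)
  finally have *: "(- 1) ^ m * fact m * line_integral \<delta> (\<lambda>z. f z * q (Suc m) z) = line_integral \<delta> (\<lambda>z. f z * D m z)" .
  have "line_integral \<delta> (\<lambda>z. 1 / (\<mu> - z)\<^sup>2 * (deriv ^^ m) f z * blinfun_apply y (R z x))
      = line_integral \<delta> (\<lambda>z. (deriv ^^ m) f z * H z)"
    by (simp add: H_def mult_ac)
  also have "\<dots> = (- 1) ^ m * line_integral \<delta> (\<lambda>z. f z * (deriv ^^ m) H z)"
    by (rule line_integral_by_parts_iterated[OF sb H \<delta>])
  also have "line_integral \<delta> (\<lambda>z. f z * (deriv ^^ m) H z) = line_integral \<delta> (\<lambda>z. f z * D m z)"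
    unfolding line_integral_def by (simp add: hd)
  also have "\<dots> = (- 1) ^ m * fact m * line_integral \<delta> (\<lambda>z. f z * q (Suc m) z)" by (rule *[symmetric])
  also have "(- 1) ^ m * ((- 1) ^ m * fact m * line_integral \<delta> (\<lambda>z. f z * q (Suc m) z))
      = fact m * line_integral \<delta> (\<lambda>z. f z * q (Suc m) z)"
    by (simp add: mult.assoc[symmetric] power_mult_distrib[symmetric])
  finally show ?thesis by (simp only: q_def w_def)
qed

end

section \<open>Square functions along vertical lines\<close>

lemma gauss_norm_nonneg: "0 \<le> gauss_norm M \<gamma> N x"
  by (simp add: gauss_norm_def)

text \<open>The sums of length one give the norm of \<open>x\<close> up to a constant factor, so that the inequalities for
  Gaussian sums contain ordinary norm estimates.\<close>

lemma gauss_norm_single: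
  "gauss_norm M \<gamma> 1 (\<lambda>_. x) = sqrt (\<integral>s. (cmod (\<gamma> 0 s))\<^sup>2 \<partial>M) * norm x"
  by (simp add: gauss_norm_def norm_scaleC power_mult_distrib real_sqrt_mult)

definition derivative_family :: "nat \<Rightarrow> real \<Rightarrow> ('a::complex_banach \<times> 'a) set \<Rightarrow> ('a \<Rightarrow>\<^sub>L 'a) set"
  where "derivative_family m \<omega> A = (\<Union>\<alpha>\<in>{..<\<omega>}. {(\<omega> - \<alpha>) ^ m *\<^sub>R S | S f.
      f \<in> Hinf \<alpha> \<and> Hinf_norm \<alpha> f \<le> 1 \<and> S \<in> bounded_clinear \<and> deriv_calc \<omega> A \<alpha> m f = graph_of S})"

lemma strong_Wgamma_bounded_calculus_iff:
  "strong_Wgamma_bounded_calculus M \<gamma> m \<omega> A \<longleftrightarrow>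
    strong_bounded_calculus m \<omega> A \<and> Wgamma_bounded M \<gamma> (derivative_family m \<omega> A)"
  by (simp add: strong_Wgamma_bounded_calculus_def derivative_family_def)

lemma Wgamma_boundedE:
  fixes T :: "('a::complex_banach \<Rightarrow>\<^sub>L 'a) set"
  assumes "Wgamma_bounded M \<gamma> T"
  obtains C where "C \<ge> 0"
    "\<And>N T' x y. (\<forall>n<N. T' n \<in> T) \<and> (\<forall>n<N. y n \<in> dual) \<Longrightarrow>
      (\<Sum>n<N. cmod (blinfun_apply (y n) (blinfun_apply (T' n) (x n)))) \<le> C * gauss_norm M \<gamma> N x * gauss_norm M \<gamma> N y"
proof -
  obtain C where C: "\<And>N T' x y. (\<forall>n<N. T' n \<in> T) \<and> (\<forall>n<N. y n \<in> dual) \<Longrightarrow>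
      (\<Sum>n<N. cmod (blinfun_apply (y n) (blinfun_apply (T' n) (x n)))) \<le> C * gauss_norm M \<gamma> N x * gauss_norm M \<gamma> N y"
    using assms unfolding Wgamma_bounded_def by blast
  show thesis
  proof (rule that[of "max C 0"])
    fix N :: nat and T' and x :: "nat \<Rightarrow> 'a" and y :: "nat \<Rightarrow> 'a \<Rightarrow>\<^sub>L complex"
    assume *: "(\<forall>n<N. T' n \<in> T) \<and> (\<forall>n<N. y n \<in> dual)"
    show "(\<Sum>n<N. cmod (blinfun_apply (y n) (blinfun_apply (T' n) (x n))))
        \<le> max C 0 * gauss_norm M \<gamma> N x * gauss_norm M \<gamma> N y"
      by (rule order.trans[OF C[OF *]]) (auto intro!: mult_right_mono gauss_norm_nonneg)
  qed simp
qed

context half_plane_operator begin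

definition vertical_norm :: "nat \<Rightarrow> real \<Rightarrow> 'a \<Rightarrow> ('a \<Rightarrow>\<^sub>L complex) \<Rightarrow> ennreal"
  where "vertical_norm k \<delta> x y =
    (\<integral>\<^sup>+t. ennreal (cmod (blinfun_apply y (Rpow (Complex \<delta> t) k x))) \<partial>lborel)"

lemma continuous_R_power_line:
  assumes "\<delta> < \<omega>" "y \<in> dual"
  shows "continuous_on UNIV (\<lambda>t. blinfun_apply y (Rpow (Complex \<delta> t) k x))"
  using line_continuous[OF R_power_weak_holomorphic[OF assms(2)]] assms(1) by simp

lemma measurable_R_power_line [measurable]:
  assumes "\<delta> < \<omega>" "y \<in> dual"
  shows "(\<lambda>t. blinfun_apply y (Rpow (Complex \<delta> t) k x)) \<in> borel_measurable borel"
  by (rule borel_measurable_continuous_onI[OF continuous_R_power_line[OF assms]])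

lemma Wgamma_GFS_iff:
  "Wgamma_GFS M \<gamma> m \<omega> A \<longleftrightarrow> (\<exists>C\<ge>0. \<forall>N \<alpha> x y. (\<forall>k<N. \<alpha> k < \<omega>) \<and> (\<forall>k<N. y k \<in> dual) \<longrightarrow>
    (\<Sum>k<N. ennreal ((\<omega> - \<alpha> k) ^ m) * vertical_norm (Suc m) (\<alpha> k) (x k) (y k))
      \<le> ennreal (C * gauss_norm M \<gamma> N x * gauss_norm M \<gamma> N y))"
proof -
  have eq: "(\<integral>\<^sup>+t. ennreal (cmod (blinfun_apply y
        ((\<omega> - \<alpha>) ^ m *\<^sub>R Rpow (Complex \<alpha> t) ((m + 1)) x))) \<partial>lborel)
      = ennreal ((\<omega> - \<alpha>) ^ m) * vertical_norm (Suc m) \<alpha> x y"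
    if "\<alpha> < \<omega>" "y \<in> dual" for \<alpha> x and y :: "'a \<Rightarrow>\<^sub>L complex"
    unfolding vertical_norm_def using that measurable_R_power_line[OF that, of "Suc m" x]
    by (subst nn_integral_cmult[symmetric])
      (auto simp: blinfun.scaleR_right ennreal_mult' simp del: funpow.simps)
  have sum_eq: "(\<Sum>k<N. \<integral>\<^sup>+t. ennreal (cmod (blinfun_apply (y k)
        ((\<omega> - \<alpha> k) ^ m *\<^sub>R Rpow (Complex (\<alpha> k) t) ((m + 1)) (x k)))) \<partial>lborel)
      = (\<Sum>k<N. ennreal ((\<omega> - \<alpha> k) ^ m) * vertical_norm (Suc m) (\<alpha> k) (x k) (y k))"
    if "(\<forall>k<N. \<alpha> k < \<omega>) \<and> (\<forall>k<N. y k \<in> dual)" for N \<alpha> x and y :: "nat \<Rightarrow> 'a \<Rightarrow>\<^sub>L complex"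
    using that by (intro sum.cong refl eq) auto
  show ?thesis
  proof
    assume "Wgamma_GFS M \<gamma> m \<omega> A"
    then obtain C where C: "C > 0" "\<And>N \<alpha> x y. (\<forall>k<N. \<alpha> k < \<omega>) \<and> (\<forall>k<N. y k \<in> dual) \<Longrightarrow>
        (\<Sum>k<N. \<integral>\<^sup>+t. ennreal (cmod (blinfun_apply (y k)
          ((\<omega> - \<alpha> k) ^ m *\<^sub>R Rpow (Complex (\<alpha> k) t) ((m + 1)) (x k)))) \<partial>lborel)
        \<le> ennreal (C * gauss_norm M \<gamma> N x * gauss_norm M \<gamma> N y)"
      unfolding Wgamma_GFS_def by blast
    show "\<exists>C\<ge>0. \<forall>N \<alpha> x y. (\<forall>k<N. \<alpha> k < \<omega>) \<and> (\<forall>k<N. y k \<in> dual) \<longrightarrow>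
      (\<Sum>k<N. ennreal ((\<omega> - \<alpha> k) ^ m) * vertical_norm (Suc m) (\<alpha> k) (x k) (y k))
        \<le> ennreal (C * gauss_norm M \<gamma> N x * gauss_norm M \<gamma> N y)"
    proof (intro exI[of _ C] conjI allI impI)
      fix N :: nat and \<alpha> :: "nat \<Rightarrow> real" and x :: "nat \<Rightarrow> 'a" and y :: "nat \<Rightarrow> 'a \<Rightarrow>\<^sub>L complex"
      assume *: "(\<forall>k<N. \<alpha> k < \<omega>) \<and> (\<forall>k<N. y k \<in> dual)"
      show "(\<Sum>k<N. ennreal ((\<omega> - \<alpha> k) ^ m) * vertical_norm (Suc m) (\<alpha> k) (x k) (y k))
          \<le> ennreal (C * gauss_norm M \<gamma> N x * gauss_norm M \<gamma> N y)"
        unfolding sum_eq[OF *, symmetric] by (rule C(2)[OF *])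
    qed (use C(1) in simp)
  next
    assume "\<exists>C\<ge>0. \<forall>N \<alpha> x y. (\<forall>k<N. \<alpha> k < \<omega>) \<and> (\<forall>k<N. y k \<in> dual) \<longrightarrow>
      (\<Sum>k<N. ennreal ((\<omega> - \<alpha> k) ^ m) * vertical_norm (Suc m) (\<alpha> k) (x k) (y k))
        \<le> ennreal (C * gauss_norm M \<gamma> N x * gauss_norm M \<gamma> N y)"
    then obtain C where C: "C \<ge> 0" "\<And>N \<alpha> x y. (\<forall>k<N. \<alpha> k < \<omega>) \<and> (\<forall>k<N. y k \<in> dual) \<Longrightarrow>
      (\<Sum>k<N. ennreal ((\<omega> - \<alpha> k) ^ m) * vertical_norm (Suc m) (\<alpha> k) (x k) (y k))
        \<le> ennreal (C * gauss_norm M \<gamma> N x * gauss_norm M \<gamma> N y)" by blast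
    show "Wgamma_GFS M \<gamma> m \<omega> A"
      unfolding Wgamma_GFS_def
    proof (intro exI[of _ "C + 1"] conjI allI impI)
      fix N :: nat and \<alpha> :: "nat \<Rightarrow> real" and x :: "nat \<Rightarrow> 'a" and y :: "nat \<Rightarrow> 'a \<Rightarrow>\<^sub>L complex"
      assume *: "(\<forall>k<N. \<alpha> k < \<omega>) \<and> (\<forall>k<N. y k \<in> dual)"
      have "ennreal (C * gauss_norm M \<gamma> N x * gauss_norm M \<gamma> N y)
          \<le> ennreal ((C + 1) * gauss_norm M \<gamma> N x * gauss_norm M \<gamma> N y)"
        by (intro ennreal_leI mult_right_mono gauss_norm_nonneg) auto
      then show "(\<Sum>k<N. \<integral>\<^sup>+t. ennreal (cmod (blinfun_apply (y k)
          ((\<omega> - \<alpha> k) ^ m *\<^sub>R Rpow (Complex (\<alpha> k) t) ((m + 1)) (x k)))) \<partial>lborel)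
        \<le> ennreal ((C + 1) * gauss_norm M \<gamma> N x * gauss_norm M \<gamma> N y)"
        unfolding sum_eq[OF *] using C(2)[OF *] by (rule order.trans[rotated])
    qed (use C(1) in simp)
  qed
qed

lemma line_integral_weak_bound:
  assumes \<delta>: "\<delta> < \<omega>" and y: "y \<in> dual" and fin: "vertical_norm k \<delta> x y < \<top>"
    and cont: "continuous_on UNIV (\<lambda>t. f (Complex \<delta> t))" and f: "\<And>t. cmod (f (Complex \<delta> t)) \<le> F" 
  shows "integrable lborel (\<lambda>t. f (Complex \<delta> t) * blinfun_apply y (Rpow (Complex \<delta> t) k x))"
    and "ennreal (cmod (line_integral \<delta> (\<lambda>z. f z * blinfun_apply y (Rpow z k x))))
      \<le> ennreal F * vertical_norm k \<delta> x y"
proof -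
  let ?q = "\<lambda>t. blinfun_apply y (Rpow (Complex \<delta> t) k x)"
  have F: "F \<ge> 0" using f[of 0] norm_ge_zero[of "f (Complex \<delta> 0)"] by linarith
  note [measurable] = measurable_R_power_line[OF \<delta> y] borel_measurable_continuous_onI[OF cont]
  have "(\<integral>\<^sup>+t. ennreal (norm (f (Complex \<delta> t) * ?q t)) \<partial>lborel)
      \<le> (\<integral>\<^sup>+t. ennreal F * ennreal (cmod (?q t)) \<partial>lborel)"
    using f F by (intro nn_integral_mono) (simp add: norm_mult ennreal_mult'[symmetric] ennreal_leI mult_right_mono)
  also have "\<dots> = ennreal F * vertical_norm k \<delta> x y"
    unfolding vertical_norm_def by (intro nn_integral_cmult) measurable
  finally have le: "(\<integral>\<^sup>+t. ennreal (norm (f (Complex \<delta> t) * ?q t)) \<partial>lborel) \<le> ennreal F * vertical_norm k \<delta> x y" .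
  show int: "integrable lborel (\<lambda>t. f (Complex \<delta> t) * ?q t)"
  proof (rule integrableI_bounded)
    have "ennreal F * vertical_norm k \<delta> x y < \<top>" using fin by (simp add: ennreal_mult_less_top)
    with le show "(\<integral>\<^sup>+t. ennreal (norm (f (Complex \<delta> t) * ?q t)) \<partial>lborel) < \<infinity>" by (simp add: order.strict_trans1)
  qed measurable
  show "ennreal (cmod (line_integral \<delta> (\<lambda>z. f z * blinfun_apply y (Rpow z k x))))
      \<le> ennreal F * vertical_norm k \<delta> x y"
    unfolding line_integral_def
    by (rule order.trans[OF integral_norm_bound_ennreal[OF int] le])
qed

text \<open>The integral over the line \<open>Re z = \<delta>\<close> of \<open>f\<close> against \<open>\<langle>R(z)\<^bsup>m+1\<^esup> x, y\<rangle>\<close> is a bounded bilinear form.  By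
  the formula for integration by parts it is represented by vectors on the range of \<open>R(\<mu>)\<^sup>2\<close>, which is
  dense, hence by an operator, and the same formula identifies this operator with \<open>f\<^sup>(\<^sup>m\<^sup>)(A)\<close>.  The
  line is the one fixed by the definition of the calculus, at distance \<open>(\<omega> - \<alpha>) / 4\<close> from \<open>\<omega>\<close>,
  which accounts for the factor \<open>4 ^ m\<close>.\<close>

lemma weak_calculus_operator:
  assumes K: "K \<ge> 0" "\<And>\<delta> x y. \<delta> < \<omega> \<Longrightarrow> y \<in> dual \<Longrightarrow>
      vertical_norm (Suc m) \<delta> x y \<le> ennreal (K / (\<omega> - \<delta>) ^ m * norm x * norm y)"
    and m: "m \<ge> 1" and \<alpha>: "\<alpha> < \<omega>" and f: "f \<in> Hinf \<alpha>"
  obtains S where "S \<in> bounded_clinear" "deriv_calc \<omega> A \<alpha> m f = graph_of S"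
    "norm S \<le> (fact m * 4 ^ m * K) / (\<omega> - \<alpha>) ^ m * Hinf_norm \<alpha> f"
    "\<And>x y. y \<in> dual \<Longrightarrow> ennreal (cmod (blinfun_apply y (blinfun_apply S x)))
      \<le> ennreal (fact m * Hinf_norm \<alpha> f) * vertical_norm (Suc m) (\<omega> - (\<omega> - \<alpha>) / 4) x y"
proof -
  define \<beta> where "\<beta> = (\<alpha> + \<omega>) / 2"
  define \<delta> where "\<delta> = (\<beta> + \<omega>) / 2"
  define \<mu> where "\<mu> = complex_of_real (\<beta> - 1)"
  define c where "c = - (fact m / (2 * complex_of_real pi))"
  define F where "F = Hinf_norm \<alpha> f"
  define B where "B x y = c * line_integral \<delta> (\<lambda>z. f z * blinfun_apply y (Rpow z (Suc m) x))" for x y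
  have ord: "\<alpha> < \<beta>" "\<beta> < \<delta>" "\<delta> < \<omega>" using \<alpha> by (auto simp: \<beta>_def \<delta>_def)
  have \<delta>_eq: "\<delta> = \<omega> - (\<omega> - \<alpha>) / 4" by (simp add: \<delta>_def \<beta>_def field_simps)
  have R\<mu>: "Re \<mu> < \<omega>" "Re \<mu> < \<beta>" using ord by (auto simp: \<mu>_def)
  have F: "F \<ge> 0" unfolding F_def by (rule Hinf_norm_nonneg[OF f])
  have cont: "continuous_on UNIV (\<lambda>t. f (Complex \<delta> t))"
    using f ord by (intro line_continuous[of f "half_plane \<alpha>"]) (auto simp: Hinf_def half_plane_def)
  have fF: "cmod (f (Complex \<delta> t)) \<le> F" for t
    unfolding F_def using ord by (intro Hinf_norm_bound[OF f]) (simp add: half_plane_def)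
  have cc: "cmod c \<le> fact m"
  proof -
    have "cmod c = fact m / (2 * pi)" by (simp add: c_def norm_divide norm_mult)
    also have "\<dots> \<le> fact m / 1" using pi_gt3 by (intro divide_left_mono) auto
    finally show ?thesis by simp
  qed
  have fin: "vertical_norm (Suc m) \<delta> x y < \<top>" if "y \<in> dual" for x y
    by (rule le_less_trans[OF K(2)[OF ord(3) that]]) simp
  note int = line_integral_weak_bound(1)[OF ord(3) _ fin cont fF]
  have B_le: "ennreal (cmod (B x y)) \<le> ennreal (fact m * F) * vertical_norm (Suc m) \<delta> x y"
    if y: "y \<in> dual" for x y
  proof -
    have "ennreal (cmod (B x y)) = ennreal (cmod c) * ennreal (cmod (line_integral \<delta> (\<lambda>z. f z * blinfun_apply y (Rpow z (Suc m) x))))"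
      by (simp add: B_def norm_mult ennreal_mult del: funpow.simps)
    also have "\<dots> \<le> ennreal (fact m) * (ennreal F * vertical_norm (Suc m) \<delta> x y)"
      using cc by (intro mult_mono line_integral_weak_bound(2)[OF ord(3) y fin[OF y] cont fF] ennreal_leI) auto
    finally show ?thesis using F by (simp add: ennreal_mult mult.assoc)
  qed
  have B_norm: "cmod (B x y) \<le> (fact m * 4 ^ m * K) / (\<omega> - \<alpha>) ^ m * F * norm x * norm y"
    if y: "y \<in> dual" for x y
  proof -
    have "ennreal (cmod (B x y)) \<le> ennreal (fact m * F) * ennreal (K / (\<omega> - \<delta>) ^ m * norm x * norm y)"
      by (intro order.trans[OF B_le[OF y]] mult_left_mono K(2) ord y) auto
    also have "\<dots> = ennreal ((fact m * F) * (K / (\<omega> - \<delta>) ^ m * norm x * norm y))"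
      using F by (intro ennreal_mult'[symmetric]) auto
    finally have "cmod (B x y) \<le> (fact m * F) * (K / (\<omega> - \<delta>) ^ m * norm x * norm y)"
      using F K(1) ord by (subst (asm) ennreal_le_iff) auto
    also have "\<omega> - \<delta> = (\<omega> - \<alpha>) / 4" by (simp add: \<delta>_eq)
    finally show ?thesis by (simp add: power_divide mult_ac)
  qed
  have part: "- (1 / (2 * of_real pi)) * line_integral \<delta> (\<lambda>z. 1 / (\<mu> - z)\<^sup>2 * (deriv ^^ m) f z * blinfun_apply y (R z x))
      = B (R \<mu> (R \<mu> x)) y" if "y \<in> dual" for x y
    unfolding regularized_by_parts[OF f R\<mu>(2) less_imp_le[OF ord(1)] ord(2,3) m that] by (simp add: B_def c_def)
  have decay: "strip_decay \<beta> \<omega> (\<lambda>z. 1 / (\<mu> - z)\<^sup>2 * (deriv ^^ m) f z)"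
    by (rule regularized_higher_deriv_decay[OF f ord(1)]) (simp add: \<mu>_def)
  have \<beta>\<omega>: "\<beta> < \<omega>" using ord by simp
  obtain S where S: "S \<in> bounded_clinear" "norm S \<le> (fact m * 4 ^ m * K) / (\<omega> - \<alpha>) ^ m * F"
      "\<And>x y. y \<in> dual \<Longrightarrow> blinfun_apply y (blinfun_apply S x) = B x y"
  proof (rule weak_operator[where B = B and D = "range (\<lambda>x. Rpow \<mu> 2 x)"])
    have R\<delta>: "Re (Complex \<delta> t) < \<omega>" for t using ord by simp
    have padd: "Rpow z n (x + x') = Rpow z n x + Rpow z n x'"
      for z n x x' by (induction n) (simp_all add: blinfun.add_right)
    have pscale: "Rpow z n (c *\<^sub>C x) = c *\<^sub>C Rpow z n x"
      if "Re z < \<omega>" for z n c x by (induction n) (simp_all add: R_scaleC[OF that])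
    show "B (x + x') y = B x y + B x' y" if y: "y \<in> dual" for x x' y
      unfolding B_def line_integral_def padd blinfun.add_right distrib_left
      using int[OF y, of x] int[OF y, of x'] y by (subst Bochner_Integration.integral_add) (auto simp: distrib_left)
    show "B (a *\<^sub>C x) y = a * B x y" if y: "y \<in> dual" for a x y
      unfolding B_def line_integral_def pscale[OF R\<delta>] functional_scaleC[OF y]
      by (simp only: mult.left_commute[of _ a] integral_mult_right_zero)
    show "cmod (B x y) \<le> (fact m * 4 ^ m * K) / (\<omega> - \<alpha>) ^ m * F * norm x * norm y"
      if "y \<in> dual" for x y by (rule B_norm[OF that])
    show "0 \<le> (fact m * 4 ^ m * K) / (\<omega> - \<alpha>) ^ m * F" using K F \<alpha> by simp
    show "closure (range (\<lambda>x. Rpow \<mu> 2 x)) = UNIV" by (rule R_power_dense[OF R\<mu>(1)])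
    fix x assume "x \<in> range (\<lambda>x. Rpow \<mu> 2 x)"
    then obtain v where v: "x = R \<mu> (R \<mu> v)" by (auto simp: numeral_2_eq_2)
    show "\<exists>u. \<forall>y\<in>dual. blinfun_apply y u = B x y"
    proof (intro exI ballI)
      fix y :: "'a \<Rightarrow>\<^sub>L complex" assume y: "y \<in> dual"
      show "blinfun_apply y (blinfun_apply (elem_calc \<omega> A \<beta> (\<lambda>z. 1 / (\<mu> - z)\<^sup>2 * (deriv ^^ m) f z)) v) = B x y"
        unfolding elem_calc_weak[OF decay order.refl \<beta>\<omega> y] \<delta>_def[symmetric] part[OF y] v ..
    qed
  qed blast
  show thesis
  proof (rule that[OF S(1)])
    show "norm S \<le> (fact m * 4 ^ m * K) / (\<omega> - \<alpha>) ^ m * Hinf_norm \<alpha> f" using S(2) by (simp add: F_def)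
    show "ennreal (cmod (blinfun_apply y (blinfun_apply S x)))
      \<le> ennreal (fact m * Hinf_norm \<alpha> f) * vertical_norm (Suc m) (\<omega> - (\<omega> - \<alpha>) / 4) x y"
      if "y \<in> dual" for x y
      using B_le[OF that] S(3)[OF that] by (simp add: \<delta>_eq F_def)
    have "blinfun_apply y (R \<mu> (R \<mu> (S x))) = B (R \<mu> (R \<mu> x)) y" if y: "y \<in> dual" for x y
    proof -
      have y': "y o\<^sub>L (R \<mu> o\<^sub>L R \<mu>) \<in> bounded_clinear"
        by (intro bounded_clinear_compose y R_clinear R\<mu>)
      have "blinfun_apply y (R \<mu> (R \<mu> (S x))) = B x (y o\<^sub>L (R \<mu> o\<^sub>L R \<mu>))"
        using S(3)[OF y', of x] by simp
      also have "\<dots> = B (R \<mu> (R \<mu> x)) y"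
        unfolding B_def line_integral_def using ord R\<mu>
        by (simp add: R_power_commute R_commute del: funpow.simps)
      finally show ?thesis .
    qed
    then show "deriv_calc \<omega> A \<alpha> m f = graph_of S"
      unfolding deriv_calc_eq_graph_iff[OF \<alpha> f] \<beta>_def[symmetric] \<mu>_def[symmetric] \<delta>_def[symmetric]
      using part by simp
  qed
qed

lemma Wgamma_GFS_imp_strong:
  assumes GFS: "Wgamma_GFS M \<gamma> m \<omega> A" and m: "m \<ge> 1"
  shows "strong_Wgamma_bounded_calculus M \<gamma> m \<omega> A"
proof -
  obtain C where C: "C \<ge> 0" "\<And>N \<alpha> x y. (\<forall>k<N. \<alpha> k < \<omega>) \<and> (\<forall>k<N. y k \<in> dual) \<Longrightarrow>
      (\<Sum>k<N. ennreal ((\<omega> - \<alpha> k) ^ m) * vertical_norm (Suc m) (\<alpha> k) (x k) (y k))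
        \<le> ennreal (C * gauss_norm M \<gamma> N x * gauss_norm M \<gamma> N y)"
    using GFS unfolding Wgamma_GFS_iff by blast
  define K where "K = C * (\<integral>s. (cmod (\<gamma> 0 s))\<^sup>2 \<partial>M)"
  have K0: "K \<ge> 0" using C(1) by (simp add: K_def)
  have K: "vertical_norm (Suc m) \<delta> x y \<le> ennreal (K / (\<omega> - \<delta>) ^ m * norm x * norm y)"
    if "\<delta> < \<omega>" "y \<in> dual" for \<delta> x y
  proof -
    have pos: "(\<omega> - \<delta>) ^ m > 0" using that by simp
    have "ennreal ((\<omega> - \<delta>) ^ m) * vertical_norm (Suc m) \<delta> x y
        \<le> ennreal (C * gauss_norm M \<gamma> 1 (\<lambda>_. x) * gauss_norm M \<gamma> 1 (\<lambda>_. y))"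
      using C(2)[of 1 "\<lambda>_. \<delta>" "\<lambda>_. y" "\<lambda>_. x"] that by simp
    also have "C * gauss_norm M \<gamma> 1 (\<lambda>_. x) * gauss_norm M \<gamma> 1 (\<lambda>_. y) = K * norm x * norm y"
      unfolding gauss_norm_single K_def by simp
    finally have "ennreal (1 / (\<omega> - \<delta>) ^ m) * (ennreal ((\<omega> - \<delta>) ^ m) * vertical_norm (Suc m) \<delta> x y)
        \<le> ennreal (1 / (\<omega> - \<delta>) ^ m) * ennreal (K * norm x * norm y)"
      by (intro mult_left_mono) auto
    then show ?thesis
      using pos by (simp add: mult.assoc[symmetric] ennreal_mult'[symmetric] del: power_eq_0_iff)
  qed
  have "strong_bounded_calculus m \<omega> A"
    unfolding strong_bounded_calculus_def
  \<comment> \<open>The summand \<open>1\<close> makes the constant positive also if \<open>K = 0\<close>.\<close>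
  proof (intro exI[of _ "fact m * 4 ^ m * K + 1"] conjI allI impI ballI)
    fix \<alpha> f assume \<alpha>: "\<alpha> < \<omega>" and f: "f \<in> Hinf \<alpha>"
    obtain S where S: "S \<in> bounded_clinear" "deriv_calc \<omega> A \<alpha> m f = graph_of S"
        "norm S \<le> (fact m * 4 ^ m * K) / (\<omega> - \<alpha>) ^ m * Hinf_norm \<alpha> f"
      by (rule weak_calculus_operator[OF K0 K m \<alpha> f]) blast+
    have "(fact m * 4 ^ m * K) / (\<omega> - \<alpha>) ^ m * Hinf_norm \<alpha> f \<le> (fact m * 4 ^ m * K + 1) / (\<omega> - \<alpha>) ^ m * Hinf_norm \<alpha> f"
      using \<alpha> Hinf_norm_nonneg[OF f] by (intro mult_right_mono divide_right_mono) auto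
    then show "\<exists>S\<in>bounded_clinear. deriv_calc \<omega> A \<alpha> m f = graph_of S \<and>
        norm S \<le> (fact m * 4 ^ m * K + 1) / (\<omega> - \<alpha>) ^ m * Hinf_norm \<alpha> f"
      using S by (intro bexI[of _ S]) auto
  qed (use K0 in \<open>simp add: add_nonneg_pos\<close>)
  moreover have "Wgamma_bounded M \<gamma> (derivative_family m \<omega> A)"
    unfolding Wgamma_bounded_def
  proof (intro exI[of _ "fact m * 4 ^ m * C"] allI impI)
    fix N :: nat and T and x :: "nat \<Rightarrow> 'a" and y :: "nat \<Rightarrow> 'a \<Rightarrow>\<^sub>L complex"
    assume asm: "(\<forall>n<N. T n \<in> derivative_family m \<omega> A) \<and> (\<forall>n<N. y n \<in> dual)"
    have "\<exists>\<delta><\<omega>. ennreal (cmod (blinfun_apply (y n) (blinfun_apply (T n) (x n))))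
        \<le> ennreal (fact m * 4 ^ m) * (ennreal ((\<omega> - \<delta>) ^ m) * vertical_norm (Suc m) \<delta> (x n) (y n))"
      if n: "n < N" for n
    proof -
      obtain \<alpha> f S where S: "\<alpha> < \<omega>" "f \<in> Hinf \<alpha>" "Hinf_norm \<alpha> f \<le> 1" "T n = (\<omega> - \<alpha>) ^ m *\<^sub>R S"
          "deriv_calc \<omega> A \<alpha> m f = graph_of S"
        using asm n unfolding derivative_family_def by blast
      have yn: "y n \<in> dual" using asm n by blast
      obtain S' where S': "deriv_calc \<omega> A \<alpha> m f = graph_of S'"
        "\<And>x y. y \<in> dual \<Longrightarrow> ennreal (cmod (blinfun_apply y (blinfun_apply S' x)))
          \<le> ennreal (fact m * Hinf_norm \<alpha> f) * vertical_norm (Suc m) (\<omega> - (\<omega> - \<alpha>) / 4) x y"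
        by (rule weak_calculus_operator[OF K0 K m S(1,2)]) blast+
      have SS: "S' = S" using S(5) S'(1) by (simp add: graph_of_eq_iff)
      define \<delta> where "\<delta> = \<omega> - (\<omega> - \<alpha>) / 4"
      have \<alpha>\<delta>: "(\<omega> - \<alpha>) ^ m = 4 ^ m * (\<omega> - \<delta>) ^ m" by (simp add: \<delta>_def power_divide)
      have "ennreal (cmod (blinfun_apply (y n) (blinfun_apply (T n) (x n))))
          = ennreal ((\<omega> - \<alpha>) ^ m) * ennreal (cmod (blinfun_apply (y n) (blinfun_apply S (x n))))"
        using S(1) by (simp add: S(4) blinfun.scaleR_left blinfun.scaleR_right ennreal_mult)
      also have "\<dots> \<le> ennreal ((\<omega> - \<alpha>) ^ m) * (ennreal (fact m * 1) * vertical_norm (Suc m) \<delta> (x n) (y n))"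
        using S'(2)[OF yn, of "x n"] S(3) unfolding SS \<delta>_def[symmetric]
        by (intro mult_left_mono order.trans[OF S'(2)[OF yn, of "x n", unfolded SS \<delta>_def[symmetric]]] mult_right_mono ennreal_leI) auto
      also have "\<dots> = ennreal (fact m * 4 ^ m) * (ennreal ((\<omega> - \<delta>) ^ m) * vertical_norm (Suc m) \<delta> (x n) (y n))"
        unfolding \<alpha>\<delta> using S(1) by (simp add: ennreal_mult \<delta>_def mult_ac)
      finally show ?thesis using S(1) by (intro exI[of _ \<delta>]) (auto simp: \<delta>_def)
    qed
    then obtain \<delta> where \<delta>: "\<And>n. n < N \<Longrightarrow> \<delta> n < \<omega>"
        "\<And>n. n < N \<Longrightarrow> ennreal (cmod (blinfun_apply (y n) (blinfun_apply (T n) (x n))))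
          \<le> ennreal (fact m * 4 ^ m) * (ennreal ((\<omega> - \<delta> n) ^ m) * vertical_norm (Suc m) (\<delta> n) (x n) (y n))"
      by metis
    have "ennreal (\<Sum>n<N. cmod (blinfun_apply (y n) (blinfun_apply (T n) (x n))))
        = (\<Sum>n<N. ennreal (cmod (blinfun_apply (y n) (blinfun_apply (T n) (x n)))))"
      by (simp add: sum_ennreal)
    also have "\<dots> \<le> (\<Sum>n<N. ennreal (fact m * 4 ^ m) * (ennreal ((\<omega> - \<delta> n) ^ m) * vertical_norm (Suc m) (\<delta> n) (x n) (y n)))"
      by (intro sum_mono \<delta>(2)) simp
    also have "\<dots> = ennreal (fact m * 4 ^ m) * (\<Sum>n<N. ennreal ((\<omega> - \<delta> n) ^ m) * vertical_norm (Suc m) (\<delta> n) (x n) (y n))"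
      by (simp only: sum_distrib_left)
    also have "\<dots> \<le> ennreal (fact m * 4 ^ m) * ennreal (C * gauss_norm M \<gamma> N x * gauss_norm M \<gamma> N y)"
      using asm \<delta>(1) by (intro mult_left_mono C(2)) auto
    also have "\<dots> = ennreal ((fact m * 4 ^ m) * (C * gauss_norm M \<gamma> N x * gauss_norm M \<gamma> N y))"
      by (intro ennreal_mult'[symmetric]) auto
    finally show "(\<Sum>n<N. cmod (blinfun_apply (y n) (blinfun_apply (T n) (x n))))
        \<le> fact m * 4 ^ m * C * gauss_norm M \<gamma> N x * gauss_norm M \<gamma> N y"
      using C(1) by (subst (asm) ennreal_le_iff) (auto simp: gauss_norm_nonneg mult_ac)
  qed
  ultimately show ?thesis by (simp add: strong_Wgamma_bounded_calculus_iff)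
qed

end

section \<open>Rational functions of the operator\<close>

text \<open>Up to the factor \<open>3\<close>, each term is at most the increment of \<open>arctan\<close> over the next unit interval.  The
  bound does not depend on the shift \<open>c\<close> or on the number of terms.\<close>

lemma sum_inverse_square_le_arctan:
  fixes c :: real and a :: int
  shows "(\<Sum>j\<in>{a..<a + int n}. 1 / (1 + (of_int j + c)\<^sup>2)) \<le> 3 * (arctan (of_int a + real n + c) - arctan (of_int a + c))"
proof (induction n)
  case (Suc n)
  let ?u = "of_int a + real n + c"
  have "{a..<a + int (Suc n)} = insert (a + int n) {a..<a + int n}" by auto
  then have "(\<Sum>j\<in>{a..<a + int (Suc n)}. 1 / (1 + (of_int j + c)\<^sup>2))
      = 1 / (1 + ?u\<^sup>2) + (\<Sum>j\<in>{a..<a + int n}. 1 / (1 + (of_int j + c)\<^sup>2))" by simp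
  moreover have "1 / (1 + ?u\<^sup>2) \<le> 3 * (arctan (?u + 1) - arctan ?u)"
  proof -
    have "\<exists>z>?u. z < ?u + 1 \<and> arctan (?u + 1) - arctan ?u = (?u + 1 - ?u) * inverse (1 + z\<^sup>2)"
      by (intro MVT2) (auto intro: DERIV_arctan)
    then obtain z where z: "?u < z" "z < ?u + 1" "arctan (?u + 1) - arctan ?u = inverse (1 + z\<^sup>2)" by auto
    have "1 + z\<^sup>2 \<le> 3 * (1 + ?u\<^sup>2)" using z by (intro one_plus_square_near) auto
    then have "1 / (1 + ?u\<^sup>2) \<le> 3 * inverse (1 + z\<^sup>2)"
      using one_plus_square_pos[of z] one_plus_square_pos[of ?u] by (simp add: field_simps)
    then show ?thesis using z(3) by simp
  qed
  ultimately show ?case using Suc by (simp add: algebra_simps)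
qed simp

lemma sum_inverse_square_le:
  fixes c :: real and a :: int
  shows "(\<Sum>j\<in>{a..<a + int n}. 1 / (1 + (of_int j + c)\<^sup>2)) \<le> 3 * pi"
  using sum_inverse_square_le_arctan[where a = a and n = n and c = c]
    arctan_bounded[of "of_int a + real n + c"] arctan_bounded[of "of_int a + c"]
  by argo

primrec blinfun_power :: "('a::real_normed_vector \<Rightarrow>\<^sub>L 'a) \<Rightarrow> nat \<Rightarrow> 'a \<Rightarrow>\<^sub>L 'a" where
  "blinfun_power T 0 = id_blinfun"
| "blinfun_power T (Suc n) = T o\<^sub>L blinfun_power T n"

lemma blinfun_power_apply: "blinfun_apply (blinfun_power T n) x = (blinfun_apply T ^^ n) x"
  by (induction n) auto

lemma bounded_clinear_power:
  "T \<in> bounded_clinear \<Longrightarrow> blinfun_power T n \<in> bounded_clinear"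
  by (induction n) (auto intro: bounded_clinear_compose simp: bounded_clinear_def)

lemma bounded_clinear_zero: "0 \<in> bounded_clinear"
  by (simp add: bounded_clinear_def)

lemma bounded_clinear_add: "S \<in> bounded_clinear \<Longrightarrow> T \<in> bounded_clinear \<Longrightarrow> S + T \<in> bounded_clinear"
  by (simp add: bounded_clinear_def blinfun.add_left scaleC_add_right)

lemma bounded_clinear_scale: "T \<in> bounded_clinear \<Longrightarrow> c *\<^sub>C T \<in> bounded_clinear"
  by (simp add: bounded_clinear_def scaleC_blinfun_apply scaleC_scaleC mult.commute)

lemma bounded_clinear_sum: "(\<And>j. j \<in> J \<Longrightarrow> T j \<in> bounded_clinear) \<Longrightarrow> (\<Sum>j\<in>J. T j) \<in> bounded_clinear"
  by (induction J rule: infinite_finite_induct) (auto intro: bounded_clinear_zero bounded_clinear_add)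

lemma deriv_inverse_square_sum:
  fixes \<zeta> :: "'j \<Rightarrow> complex"
  assumes "\<And>j. j \<in> J \<Longrightarrow> Re (\<zeta> j) = \<alpha>" "\<alpha> < Re z"
  shows "(deriv ^^ m) (\<lambda>z. \<Sum>j\<in>J. \<epsilon> j / (\<zeta> j - z)\<^sup>2) z
    = (\<Sum>j\<in>J. \<epsilon> j * fact (Suc m) / (\<zeta> j - z) ^ Suc (Suc m))"
proof (rule higher_deriv_eqI[of "half_plane \<alpha>" _ "\<lambda>m z. \<Sum>j\<in>J. \<epsilon> j * fact (Suc m) / (\<zeta> j - z) ^ Suc (Suc m)"])
  fix i w assume w: "w \<in> half_plane \<alpha>"
  have "((\<lambda>z. \<Sum>j\<in>J. \<epsilon> j * fact (Suc i) / (\<zeta> j - z) ^ Suc (Suc i)) has_field_derivative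
      (\<Sum>j\<in>J. of_nat (Suc (Suc i)) * (\<epsilon> j * fact (Suc i)) / (\<zeta> j - w) ^ Suc (Suc (Suc i)))) (at w)"
    using w assms(1) by (intro DERIV_sum inverse_power_has_field_derivative) (auto simp: half_plane_def)
  also have "(\<lambda>j. of_nat (Suc (Suc i)) * (\<epsilon> j * fact (Suc i)) / (\<zeta> j - w) ^ Suc (Suc (Suc i)))
      = (\<lambda>j. \<epsilon> j * fact (Suc (Suc i)) / (\<zeta> j - w) ^ Suc (Suc (Suc i)))"
    by (simp add: fact_Suc[of "Suc i"] mult_ac del: of_nat_Suc fact_Suc power_Suc)
  finally show "((\<lambda>z. \<Sum>j\<in>J. \<epsilon> j * fact (Suc i) / (\<zeta> j - z) ^ Suc (Suc i)) has_field_derivative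
      (\<Sum>j\<in>J. \<epsilon> j * fact (Suc (Suc i)) / (\<zeta> j - w) ^ Suc (Suc (Suc i)))) (at w)" .
qed (use assms in \<open>auto simp: power2_eq_square\<close>, auto simp: half_plane_def)

context half_plane_operator begin

text \<open>For rational functions with poles to the left, the calculus gives the expected operator: the factors
  \<open>1 / (\<zeta> - z)\<close> turn into resolvents one at a time.\<close>

lemma deriv_calc_inverse_square_sum:
  fixes \<zeta> :: "'j \<Rightarrow> complex"
  assumes J: "finite J" and \<zeta>: "\<And>j. j \<in> J \<Longrightarrow> Re (\<zeta> j) = \<alpha>" and \<alpha>: "\<alpha> < \<alpha>'" "\<alpha>' < \<omega>"
    and H: "(\<lambda>z. \<Sum>j\<in>J. \<epsilon> j / (\<zeta> j - z)\<^sup>2) \<in> Hinf \<alpha>'"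
  shows "deriv_calc \<omega> A \<alpha>' m (\<lambda>z. \<Sum>j\<in>J. \<epsilon> j / (\<zeta> j - z)\<^sup>2)
    = graph_of (\<Sum>j\<in>J. (\<epsilon> j * fact (Suc m)) *\<^sub>C blinfun_power (R (\<zeta> j)) (Suc (Suc m)))"
proof -
  define \<beta> where "\<beta> = (\<alpha>' + \<omega>) / 2"
  define \<delta> where "\<delta> = (\<beta> + \<omega>) / 2"
  define \<mu> where "\<mu> = complex_of_real (\<beta> - 1)"
  define k where "k = Suc (Suc m)"
  define e where "e z = 1 / (\<mu> - z)\<^sup>2" for z
  have ord: "\<alpha>' < \<beta>" "\<beta> < \<delta>" "\<delta> < \<omega>" using \<alpha> by (auto simp: \<beta>_def \<delta>_def)
  have R\<mu>: "Re \<mu> < \<omega>" "Re \<mu> < \<beta>" using ord by (auto simp: \<mu>_def)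
  have e_decay: "half_plane_decay \<beta> e" unfolding e_def by (rule half_plane_decay_inverse_square[OF R\<mu>(2)])
  have R\<zeta>: "Re (\<zeta> j) < \<omega>" "Re (\<zeta> j) < \<beta>" if "j \<in> J" for j using \<zeta>[OF that] \<alpha> ord by auto
  have "blinfun_apply y (R \<mu> (R \<mu> ((\<Sum>j\<in>J. (\<epsilon> j * fact (Suc m)) *\<^sub>C blinfun_power (R (\<zeta> j)) k) x)))
      = - (1 / (2 * of_real pi)) * line_integral \<delta> (\<lambda>z. e z *
          (deriv ^^ m) (\<lambda>z. \<Sum>j\<in>J. \<epsilon> j / (\<zeta> j - z)\<^sup>2) z * blinfun_apply y (R z x))"
    if y: "y \<in> dual" for x and y :: "'a \<Rightarrow>\<^sub>L complex"
  proof -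
    have one: "line_integral \<delta> (\<lambda>z. e z / (\<zeta> j - z) ^ k * blinfun_apply y (R z x))
        = - 2 * of_real pi * blinfun_apply y (Rpow (\<zeta> j) k (R \<mu> (R \<mu> x)))"
      and int: "integrable lborel (\<lambda>t. e (Complex \<delta> t) / (\<zeta> j - Complex \<delta> t) ^ k * blinfun_apply y (R (Complex \<delta> t) x))"
      if j: "j \<in> J" for j
    proof -
      let ?y = "y o\<^sub>L blinfun_power (R (\<zeta> j)) k"
      have y': "?y \<in> dual"
        by (intro bounded_clinear_compose y bounded_clinear_power R_clinear R\<zeta> j)
      have "line_integral \<delta> (\<lambda>z. e z / (\<zeta> j - z) ^ k * blinfun_apply y (R z x))
          = line_integral \<delta> (\<lambda>z. e z * blinfun_apply ?y (R z x))"
        using line_integral_mult_R_power[OF e_decay R\<zeta>(2)[OF j] ord(2,3) y, of k x]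
        by (simp add: blinfun_power_apply)
      also have "\<dots> = - 2 * of_real pi * blinfun_apply ?y (R \<mu> (R \<mu> x))"
        unfolding e_def \<mu>_def using ord by (intro line_integral_regularizer y') auto
      finally show "line_integral \<delta> (\<lambda>z. e z / (\<zeta> j - z) ^ k * blinfun_apply y (R z x))
        = - 2 * of_real pi * blinfun_apply y (Rpow (\<zeta> j) k (R \<mu> (R \<mu> x)))"
        by (simp add: blinfun_power_apply)
      have "integrable lborel (\<lambda>t. (\<lambda>z. blinfun_apply y (R z x) * (e z / (\<zeta> j - z) ^ k)) (Complex \<delta> t))"
        by (rule strip_decay_integrable[OF strip_decay_mult[OF R_strip_bounded[OF y] half_plane_decay_strip[OF
              half_plane_decay_divide_power[OF e_decay R\<zeta>(2)[OF j]]]] ord(2,3)])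
      then show "integrable lborel (\<lambda>t. e (Complex \<delta> t) / (\<zeta> j - Complex \<delta> t) ^ k * blinfun_apply y (R (Complex \<delta> t) x))"
        by (simp add: mult.commute)
    qed
    have dz: "(deriv ^^ m) (\<lambda>z. \<Sum>j\<in>J. \<epsilon> j / (\<zeta> j - z)\<^sup>2) (Complex \<delta> t)
        = (\<Sum>j\<in>J. \<epsilon> j * fact (Suc m) / (\<zeta> j - Complex \<delta> t) ^ k)" for t
      unfolding k_def using \<zeta> \<alpha> ord by (intro deriv_inverse_square_sum[of J \<zeta> \<alpha>]) auto
    have split: "e z * (\<Sum>j\<in>J. \<epsilon> j * fact (Suc m) / (\<zeta> j - z) ^ k) * r
        = (\<Sum>j\<in>J. (\<epsilon> j * fact (Suc m)) * (e z / (\<zeta> j - z) ^ k * r))" for z r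
      unfolding sum_distrib_left sum_distrib_right by (intro sum.cong refl) (simp add: mult_ac)
    have "line_integral \<delta> (\<lambda>z. e z * (deriv ^^ m) (\<lambda>z. \<Sum>j\<in>J. \<epsilon> j / (\<zeta> j - z)\<^sup>2) z * blinfun_apply y (R z x))
        = (\<Sum>j\<in>J. (\<epsilon> j * fact (Suc m)) * line_integral \<delta> (\<lambda>z. e z / (\<zeta> j - z) ^ k * blinfun_apply y (R z x)))"
      unfolding line_integral_def dz split
      by (subst Bochner_Integration.integral_sum) (auto simp del: times_divide_eq_left intro!: integrable_mult_right int)
    also have "\<dots> = (\<Sum>j\<in>J. (\<epsilon> j * fact (Suc m)) * (- 2 * of_real pi * blinfun_apply y (Rpow (\<zeta> j) k (R \<mu> (R \<mu> x)))))"
      by (intro sum.cong refl arg_cong2[of _ _ _ _ "(*)"] one)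
    also have "- (1 / (2 * of_real pi)) * \<dots> = (\<Sum>j\<in>J. (\<epsilon> j * fact (Suc m)) * blinfun_apply y (Rpow (\<zeta> j) k (R \<mu> (R \<mu> x))))"
      unfolding sum_distrib_left by (intro sum.cong refl) simp
    also have "\<dots> = blinfun_apply y (R \<mu> (R \<mu> ((\<Sum>j\<in>J. (\<epsilon> j * fact (Suc m)) *\<^sub>C blinfun_power (R (\<zeta> j)) k) x)))"
      using R_power_commute[OF R\<zeta>(1) R\<mu>(1)]
      by (simp add: blinfun.sum_left blinfun.sum_right scaleC_blinfun_apply R_scaleC[OF R\<mu>(1)]
          functional_scaleC[OF y] blinfun_power_apply)
    finally show ?thesis by (rule sym)
  qed
  then show ?thesis
    unfolding deriv_calc_eq_graph_iff[OF \<alpha>(2) H] \<beta>_def[symmetric] \<mu>_def[symmetric] \<delta>_def[symmetric]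
      k_def[symmetric] e_def[symmetric] by blast
qed

text \<open>Poles with spacing \<open>d\<close> on the line \<open>Re z = \<alpha>\<close>, seen from distance at least \<open>d\<close>: after scaling by \<open>d\<close>
  the sum of the squared inverse distances is at most \<open>3 * pi\<close>, however many poles there are.\<close>

lemma inverse_square_sum_Hinf:
  fixes \<alpha> d s :: real and a :: int
  assumes d: "d > 0" and \<epsilon>: "\<And>j. cmod (\<epsilon> j) \<le> d\<^sup>2 / (3 * pi)"
  shows "(\<lambda>z. \<Sum>j\<in>{a..<a + int n}. \<epsilon> j / (Complex \<alpha> ((s + of_int j) * d) - z)\<^sup>2) \<in> Hinf (\<alpha> + d)"
    and "Hinf_norm (\<alpha> + d) (\<lambda>z. \<Sum>j\<in>{a..<a + int n}. \<epsilon> j / (Complex \<alpha> ((s + of_int j) * d) - z)\<^sup>2) \<le> 1"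
proof -
  let ?H = "\<lambda>z. \<Sum>j\<in>{a..<a + int n}. \<epsilon> j / (Complex \<alpha> ((s + of_int j) * d) - z)\<^sup>2"
  have hol: "?H holomorphic_on half_plane (\<alpha> + d)"
    using d by (intro holomorphic_intros) (auto simp: half_plane_def)
  have "cmod (?H z) \<le> 1" if z: "z \<in> half_plane (\<alpha> + d)" for z
  proof -
    have "cmod (\<epsilon> j / (Complex \<alpha> ((s + of_int j) * d) - z)\<^sup>2)
        \<le> (1 / (3 * pi)) * (1 / (1 + (of_int j + (s - Im z / d))\<^sup>2))" for j
    proof -
      have "d\<^sup>2 * (1 + (of_int j + (s - Im z / d))\<^sup>2) = d\<^sup>2 + ((s + of_int j) * d - Im z)\<^sup>2"
        using d by (simp add: power2_eq_square field_simps)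
      also have "\<dots> \<le> (Re z - \<alpha>)\<^sup>2 + ((s + of_int j) * d - Im z)\<^sup>2"
        using d z by (intro add_right_mono power_mono) (auto simp: half_plane_def)
      also have "\<dots> = (cmod (Complex \<alpha> ((s + of_int j) * d) - z))\<^sup>2"
        by (simp add: cmod_power2 power2_commute)
      finally have le: "d\<^sup>2 * (1 + (of_int j + (s - Im z / d))\<^sup>2) \<le> (cmod (Complex \<alpha> ((s + of_int j) * d) - z))\<^sup>2" .
      have pos: "0 < d\<^sup>2 * (1 + (of_int j + (s - Im z / d))\<^sup>2)"
        using d one_plus_square_pos by (intro mult_pos_pos) auto
      have "cmod (\<epsilon> j / (Complex \<alpha> ((s + of_int j) * d) - z)\<^sup>2)
          = cmod (\<epsilon> j) / (cmod (Complex \<alpha> ((s + of_int j) * d) - z))\<^sup>2" by (simp add: norm_divide norm_power)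
      also have "\<dots> \<le> (d\<^sup>2 / (3 * pi)) / (d\<^sup>2 * (1 + (of_int j + (s - Im z / d))\<^sup>2))"
        by (rule frac_le[OF _ \<epsilon> pos le]) simp
      also have "\<dots> = (1 / (3 * pi)) * (1 / (1 + (of_int j + (s - Im z / d))\<^sup>2))" using d by simp
      finally show ?thesis .
    qed
    then have "cmod (?H z) \<le> (\<Sum>j\<in>{a..<a + int n}. (1 / (3 * pi)) * (1 / (1 + (of_int j + (s - Im z / d))\<^sup>2)))"
      by (intro order.trans[OF norm_sum] sum_mono)
    also have "\<dots> = (1 / (3 * pi)) * (\<Sum>j\<in>{a..<a + int n}. 1 / (1 + (of_int j + (s - Im z / d))\<^sup>2))"
      by (simp only: sum_distrib_left)
    also have "\<dots> \<le> (1 / (3 * pi)) * (3 * pi)"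
      by (intro mult_left_mono sum_inverse_square_le) simp
    finally show ?thesis by simp
  qed
  from HinfI[OF hol this] show "?H \<in> Hinf (\<alpha> + d)" "Hinf_norm (\<alpha> + d) ?H \<le> 1" by auto
qed

end

definition grid :: "nat \<Rightarrow> int set"
  where "grid n = {- int n..<int n}"

text \<open>The form of the interval to which the telescoping estimate by \<open>arctan\<close> applies.\<close>

lemma grid_eq: "grid n = {- int n..<- int n + int (2 * n)}"
  by (auto simp: grid_def)

text \<open>The integral over the line is the average, over all translates of a grid of mesh \<open>d\<close>, of \<open>d\<close> times
  the sum over the grid.  A bound for such sums that is uniform in the translate is therefore a bound for the
  integral, and no Riemann sums have to converge.\<close>

lemma nn_integral_periodize:
  fixes \<phi> :: "real \<Rightarrow> ennreal" and d :: real
  assumes [measurable]: "\<phi> \<in> borel_measurable borel" and d: "d > 0"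
  shows "(\<integral>\<^sup>+t. \<phi> t * indicator {- real n * d..<real n * d} t \<partial>lborel)
    = (\<integral>\<^sup>+s. (\<Sum>j\<in>grid n. ennreal d * \<phi> ((s + of_int j) * d)) * indicator {0..<1} s \<partial>lborel)"
proof -
  have ind: "indicator {of_int a * d..<(of_int a + real k) * d} t
      = (\<Sum>j\<in>{a..<a + int k}. indicator {of_int j * d..<(of_int j + 1) * d} t :: ennreal)" for a :: int and k t
  proof (induction k)
    case (Suc k)
    have s: "{a..<a + int (Suc k)} = insert (a + int k) {a..<a + int k}" by auto
    have le: "of_int a * d \<le> (of_int a + real k) * d" "(of_int a + real k) * d \<le> (of_int a + real k + 1) * d"
      using d by (auto intro!: mult_right_mono)
    have split: "indicator {p..<r} t = indicator {p..<q} t + (indicator {q..<r} t :: ennreal)"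
      if "p \<le> q" "q \<le> r" for p q r using that by (auto simp: indicator_def)
    have "of_int a + real (Suc k) = of_int a + real k + 1" by simp
    then have "indicator {of_int a * d..<(of_int a + real (Suc k)) * d} t
        = indicator {of_int a * d..<(of_int a + real k) * d} t + (indicator {(of_int a + real k) * d..<(of_int a + real k + 1) * d} t :: ennreal)"
      using split[OF le] by (simp only:)
    then show ?case unfolding s using Suc by (simp add: add.commute)
  qed simp
  have "(\<integral>\<^sup>+t. \<phi> t * indicator {- real n * d..<real n * d} t \<partial>lborel)
      = (\<integral>\<^sup>+t. (\<Sum>j\<in>grid n. \<phi> t * indicator {of_int j * d..<(of_int j + 1) * d} t) \<partial>lborel)"
  proof (intro nn_integral_cong)
    fix t
    have "of_int (- int n) * d = - real n * d" "(of_int (- int n) + real (2 * n)) * d = real n * d"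
      by (simp_all add: algebra_simps)
    then have "indicator {- real n * d..<real n * d} t
        = (\<Sum>j\<in>grid n. indicator {of_int j * d..<(of_int j + 1) * d} t :: ennreal)"
      using ind[of "- int n" "2 * n" t] by (simp only: grid_eq)
    then show "\<phi> t * indicator {- real n * d..<real n * d} t
        = (\<Sum>j\<in>grid n. \<phi> t * indicator {of_int j * d..<(of_int j + 1) * d} t)"
      by (simp only: sum_distrib_left)
  qed
  also have "\<dots> = (\<Sum>j\<in>grid n. \<integral>\<^sup>+t. \<phi> t * indicator {of_int j * d..<(of_int j + 1) * d} t \<partial>lborel)"
    by (intro nn_integral_sum) measurable
  also have "\<dots> = (\<Sum>j\<in>grid n. \<integral>\<^sup>+s. ennreal d * \<phi> ((s + of_int j) * d) * indicator {0..<1} s \<partial>lborel)"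
  proof (intro sum.cong refl)
    fix j :: int
    have "(\<integral>\<^sup>+t. \<phi> t * indicator {of_int j * d..<(of_int j + 1) * d} t \<partial>lborel)
        = ennreal \<bar>d\<bar> * (\<integral>\<^sup>+s. \<phi> (of_int j * d + d * s) * indicator {of_int j * d..<(of_int j + 1) * d} (of_int j * d + d * s) \<partial>lborel)"
      using d by (intro nn_integral_real_affine) auto
    also have "\<dots> = (\<integral>\<^sup>+s. ennreal \<bar>d\<bar> * (\<phi> (of_int j * d + d * s) * indicator {of_int j * d..<(of_int j + 1) * d} (of_int j * d + d * s)) \<partial>lborel)"
      by (intro nn_integral_cmult[symmetric]) measurable
    also have "\<dots> = (\<integral>\<^sup>+s. ennreal d * \<phi> ((s + of_int j) * d) * indicator {0..<1} s \<partial>lborel)"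
    proof (intro nn_integral_cong)
      fix s
      have "indicator {of_int j * d..<(of_int j + 1) * d} (of_int j * d + d * s) = (indicator {0..<1} s :: ennreal)"
        using d by (auto simp: indicator_def algebra_simps zero_le_mult_iff)
      moreover have "of_int j * d + d * s = (s + of_int j) * d" by (simp add: algebra_simps)
      ultimately show "ennreal \<bar>d\<bar> * (\<phi> (of_int j * d + d * s) * indicator {of_int j * d..<(of_int j + 1) * d} (of_int j * d + d * s))
          = ennreal d * \<phi> ((s + of_int j) * d) * indicator {0..<1} s" using d by (simp add: mult.assoc)
    qed
    finally show "(\<integral>\<^sup>+t. \<phi> t * indicator {of_int j * d..<(of_int j + 1) * d} t \<partial>lborel)
        = (\<integral>\<^sup>+s. ennreal d * \<phi> ((s + of_int j) * d) * indicator {0..<1} s \<partial>lborel)" .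
  qed
  also have "\<dots> = (\<integral>\<^sup>+s. (\<Sum>j\<in>grid n. ennreal d * \<phi> ((s + of_int j) * d) * indicator {0..<1} s) \<partial>lborel)"
    by (intro nn_integral_sum[symmetric]) measurable
  finally show ?thesis by (simp only: sum_distrib_right)
qed

lemma nn_integral_window_limit:
  fixes \<phi> :: "real \<Rightarrow> ennreal" and d :: real
  assumes [measurable]: "\<phi> \<in> borel_measurable borel" and d: "d > 0"
  shows "(\<lambda>n. \<integral>\<^sup>+t. \<phi> t * indicator {- real n * d..<real n * d} t \<partial>lborel) \<longlonglongrightarrow> (\<integral>\<^sup>+t. \<phi> t \<partial>lborel)"
proof (rule nn_integral_LIMSEQ)
  show "incseq (\<lambda>n t. \<phi> t * indicator {- real n * d..<real n * d} t)"
  proof (intro incseq_SucI le_funI mult_left_mono)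
    fix n t
    have "real n * d \<le> real (Suc n) * d" using d by (intro mult_right_mono) auto
    then show "(indicator {- real n * d..<real n * d} t :: ennreal) \<le> indicator {- real (Suc n) * d..<real (Suc n) * d} t"
      using mult_minus_left[of "real n" d] mult_minus_left[of "real (Suc n)" d]
      by (auto simp: indicator_def simp del: of_nat_Suc mult_minus_left)
  qed auto
  fix t
  obtain N :: nat where N: "\<bar>t\<bar> / d < real N" using reals_Archimedean2 by blast
  have "\<phi> t * indicator {- real n * d..<real n * d} t = \<phi> t" if "n \<ge> N" for n
  proof -
    have "\<bar>t\<bar> < real n * d" using N that d by (simp add: field_simps) (meson less_le_trans mult_left_mono of_nat_le_iff less_imp_le)
    then show ?thesis by (auto simp: indicator_def)
  qed
  then have "\<forall>\<^sub>F n in sequentially. \<phi> t * indicator {- real n * d..<real n * d} t = \<phi> t"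
    by (auto simp: eventually_sequentially)
  then show "(\<lambda>n. \<phi> t * indicator {- real n * d..<real n * d} t) \<longlonglongrightarrow> \<phi> t"
    by (rule tendsto_eventually)
qed measurable

context half_plane_operator begin

text \<open>For each index \<open>k\<close>, poles are placed on a grid of mesh \<open>d = (\<omega> - \<alpha>) / 2\<close> on the line \<open>Re z = \<alpha>\<close>, with
  coefficients that remove the phases of \<open>\<langle>R(\<zeta>)\<^bsup>m+2\<^esup> x, y\<rangle>\<close> at the poles.  The resulting function is
  admissible on \<open>Re z > \<alpha> + d\<close>, and its \<open>m\<close>-th derivative at \<open>A\<close>, paired with \<open>x\<close> and \<open>y\<close>, is the sum of the
  absolute values over the grid.  Since the poles are double, the order of the
  resolvent goes up by one compared with what \<open>m\<close> derivatives of a simple pole would give; simple poles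
  would not do, as their sums are not bounded.\<close>

lemma strong_imp_Wgamma_GFS_Suc:
  assumes "strong_Wgamma_bounded_calculus M \<gamma> m \<omega> A"
  shows "Wgamma_GFS M \<gamma> (Suc m) \<omega> A"
proof -
  let ?T = "derivative_family m \<omega> A"
  have W: "Wgamma_bounded M \<gamma> ?T" using assms by (simp add: strong_Wgamma_bounded_calculus_iff)
  obtain C where C: "C \<ge> 0" "\<And>N T x y. (\<forall>n<N. T n \<in> ?T) \<and> (\<forall>n<N. y n \<in> dual) \<Longrightarrow>
      (\<Sum>n<N. cmod (blinfun_apply (y n) (blinfun_apply (T n) (x n)))) \<le> C * gauss_norm M \<gamma> N x * gauss_norm M \<gamma> N y"
    by (rule Wgamma_boundedE[OF W]) blast
  show ?thesis
    unfolding Wgamma_GFS_iff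
  proof (intro exI[of _ "2 ^ Suc m * (3 * pi / fact (Suc m) * C)"] conjI allI impI)
    show "0 \<le> 2 ^ Suc m * (3 * pi / fact (Suc m) * C)" using C(1) by (simp del: fact_Suc)
    fix N :: nat and \<alpha> :: "nat \<Rightarrow> real" and x :: "nat \<Rightarrow> 'a" and y :: "nat \<Rightarrow> 'a \<Rightarrow>\<^sub>L complex"
    assume asm: "(\<forall>k<N. \<alpha> k < \<omega>) \<and> (\<forall>k<N. y k \<in> dual)"
    define G where "G = gauss_norm M \<gamma> N x * gauss_norm M \<gamma> N y"
    have G: "G \<ge> 0" by (simp add: G_def gauss_norm_nonneg)
    define d where "d k = (\<omega> - \<alpha> k) / 2" for k
    have d: "d k > 0" if "k < N" for k using asm that by (simp add: d_def)
    define \<phi> where "\<phi> k t = blinfun_apply (y k) (Rpow (Complex (\<alpha> k) t) (Suc (Suc m)) (x k))" for k t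
    have meas: "\<phi> k \<in> borel_measurable borel" if "k < N" for k
      unfolding \<phi>_def using asm that by (intro measurable_R_power_line) auto
    have point: "(\<Sum>k<N. d k ^ Suc m * (\<Sum>j\<in>grid n. d k * cmod (\<phi> k ((s + of_int j) * d k))))
        \<le> 3 * pi / fact (Suc m) * C * G" for n s
    proof -
      define J where "J = grid n"
      define \<zeta> where "\<zeta> k j = Complex (\<alpha> k) ((s + of_int j) * d k)" for k and j :: int
      \<comment> \<open>The conjugated sign removes the phase; the other factor normalizes the sum in \<open>Hinf (\<alpha> k + d k)\<close>.\<close>
      define \<epsilon> where "\<epsilon> k j = of_real (d k ^ 2 / (3 * pi)) * cnj (sgn (\<phi> k ((s + of_int j) * d k)))" for k and j :: int
      define H where "H k z = (\<Sum>j\<in>J. \<epsilon> k j / (\<zeta> k j - z)\<^sup>2)" for k z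
      define S where "S k = (\<Sum>j\<in>J. (\<epsilon> k j * fact (Suc m)) *\<^sub>C blinfun_power (R (\<zeta> k j)) (Suc (Suc m)))" for k
      have in_T: "(\<omega> - (\<alpha> k + d k)) ^ m *\<^sub>R S k \<in> ?T" if k: "k < N" for k
      proof -
        have ak: "\<alpha> k < \<alpha> k + d k" "\<alpha> k + d k < \<omega>" using d[OF k] asm k by (auto simp: d_def field_simps)
        have \<epsilon>: "cmod (\<epsilon> k j) \<le> (d k)\<^sup>2 / (3 * pi)" for j
          by (simp add: \<epsilon>_def norm_mult norm_power norm_divide norm_sgn)
        have H: "H k \<in> Hinf (\<alpha> k + d k)" "Hinf_norm (\<alpha> k + d k) (H k) \<le> 1"
          using inverse_square_sum_Hinf[OF d[OF k] \<epsilon>, where a = "- int n" and n = "2 * n" and \<alpha> = "\<alpha> k" and s = s]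
          unfolding H_def J_def grid_eq \<zeta>_def by auto
        have "deriv_calc \<omega> A (\<alpha> k + d k) m (H k) = graph_of (S k)"
        proof -
          have Hk: "H k = (\<lambda>z. \<Sum>j\<in>J. \<epsilon> k j / (\<zeta> k j - z)\<^sup>2)" by (rule ext) (rule H_def)
          have "(\<lambda>z. \<Sum>j\<in>J. \<epsilon> k j / (\<zeta> k j - z)\<^sup>2) \<in> Hinf (\<alpha> k + d k)" using H(1) by (simp only: Hk)
          then show ?thesis
            unfolding Hk S_def
            by (intro deriv_calc_inverse_square_sum[OF _ _ ak]) (simp_all add: J_def grid_def \<zeta>_def)
        qed
        moreover have "S k \<in> bounded_clinear"
          unfolding S_def using asm k
          by (intro bounded_clinear_sum bounded_clinear_scale bounded_clinear_power R_clinear) (auto simp: \<zeta>_def)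
        ultimately show ?thesis using H ak(2) unfolding derivative_family_def by blast
      qed
      have val: "cmod (blinfun_apply (y k) (blinfun_apply ((\<omega> - (\<alpha> k + d k)) ^ m *\<^sub>R S k) (x k)))
          = fact (Suc m) / (3 * pi) * (d k ^ Suc m * (\<Sum>j\<in>J. d k * cmod (\<phi> k ((s + of_int j) * d k))))" if k: "k < N" for k
      proof -
        have yk: "y k \<in> dual" using asm k by blast
        have "blinfun_apply (y k) (blinfun_apply (S k) (x k)) = (\<Sum>j\<in>J. \<epsilon> k j * fact (Suc m) * \<phi> k ((s + of_int j) * d k))"
          by (simp add: S_def blinfun.sum_left blinfun.sum_right scaleC_blinfun_apply functional_scaleC[OF yk]
              blinfun_power_apply \<phi>_def \<zeta>_def del: fact_Suc)
        also have "\<dots> = (\<Sum>j\<in>J. of_real (d k ^ 2 / (3 * pi) * fact (Suc m) * cmod (\<phi> k ((s + of_int j) * d k))))"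
        proof (intro sum.cong refl)
          fix j
          have "\<epsilon> k j * fact (Suc m) * \<phi> k ((s + of_int j) * d k)
              = of_real (d k ^ 2 / (3 * pi)) * fact (Suc m) * (cnj (sgn (\<phi> k ((s + of_int j) * d k))) * \<phi> k ((s + of_int j) * d k))"
            by (simp only: \<epsilon>_def mult_ac)
          then show "\<epsilon> k j * fact (Suc m) * \<phi> k ((s + of_int j) * d k)
              = of_real (d k ^ 2 / (3 * pi) * fact (Suc m) * cmod (\<phi> k ((s + of_int j) * d k)))"
            unfolding cnj_sgn_mult by (simp del: fact_Suc)
        qed
        also have "\<dots> = of_real (d k ^ 2 / (3 * pi) * fact (Suc m) * (\<Sum>j\<in>J. cmod (\<phi> k ((s + of_int j) * d k))))"
          by (simp only: of_real_sum[symmetric] sum_distrib_left)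
        finally have yS: "blinfun_apply (y k) (blinfun_apply (S k) (x k))
            = of_real (d k ^ 2 / (3 * pi) * fact (Suc m) * (\<Sum>j\<in>J. cmod (\<phi> k ((s + of_int j) * d k))))" .
        have nonneg: "0 \<le> d k ^ 2 / (3 * pi) * fact (Suc m) * (\<Sum>j\<in>J. cmod (\<phi> k ((s + of_int j) * d k)))"
          by (intro mult_nonneg_nonneg sum_nonneg) auto
        have cS: "cmod (blinfun_apply (y k) (blinfun_apply (S k) (x k)))
            = d k ^ 2 / (3 * pi) * fact (Suc m) * (\<Sum>j\<in>J. cmod (\<phi> k ((s + of_int j) * d k)))"
          unfolding yS norm_of_real by (rule abs_of_nonneg[OF nonneg])
        have dk: "\<omega> - (\<alpha> k + d k) = d k" by (simp add: d_def field_simps)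
        show ?thesis
          unfolding dk using d[OF k] by (simp add: cS blinfun.scaleR_left blinfun.scaleR_right sum_distrib_left[symmetric] power2_eq_square mult_ac del: fact_Suc)
      qed
      have "fact (Suc m) / (3 * pi) * (\<Sum>k<N. d k ^ Suc m * (\<Sum>j\<in>J. d k * cmod (\<phi> k ((s + of_int j) * d k))))
          = (\<Sum>k<N. cmod (blinfun_apply (y k) (blinfun_apply ((\<omega> - (\<alpha> k + d k)) ^ m *\<^sub>R S k) (x k))))"
        unfolding sum_distrib_left[of "fact (Suc m) / (3 * pi)"] by (intro sum.cong refl val[symmetric]) simp
      also have "\<dots> \<le> C * G"
        using C(2)[of N "\<lambda>k. (\<omega> - (\<alpha> k + d k)) ^ m *\<^sub>R S k" y x] in_T asm by (simp add: G_def mult.assoc)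
      finally have "(3 * pi / fact (Suc m)) * (fact (Suc m) / (3 * pi) * (\<Sum>k<N. d k ^ Suc m * (\<Sum>j\<in>J. d k * cmod (\<phi> k ((s + of_int j) * d k)))))
          \<le> (3 * pi / fact (Suc m)) * (C * G)" by (intro mult_left_mono) (simp_all del: fact_Suc)
      then show ?thesis unfolding J_def by (simp add: mult.assoc del: fact_Suc)
    qed
    \<comment> \<open>Integrating over \<open>s\<close> turns the sums over translated grids into integrals over a window.\<close>
    have window: "(\<Sum>k<N. ennreal (d k ^ Suc m) * (\<integral>\<^sup>+t. ennreal (cmod (\<phi> k t)) * indicator {- real n * d k..<real n * d k} t \<partial>lborel))
        \<le> ennreal (3 * pi / fact (Suc m) * C * G)" for n
    proof -
      have "(\<Sum>k<N. ennreal (d k ^ Suc m) * (\<integral>\<^sup>+t. ennreal (cmod (\<phi> k t)) * indicator {- real n * d k..<real n * d k} t \<partial>lborel))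
          = (\<Sum>k<N. \<integral>\<^sup>+s. ennreal (d k ^ Suc m) * ((\<Sum>j\<in>grid n. ennreal (d k) * ennreal (cmod (\<phi> k ((s + of_int j) * d k)))) * indicator {0..<1} s) \<partial>lborel)"
      proof (intro sum.cong refl)
        fix k assume "k \<in> {..<N}"
        then have k: "k < N" by simp
        note [measurable] = meas[OF k]
        show "ennreal (d k ^ Suc m) * (\<integral>\<^sup>+t. ennreal (cmod (\<phi> k t)) * indicator {- real n * d k..<real n * d k} t \<partial>lborel)
          = (\<integral>\<^sup>+s. ennreal (d k ^ Suc m) * ((\<Sum>j\<in>grid n. ennreal (d k) * ennreal (cmod (\<phi> k ((s + of_int j) * d k)))) * indicator {0..<1} s) \<partial>lborel)"
          using d[OF k] by (subst nn_integral_periodize) (auto intro!: nn_integral_cmult[symmetric])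
      qed
      also have "\<dots> = (\<integral>\<^sup>+s. (\<Sum>k<N. ennreal (d k ^ Suc m) * ((\<Sum>j\<in>grid n. ennreal (d k) * ennreal (cmod (\<phi> k ((s + of_int j) * d k)))) * indicator {0..<1} s)) \<partial>lborel)"
      proof (rule nn_integral_sum[symmetric])
        fix k assume "k \<in> {..<N}"
        then have k: "k < N" by simp
        note [measurable] = meas[OF k]
        show "(\<lambda>s. ennreal (d k ^ Suc m) * ((\<Sum>j\<in>grid n. ennreal (d k) * ennreal (cmod (\<phi> k ((s + of_int j) * d k)))) * indicator {0..<1} s)) \<in> borel_measurable lborel"
          by measurable
      qed
      also have "\<dots> \<le> (\<integral>\<^sup>+s. ennreal (3 * pi / fact (Suc m) * C * G) * indicator {0..<1::real} s \<partial>lborel)"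
      proof (rule nn_integral_mono)
        fix s :: real
        have "(\<Sum>k<N. ennreal (d k ^ Suc m) * ((\<Sum>j\<in>grid n. ennreal (d k) * ennreal (cmod (\<phi> k ((s + of_int j) * d k)))) * indicator {0..<1} s))
            = (\<Sum>k<N. ennreal (d k ^ Suc m * (\<Sum>j\<in>grid n. d k * cmod (\<phi> k ((s + of_int j) * d k))))) * indicator {0..<1} s"
          unfolding sum_distrib_right
        proof (intro sum.cong refl)
          fix k assume "k \<in> {..<N}"
          then have k: "d k > 0" using d by simp
          show "ennreal (d k ^ Suc m) * ((\<Sum>j\<in>grid n. ennreal (d k) * ennreal (cmod (\<phi> k ((s + of_int j) * d k))) * indicator {0..<1} s))
            = ennreal (d k ^ Suc m * (\<Sum>j\<in>grid n. d k * cmod (\<phi> k ((s + of_int j) * d k)))) * indicator {0..<1} s"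
            using k by (simp add: sum_distrib_right[symmetric] ennreal_mult[symmetric] sum_ennreal sum_nonneg mult.assoc[symmetric] del: power_Suc)
        qed
        also have "(\<Sum>k<N. ennreal (d k ^ Suc m * (\<Sum>j\<in>grid n. d k * cmod (\<phi> k ((s + of_int j) * d k)))))
            = ennreal (\<Sum>k<N. d k ^ Suc m * (\<Sum>j\<in>grid n. d k * cmod (\<phi> k ((s + of_int j) * d k))))"
          using d by (intro sum_ennreal mult_nonneg_nonneg sum_nonneg) (auto simp: less_imp_le)
        also have "\<dots> \<le> ennreal (3 * pi / fact (Suc m) * C * G)" by (intro ennreal_leI point)
        finally show "(\<Sum>k<N. ennreal (d k ^ Suc m) * ((\<Sum>j\<in>grid n. ennreal (d k) * ennreal (cmod (\<phi> k ((s + of_int j) * d k)))) * indicator {0..<1} s))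
            \<le> ennreal (3 * pi / fact (Suc m) * C * G) * indicator {0..<1} s"
          by (simp add: mult_right_mono)
      qed
      also have "\<dots> = ennreal (3 * pi / fact (Suc m) * C * G)"
        by (subst nn_integral_cmult_indicator) auto
      finally show ?thesis .
    qed
    have "(\<lambda>n. \<Sum>k<N. ennreal (d k ^ Suc m) * (\<integral>\<^sup>+t. ennreal (cmod (\<phi> k t)) * indicator {- real n * d k..<real n * d k} t \<partial>lborel))
        \<longlonglongrightarrow> (\<Sum>k<N. ennreal (d k ^ Suc m) * (\<integral>\<^sup>+t. ennreal (cmod (\<phi> k t)) \<partial>lborel))"
    proof (intro tendsto_sum ennreal_tendsto_cmult nn_integral_window_limit)
      fix k assume "k \<in> {..<N}"
      then have k: "k < N" by simp
      note [measurable] = meas[OF k]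
      show "(\<lambda>t. ennreal (cmod (\<phi> k t))) \<in> borel_measurable borel" by measurable
      show "0 < d k" by (rule d[OF k])
    qed simp
    then have "(\<Sum>k<N. ennreal (d k ^ Suc m) * (\<integral>\<^sup>+t. ennreal (cmod (\<phi> k t)) \<partial>lborel)) \<le> ennreal (3 * pi / fact (Suc m) * C * G)"
      using window by (intro LIMSEQ_le_const2) auto
    then have "ennreal (2 ^ Suc m) * (\<Sum>k<N. ennreal (d k ^ Suc m) * (\<integral>\<^sup>+t. ennreal (cmod (\<phi> k t)) \<partial>lborel))
        \<le> ennreal (2 ^ Suc m) * ennreal (3 * pi / fact (Suc m) * C * G)" by (intro mult_left_mono) auto
    also have "ennreal (2 ^ Suc m) * ennreal (3 * pi / fact (Suc m) * C * G) = ennreal (2 ^ Suc m * (3 * pi / fact (Suc m) * C * G))"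
      by (intro ennreal_mult'[symmetric]) auto
    also have "ennreal (2 ^ Suc m) * (\<Sum>k<N. ennreal (d k ^ Suc m) * (\<integral>\<^sup>+t. ennreal (cmod (\<phi> k t)) \<partial>lborel))
        = (\<Sum>k<N. ennreal ((\<omega> - \<alpha> k) ^ Suc m) * vertical_norm (Suc (Suc m)) (\<alpha> k) (x k) (y k))"
      unfolding sum_distrib_left
    proof (intro sum.cong refl)
      fix k
      have "(\<omega> - \<alpha> k) ^ Suc m = 2 ^ Suc m * d k ^ Suc m"
        unfolding power_mult_distrib[symmetric] by (rule arg_cong[of _ _ "\<lambda>r. r ^ Suc m"]) (simp add: d_def)
      then show "ennreal (2 ^ Suc m) * (ennreal (d k ^ Suc m) * (\<integral>\<^sup>+t. ennreal (cmod (\<phi> k t)) \<partial>lborel))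
          = ennreal ((\<omega> - \<alpha> k) ^ Suc m) * vertical_norm (Suc (Suc m)) (\<alpha> k) (x k) (y k)"
        unfolding vertical_norm_def \<phi>_def by (simp only: ennreal_mult'[of "2 ^ Suc m"] zero_le_power zero_le_numeral mult.assoc)
    qed
    finally show "(\<Sum>k<N. ennreal ((\<omega> - \<alpha> k) ^ Suc m) * vertical_norm (Suc (Suc m)) (\<alpha> k) (x k) (y k))
        \<le> ennreal (2 ^ Suc m * (3 * pi / fact (Suc m) * C) * gauss_norm M \<gamma> N x * gauss_norm M \<gamma> N y)"
      by (simp add: G_def mult.assoc)
  qed
qed


section \<open>Integration along horizontal half-lines\<close>

text \<open>Positions are measured in units of the distance \<open>d\<close> to the line \<open>Re z = \<omega>\<close>, so that one value of the
  parameter \<open>\<sigma>\<close> can be used for all terms of a sum at once.\<close>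

definition horizontal :: "real \<Rightarrow> real \<Rightarrow> real \<Rightarrow> complex"
  where "horizontal d t \<sigma> = Complex (\<omega> - (1 + \<sigma>) * d) t"

text \<open>Along the half-line, \<open>R(z)\<^sup>k\<close> has the derivative \<open>- k R(z)\<^bsup>k+1\<^esup>\<close> in \<open>z\<close>, and applied to a vector
  it tends to \<open>0\<close> at the far end.\<close>

lemma norm_R_power_le_horizontal:
  assumes d: "d > 0" and y: "y \<in> dual"
  shows "ennreal (cmod (blinfun_apply y (Rpow (horizontal d t 0) (Suc k) x)))
    \<le> (\<integral>\<^sup>+\<sigma>. ennreal (real (Suc k) * d) * ennreal (indicator {0..} \<sigma> *\<^sub>R
        cmod (blinfun_apply y (Rpow (horizontal d t \<sigma>) (Suc (Suc k)) x))) \<partial>lborel)"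
    (is "_ \<le> ?I")
proof -
  let ?F = "\<lambda>n \<sigma>. blinfun_apply y (Rpow (horizontal d t \<sigma>) n x)"
  let ?g = "\<lambda>\<sigma>. of_real (real (Suc k) * d) * ?F (Suc (Suc k)) \<sigma>"
  have neg: "Re (horizontal d t \<sigma>) < \<omega>" if "\<sigma> \<ge> 0" for \<sigma>
    using d that by (simp add: horizontal_def mult_pos_pos add_pos_nonneg)
  have hd: "(horizontal d t has_vector_derivative of_real (- d)) (at \<sigma> within S)" for \<sigma> S
  proof -
    have "horizontal d t = (\<lambda>\<sigma>. Complex \<omega> t - of_real ((1 + \<sigma>) * d))"
      by (rule ext) (simp add: horizontal_def complex_eq_iff)
    then show ?thesis by (auto intro!: derivative_eq_intros)
  qed
  have der: "(?F (Suc k) has_vector_derivative ?g \<sigma>) (at \<sigma> within S)" if "\<sigma> \<ge> 0" for \<sigma> S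
  proof -
    have "((\<lambda>z. blinfun_apply y (Rpow z (Suc k) x)) has_field_derivative
        - (of_nat (Suc k) * ?F (Suc (Suc k)) \<sigma>)) (at (horizontal d t \<sigma>))"
      by (rule R_power_weak_derivative[OF neg[OF that] y])
    from field_vector_diff_chain_within[OF hd has_field_derivative_at_within[OF this]]
    show ?thesis by (simp add: o_def mult_ac del: of_nat_Suc funpow.simps)
  qed
  have cont_h: "continuous_on S (horizontal d t)" for S
    by (rule continuous_on_vector_derivative[OF hd])
  have cont: "continuous_on {0..real n} ?g" for n
  proof -
    have "continuous_on {0..real n} (?F (Suc (Suc k)))"
      by (rule continuous_on_compose2[OF holomorphic_on_imp_continuous_on[OF R_power_weak_holomorphic[OF y]] cont_h])
        (use neg in auto)
    then show ?thesis by (rule continuous_on_mult[OF continuous_on_const])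
  qed
  have le: "ennreal (cmod (?F (Suc k) 0)) \<le> ennreal (cmod (?F (Suc k) (real n))) + ?I" for n
  proof -
    have bi: "has_bochner_integral lborel (\<lambda>\<sigma>. indicator {0..real n} \<sigma> *\<^sub>R ?g \<sigma>) (?F (Suc k) (real n) - ?F (Suc k) 0)"
      by (rule has_bochner_integral_FTC_Icc[OF _ der cont]) auto
    then have int: "integrable lborel (\<lambda>\<sigma>. indicator {0..real n} \<sigma> *\<^sub>R ?g \<sigma>)"
      and val: "(\<integral>\<sigma>. indicator {0..real n} \<sigma> *\<^sub>R ?g \<sigma> \<partial>lborel) = ?F (Suc k) (real n) - ?F (Suc k) 0"
      by (auto simp: has_bochner_integral_iff)
    have "ennreal (cmod (?F (Suc k) 0)) \<le> ennreal (cmod (?F (Suc k) (real n)) + cmod (?F (Suc k) (real n) - ?F (Suc k) 0))"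
      by (intro ennreal_leI) (metis norm_minus_commute norm_triangle_sub)
    also have "\<dots> = ennreal (cmod (?F (Suc k) (real n))) + ennreal (cmod (?F (Suc k) (real n) - ?F (Suc k) 0))"
      by (rule ennreal_plus) auto
    also have "ennreal (cmod (?F (Suc k) (real n) - ?F (Suc k) 0)) \<le> (\<integral>\<^sup>+\<sigma>. norm (indicator {0..real n} \<sigma> *\<^sub>R ?g \<sigma>) \<partial>lborel)"
      unfolding val[symmetric] by (rule integral_norm_bound_ennreal[OF int])
    also have "\<dots> \<le> ?I"
      using d by (intro nn_integral_mono) (auto simp: indicator_def norm_mult ennreal_mult' simp del: of_nat_Suc funpow.simps)
    finally show ?thesis by simp
  qed
  have lim: "(\<lambda>n. ?F (Suc k) (real n)) \<longlonglongrightarrow> 0"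
  proof (rule LIMSEQ_I)
    fix e :: real assume e: "e > 0"
    have d': "\<omega> - d < \<omega>" using d by simp
    obtain M where M: "M > 0" "\<And>z. Re z \<le> \<omega> - d \<Longrightarrow> norm (R z) \<le> M" using R_bound[OF d'] by blast
    define e' where "e' = e / (norm y * M ^ k + 1)"
    have pos: "0 < norm y * M ^ k + 1" using M(1) by (simp add: add_nonneg_pos)
    then have e': "e' > 0" using e by (simp add: e'_def)
    obtain K where K: "\<And>z. Re z \<le> \<omega> - d \<Longrightarrow> K \<le> cmod z \<Longrightarrow> norm (R z x) < e'"
      using R_vanishes[OF d' e'] by blast
    obtain N :: nat where N: "(\<bar>K\<bar> + \<bar>\<omega>\<bar>) / d < real N" using reals_Archimedean2 by blast
    show "\<exists>no. \<forall>n\<ge>no. norm (?F (Suc k) (real n) - 0) < e"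
    proof (intro exI[of _ N] allI impI)
      fix n assume n: "n \<ge> N"
      let ?z = "horizontal d t (real n)"
      have "(1 + real n) * d \<ge> d" using d by (simp add: algebra_simps)
      then have z: "Re ?z \<le> \<omega> - d" by (simp add: horizontal_def)
      have "\<bar>K\<bar> + \<bar>\<omega>\<bar> < real N * d" using N d by (simp add: field_simps)
      also have "\<dots> \<le> (1 + real n) * d" using n d by (intro mult_right_mono) auto
      finally have "K \<le> \<bar>Re ?z\<bar>" unfolding horizontal_def complex.sel by linarith
      then have "K \<le> cmod ?z" using abs_Re_le_cmod[of ?z] by linarith
      then have Rx: "norm (R ?z x) < e'" by (rule K[OF z])
      have "norm (?F (Suc k) (real n)) \<le> norm y * norm (Rpow ?z k (R ?z x))"
        using norm_blinfun[of y] by (simp add: funpow_swap1)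
      also have "\<dots> \<le> norm y * (M ^ k * norm (R ?z x))"
        by (intro mult_left_mono norm_R_power[OF M(2) z]) auto
      also have "\<dots> \<le> norm y * (M ^ k * e')"
        using Rx M(1) by (intro mult_left_mono) auto
      also have "\<dots> < (norm y * M ^ k + 1) * e'" using e' by (simp add: algebra_simps)
      also have "\<dots> = e" using pos by (simp add: e'_def)
      finally show "norm (?F (Suc k) (real n) - 0) < e" by simp
    qed
  qed
  have "(\<lambda>n. ennreal (cmod (?F (Suc k) (real n))) + ?I) \<longlonglongrightarrow> ennreal 0 + ?I"
    using tendsto_norm_zero[OF lim] by (intro tendsto_add tendsto_ennrealI tendsto_const)
  then show ?thesis using le by (intro LIMSEQ_le_const[where a = "ennreal (cmod (?F (Suc k) 0))"]) auto
qed

text \<open>The pointwise estimate, integrated over the line; Tonelli's theorem turns the right-hand side into an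
  integral of vertical norms.\<close>

lemma vertical_norm_le_horizontal:
  assumes d: "d > 0" and y: "y \<in> dual"
  shows "vertical_norm (Suc k) (\<omega> - d) x y
      \<le> (\<integral>\<^sup>+\<sigma>. ennreal (real (Suc k) * d) * (indicator {0..} \<sigma> * vertical_norm (Suc (Suc k)) (\<omega> - (1 + \<sigma>) * d) x y) \<partial>lborel)"
    and "(\<lambda>\<sigma>. indicator {0..} \<sigma> * vertical_norm (Suc (Suc k)) (\<omega> - (1 + \<sigma>) * d) x y) \<in> borel_measurable borel"
proof -
  let ?q = "\<lambda>t \<sigma>. indicator {0..} \<sigma> *\<^sub>R cmod (blinfun_apply y (Rpow (horizontal d t \<sigma>) (Suc (Suc k)) x))"
  have "continuous_on (UNIV \<times> {0..}) (\<lambda>p. cmod (blinfun_apply y (Rpow (horizontal d (fst p) (snd p)) (Suc (Suc k)) x)))"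
  proof (rule continuous_on_norm, rule continuous_on_compose2[OF holomorphic_on_imp_continuous_on[OF R_power_weak_holomorphic[OF y]]])
    show "continuous_on (UNIV \<times> {0..}) (\<lambda>p. horizontal d (fst p) (snd p))"
      unfolding horizontal_def Complex_eq by (intro continuous_intros)
    show "(\<lambda>p. horizontal d (fst p) (snd p)) ` (UNIV \<times> {0..}) \<subseteq> {z. Re z < \<omega>}"
      using d by (auto simp: horizontal_def mult_pos_pos add_pos_nonneg)
  qed
  moreover have "(UNIV :: real set) \<times> {0::real..} \<in> sets borel"
    by (intro borel_closed closed_Times) auto
  ultimately have "(\<lambda>p. indicator (UNIV \<times> {0..}) p *\<^sub>R cmod (blinfun_apply y (Rpow (horizontal d (fst p) (snd p)) (Suc (Suc k)) x))) \<in> borel_measurable borel"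
    by (intro borel_measurable_continuous_on_indicator)
  moreover have "(\<lambda>p. indicator (UNIV \<times> {0..}) p *\<^sub>R cmod (blinfun_apply y (Rpow (horizontal d (fst p) (snd p)) (Suc (Suc k)) x)))
      = (\<lambda>(t, \<sigma>). ?q t \<sigma>)" by (rule ext) (auto simp: indicator_def)
  ultimately have meas: "(\<lambda>(t, \<sigma>). ?q t \<sigma>) \<in> borel_measurable (borel \<Otimes>\<^sub>M borel)"
    unfolding borel_prod by simp
  have meas2: "(\<lambda>(t, \<sigma>). ennreal (?q t \<sigma>)) \<in> borel_measurable (lborel \<Otimes>\<^sub>M lborel)"
    using measurable_compose[OF meas measurable_ennreal] by (simp add: case_prod_beta' cong: measurable_cong_sets)
  have meas3: "(\<lambda>(\<sigma>, t). ennreal (?q t \<sigma>)) \<in> borel_measurable (borel \<Otimes>\<^sub>M lborel)"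
    using measurable_compose[OF measurable_pair_swap' meas2] by (simp add: case_prod_beta' cong: measurable_cong_sets)
  have inner: "(\<integral>\<^sup>+t. ennreal (?q t \<sigma>) \<partial>lborel) = indicator {0..} \<sigma> * vertical_norm (Suc (Suc k)) (\<omega> - (1 + \<sigma>) * d) x y" for \<sigma>
    by (auto simp: indicator_def vertical_norm_def horizontal_def simp del: funpow.simps)
  show m: "(\<lambda>\<sigma>. indicator {0..} \<sigma> * vertical_norm (Suc (Suc k)) (\<omega> - (1 + \<sigma>) * d) x y) \<in> borel_measurable borel"
    unfolding inner[symmetric] using meas3 by (rule lborel.borel_measurable_nn_integral)
  have meas_t: "(\<lambda>\<sigma>. ennreal (?q t \<sigma>)) \<in> borel_measurable lborel" for t
    using measurable_compose[OF measurable_Pair1' meas2, of t] by simp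
  have "vertical_norm (Suc k) (\<omega> - d) x y = (\<integral>\<^sup>+t. ennreal (cmod (blinfun_apply y (Rpow (horizontal d t 0) (Suc k) x))) \<partial>lborel)"
    by (simp add: vertical_norm_def horizontal_def del: funpow.simps)
  also have "\<dots> \<le> (\<integral>\<^sup>+t. (\<integral>\<^sup>+\<sigma>. ennreal (real (Suc k) * d) * ennreal (?q t \<sigma>) \<partial>lborel) \<partial>lborel)"
    by (intro nn_integral_mono norm_R_power_le_horizontal[OF d y])
  also have "\<dots> = (\<integral>\<^sup>+\<sigma>. (\<integral>\<^sup>+t. ennreal (real (Suc k) * d) * ennreal (?q t \<sigma>) \<partial>lborel) \<partial>lborel)"
  proof (rule lborel_pair.Fubini'[symmetric])
    show "(\<lambda>(t, \<sigma>). ennreal (real (Suc k) * d) * ennreal (?q t \<sigma>)) \<in> borel_measurable (lborel \<Otimes>\<^sub>M lborel)"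
      using borel_measurable_times_ennreal[OF measurable_const meas2, of "ennreal (real (Suc k) * d)"] by (simp add: case_prod_beta')
  qed
  also have "\<dots> = (\<integral>\<^sup>+\<sigma>. ennreal (real (Suc k) * d) * (\<integral>\<^sup>+t. ennreal (?q t \<sigma>) \<partial>lborel) \<partial>lborel)"
  proof (intro nn_integral_cong nn_integral_cmult)
    fix \<sigma>
    show "(\<lambda>t. ennreal (?q t \<sigma>)) \<in> borel_measurable lborel"
      using measurable_compose[OF measurable_Pair2' meas2, of \<sigma>] by simp
  qed
  finally show "vertical_norm (Suc k) (\<omega> - d) x y
      \<le> (\<integral>\<^sup>+\<sigma>. ennreal (real (Suc k) * d) * (indicator {0..} \<sigma> * vertical_norm (Suc (Suc k)) (\<omega> - (1 + \<sigma>) * d) x y) \<partial>lborel)"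
    unfolding inner .
qed

lemma nn_integral_inverse_square_tail:
  "(\<integral>\<^sup>+\<sigma>. ennreal (1 / (1 + \<sigma>)\<^sup>2) * indicator {0..} \<sigma> \<partial>lborel) = 1"
proof -
  have "(\<integral>\<^sup>+\<sigma>. ennreal (1 / (1 + \<sigma>)\<^sup>2) * indicator {0::real..} \<sigma> \<partial>lborel) = ennreal (0 - (- (1 / (1 + 0))))"
  proof (rule nn_integral_FTC_atLeast)
    show "((\<lambda>\<sigma>. - (1 / (1 + \<sigma>))) has_real_derivative 1 / (1 + \<sigma>)\<^sup>2) (at \<sigma>)" if "0 \<le> \<sigma>" for \<sigma> :: real
      using that by (auto intro!: derivative_eq_intros simp: power2_eq_square)
    show "((\<lambda>\<sigma>::real. - (1 / (1 + \<sigma>))) \<longlongrightarrow> 0) at_top" by real_asymp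
  qed auto
  then show ?thesis by simp
qed

text \<open>For each \<open>\<sigma>\<close> the hypothesis applies to the abscissae \<open>\<omega> - (1 + \<sigma>) d\<^sub>k\<close>, and its weights exceed
  \<open>d\<^sub>k\<^bsup>m+1\<^esup>\<close> by the common factor \<open>(1 + \<sigma>)\<^bsup>m+1\<^esup>\<close>, which is integrable in the denominator.\<close>

lemma Wgamma_GFS_Suc_imp:
  assumes GFS: "Wgamma_GFS M \<gamma> (Suc m) \<omega> A" and m: "m \<ge> 1"
  shows "Wgamma_GFS M \<gamma> m \<omega> A"
proof -
  obtain C where C: "C \<ge> 0" "\<And>N \<alpha> x y. (\<forall>k<N. \<alpha> k < \<omega>) \<and> (\<forall>k<N. y k \<in> dual) \<Longrightarrow>
      (\<Sum>k<N. ennreal ((\<omega> - \<alpha> k) ^ Suc m) * vertical_norm (Suc (Suc m)) (\<alpha> k) (x k) (y k))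
        \<le> ennreal (C * gauss_norm M \<gamma> N x * gauss_norm M \<gamma> N y)"
    using GFS unfolding Wgamma_GFS_iff by blast
  show ?thesis
    unfolding Wgamma_GFS_iff
  proof (intro exI[of _ "real (Suc m) * C"] conjI allI impI)
    fix N :: nat and \<alpha> :: "nat \<Rightarrow> real" and x :: "nat \<Rightarrow> 'a" and y :: "nat \<Rightarrow> 'a \<Rightarrow>\<^sub>L complex"
    assume asm: "(\<forall>k<N. \<alpha> k < \<omega>) \<and> (\<forall>k<N. y k \<in> dual)"
    define G where "G = gauss_norm M \<gamma> N x * gauss_norm M \<gamma> N y"
    have G: "G \<ge> 0" by (simp add: G_def gauss_norm_nonneg)
    define d where "d k = \<omega> - \<alpha> k" for k
    have d: "d k > 0" if "k < N" for k using asm that by (simp add: d_def)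
    define V where "V k \<sigma> = (indicator {0..} \<sigma> * vertical_norm (Suc (Suc m)) (\<omega> - (1 + \<sigma>) * d k) (x k) (y k) :: ennreal)" for k \<sigma>
    have meas: "V k \<in> borel_measurable borel" if "k < N" for k
      unfolding V_def using asm that by (intro vertical_norm_le_horizontal(2)[OF d[OF that]]) auto
    have term_le: "ennreal (d k ^ m) * vertical_norm (Suc m) (\<alpha> k) (x k) (y k)
        \<le> (\<integral>\<^sup>+\<sigma>. ennreal (real (Suc m)) * (ennreal (d k ^ Suc m) * V k \<sigma>) \<partial>lborel)" if k: "k < N" for k
    proof -
      have yk: "y k \<in> dual" using asm k by blast
      note [measurable] = meas[OF k]
      have "vertical_norm (Suc m) (\<alpha> k) (x k) (y k) \<le> (\<integral>\<^sup>+\<sigma>. ennreal (real (Suc m) * d k) * V k \<sigma> \<partial>lborel)"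
        using vertical_norm_le_horizontal(1)[OF d[OF k] yk, of m "x k"] by (simp add: d_def V_def)
      then have "ennreal (d k ^ m) * vertical_norm (Suc m) (\<alpha> k) (x k) (y k)
          \<le> ennreal (d k ^ m) * (\<integral>\<^sup>+\<sigma>. ennreal (real (Suc m) * d k) * V k \<sigma> \<partial>lborel)" by (rule mult_left_mono) simp
      also have "\<dots> = (\<integral>\<^sup>+\<sigma>. ennreal (d k ^ m) * (ennreal (real (Suc m) * d k) * V k \<sigma>) \<partial>lborel)"
        by (intro nn_integral_cmult[symmetric]) measurable
      also have "\<dots> = (\<integral>\<^sup>+\<sigma>. ennreal (real (Suc m)) * (ennreal (d k ^ Suc m) * V k \<sigma>) \<partial>lborel)"
      proof -
        have "ennreal (d k ^ m) * ennreal (real (Suc m) * d k) = ennreal (d k ^ m * (real (Suc m) * d k))"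
          using d[OF k] by (intro ennreal_mult'[symmetric]) simp
        also have "d k ^ m * (real (Suc m) * d k) = real (Suc m) * d k ^ Suc m" by simp
        also have "ennreal \<dots> = ennreal (real (Suc m)) * ennreal (d k ^ Suc m)" by (intro ennreal_mult') simp
        finally show ?thesis by (simp only: mult.assoc[symmetric])
      qed
      finally show ?thesis .
    qed
    have point: "(\<Sum>k<N. ennreal (d k ^ Suc m) * V k \<sigma>) \<le> ennreal (C * G) * (ennreal (1 / (1 + \<sigma>)\<^sup>2) * indicator {0..} \<sigma>)" for \<sigma>
    proof (cases "\<sigma> \<ge> 0")
      case True
      then have pos: "1 + \<sigma> > 0" by simp
      have "(\<Sum>k<N. ennreal ((\<omega> - (\<omega> - (1 + \<sigma>) * d k)) ^ Suc m) * vertical_norm (Suc (Suc m)) (\<omega> - (1 + \<sigma>) * d k) (x k) (y k))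
          \<le> ennreal (C * gauss_norm M \<gamma> N x * gauss_norm M \<gamma> N y)"
        using asm d pos by (intro C(2)) auto
      moreover have "ennreal ((\<omega> - (\<omega> - (1 + \<sigma>) * d k)) ^ Suc m) = ennreal ((1 + \<sigma>) ^ Suc m) * ennreal (d k ^ Suc m)" for k
      proof -
        have "(\<omega> - (\<omega> - (1 + \<sigma>) * d k)) ^ Suc m = (1 + \<sigma>) ^ Suc m * d k ^ Suc m"
          unfolding power_mult_distrib[symmetric] by (rule arg_cong[of _ _ "\<lambda>r. r ^ Suc m"]) simp
        then show ?thesis using pos by (simp only: ennreal_mult' zero_le_power less_imp_le)
      qed
      ultimately have "ennreal ((1 + \<sigma>) ^ Suc m) * (\<Sum>k<N. ennreal (d k ^ Suc m) * V k \<sigma>) \<le> ennreal (C * G)"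
        using True by (simp add: V_def G_def sum_distrib_left mult.assoc del: power_Suc)
      then have "ennreal (1 / (1 + \<sigma>) ^ Suc m) * (ennreal ((1 + \<sigma>) ^ Suc m) * (\<Sum>k<N. ennreal (d k ^ Suc m) * V k \<sigma>))
          \<le> ennreal (1 / (1 + \<sigma>) ^ Suc m) * ennreal (C * G)" by (rule mult_left_mono) simp
      moreover have "ennreal (1 / (1 + \<sigma>) ^ Suc m) * ennreal ((1 + \<sigma>) ^ Suc m) = 1"
        using pos by (subst ennreal_mult'[symmetric]) (auto simp del: power_Suc)
      ultimately have "(\<Sum>k<N. ennreal (d k ^ Suc m) * V k \<sigma>) \<le> ennreal (1 / (1 + \<sigma>) ^ Suc m) * ennreal (C * G)"
        by (simp only: mult.assoc[symmetric] mult_1_left)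
      also have "\<dots> \<le> ennreal (1 / (1 + \<sigma>)\<^sup>2) * ennreal (C * G)"
      proof (intro mult_right_mono ennreal_leI divide_left_mono)
        show "(1 + \<sigma>)\<^sup>2 \<le> (1 + \<sigma>) ^ Suc m" using True m by (intro power_increasing) auto
      qed (use pos in \<open>auto simp del: power_Suc\<close>)
      finally show ?thesis using True by (simp add: mult.commute)
    qed (simp add: V_def)
    have "(\<Sum>k<N. ennreal ((\<omega> - \<alpha> k) ^ m) * vertical_norm (Suc m) (\<alpha> k) (x k) (y k))
        \<le> (\<Sum>k<N. \<integral>\<^sup>+\<sigma>. ennreal (real (Suc m)) * (ennreal (d k ^ Suc m) * V k \<sigma>) \<partial>lborel)"
      unfolding d_def[symmetric] by (intro sum_mono term_le) simp
    also have "\<dots> = (\<integral>\<^sup>+\<sigma>. (\<Sum>k<N. ennreal (real (Suc m)) * (ennreal (d k ^ Suc m) * V k \<sigma>)) \<partial>lborel)"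
    proof (rule nn_integral_sum[symmetric])
      fix k assume "k \<in> {..<N}"
      then have k: "k < N" by simp
      note [measurable] = meas[OF k]
      show "(\<lambda>\<sigma>. ennreal (real (Suc m)) * (ennreal (d k ^ Suc m) * V k \<sigma>)) \<in> borel_measurable lborel" by measurable
    qed
    also have "\<dots> \<le> (\<integral>\<^sup>+\<sigma>. ennreal (real (Suc m) * (C * G)) * (ennreal (1 / (1 + \<sigma>)\<^sup>2) * indicator {0..} \<sigma>) \<partial>lborel)"
    proof (intro nn_integral_mono)
      fix \<sigma>
      have "(\<Sum>k<N. ennreal (real (Suc m)) * (ennreal (d k ^ Suc m) * V k \<sigma>)) = ennreal (real (Suc m)) * (\<Sum>k<N. ennreal (d k ^ Suc m) * V k \<sigma>)"
        by (simp only: sum_distrib_left)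
      also have "\<dots> \<le> ennreal (real (Suc m)) * (ennreal (C * G) * (ennreal (1 / (1 + \<sigma>)\<^sup>2) * indicator {0..} \<sigma>))"
        by (intro mult_left_mono point) simp
      finally show "(\<Sum>k<N. ennreal (real (Suc m)) * (ennreal (d k ^ Suc m) * V k \<sigma>))
          \<le> ennreal (real (Suc m) * (C * G)) * (ennreal (1 / (1 + \<sigma>)\<^sup>2) * indicator {0..} \<sigma>)"
        by (simp only: ennreal_mult'[OF of_nat_0_le_iff] mult.assoc)
    qed
    also have "\<dots> = ennreal (real (Suc m) * (C * G))"
      by (subst nn_integral_cmult) (simp_all add: nn_integral_inverse_square_tail)
    finally show "(\<Sum>k<N. ennreal ((\<omega> - \<alpha> k) ^ m) * vertical_norm (Suc m) (\<alpha> k) (x k) (y k))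
        \<le> ennreal (real (Suc m) * C * gauss_norm M \<gamma> N x * gauss_norm M \<gamma> N y)"
      by (simp only: G_def mult.assoc)
  qed (use C(1) in simp)
qed

end

section \<open>The semigroup\<close>

lemma tendsto_zero_by_density:
  fixes Q :: "real \<Rightarrow> 'a::real_normed_vector \<Rightarrow> 'b::real_normed_vector"
  assumes lip: "\<And>h x x'. 0 < h \<Longrightarrow> h \<le> 1 \<Longrightarrow> norm (Q h x - Q h x') \<le> K * norm (x - x')"
    and dense: "closure D = UNIV"
    and lim: "\<And>x. x \<in> D \<Longrightarrow> ((\<lambda>h. Q h x) \<longlongrightarrow> 0) (at_right 0)"
  shows "((\<lambda>h. Q h x) \<longlongrightarrow> 0) (at_right 0)"
proof (rule tendstoI)
  fix e :: real assume e: "e > 0"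
  have "x \<in> closure D" using dense by simp
  then obtain x' where x': "x' \<in> D" "dist x' x < e / (2 * (\<bar>K\<bar> + 1))"
    unfolding closure_approachable using e by (metis abs_ge_zero add_nonneg_pos divide_pos_pos mult_pos_pos zero_less_numeral zero_less_one)
  have "\<forall>\<^sub>F h in at_right 0. dist (Q h x') 0 < e / 2"
    using lim[OF x'(1)] e by (intro tendstoD) auto
  moreover have "\<forall>\<^sub>F h in at_right 0. 0 < h \<and> h \<le> (1::real)"
    by (auto simp: eventually_at_right_field intro!: exI[of _ 1])
  ultimately show "\<forall>\<^sub>F h in at_right 0. dist (Q h x) 0 < e"
  proof eventually_elim
    case (elim h)
    have "norm (Q h x - Q h x') \<le> K * norm (x - x')" using elim by (intro lip) auto
    also have "\<dots> \<le> (\<bar>K\<bar> + 1) * norm (x - x')" by (intro mult_right_mono) auto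
    also have "\<dots> \<le> (\<bar>K\<bar> + 1) * (e / (2 * (\<bar>K\<bar> + 1)))"
      using x'(2) by (intro mult_left_mono) (auto simp: dist_norm norm_minus_commute)
    also have "\<dots> = e / 2" by (simp add: field_simps)
    finally have "norm (Q h x - Q h x') \<le> e / 2" .
    then show ?case using elim norm_triangle_sub[of "Q h x" "Q h x'"] by simp
  qed
qed

lemma half_plane_decay_exp:
  assumes "t \<ge> 0" and F: "half_plane_decay a F"
  shows "half_plane_decay a (\<lambda>z. exp (- (of_real t * z)) * F z)"
proof (rule half_plane_decay_mult[OF _ _ F])
  show "(\<lambda>z. exp (- (of_real t * z))) holomorphic_on half_plane a" by (intro holomorphic_intros)
  fix z assume "z \<in> half_plane a"
  then have "t * a \<le> t * Re z" using assms(1) by (intro mult_left_mono) (auto simp: half_plane_def)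
  then show "cmod (exp (- (of_real t * z))) \<le> exp (- (t * a))" by simp
qed

text \<open>A family of operators that the functional calculus regards as \<open>exp (- t A)\<close>: after regularization by
  \<open>R(\<omega> - 2)\<^sup>2\<close> it is given by the elementary integral along \<open>Re z = \<omega> - 1/2\<close>.  This is the line that the elementary
  calculus uses for functions on \<open>Re z > \<omega> - 1\<close>, and \<open>\<omega> - 2\<close> is a point to the left of that half-plane.\<close>

locale exponential_family = half_plane_operator A \<omega>
  for A :: "('a::complex_banach \<times> 'a) set" and \<omega> +
  fixes T :: "real \<Rightarrow> 'a \<Rightarrow>\<^sub>L 'a" and K :: real
  assumes T_clinear: "0 \<le> t \<Longrightarrow> T t \<in> bounded_clinear"
    and T_zero: "T 0 = id_blinfun"
    and T_bound: "0 \<le> t \<Longrightarrow> norm (T t) \<le> K * exp (- \<omega> * t)"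
    and T_weak: "0 \<le> t \<Longrightarrow> y \<in> dual \<Longrightarrow>
      blinfun_apply y (resolvent A (of_real (\<omega> - 2)) (resolvent A (of_real (\<omega> - 2)) (T t x)))
      = - (1 / (2 * of_real pi)) * line_integral (\<omega> - 1 / 2)
          (\<lambda>z. exp (- (of_real t * z)) * (1 / (of_real (\<omega> - 2) - z)\<^sup>2) * blinfun_apply y (resolvent A z x))"
begin

definition \<mu> :: complex where "\<mu> = of_real (\<omega> - 2)"
definition \<delta> :: real where "\<delta> = \<omega> - 1 / 2"
definition P :: "'a \<Rightarrow>\<^sub>L 'a" where "P = R \<mu>"
abbreviation Ppow :: "nat \<Rightarrow> 'a \<Rightarrow> 'a" where "Ppow n \<equiv> blinfun_apply P ^^ n"

lemma \<mu>: "Re \<mu> < \<omega>" "Re \<mu> < \<omega> - 1" and \<delta>: "\<omega> - 1 < \<delta>" "\<delta> < \<omega>"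
  by (auto simp: \<mu>_def \<delta>_def)

lemma T_weak_power:
  assumes t: "0 \<le> t" and y: "y \<in> dual" and k: "k \<ge> 2"
  shows "blinfun_apply y (Ppow k (T t x)) = - (1 / (2 * of_real pi)) *
    line_integral \<delta> (\<lambda>z. exp (- (of_real t * z)) * (1 / (\<mu> - z) ^ k) * blinfun_apply y (R z x))"
proof -
  obtain j where j: "k = j + 2" using k by (metis add.commute le_Suc_ex)
  let ?y = "y o\<^sub>L blinfun_power P j"
  have y': "?y \<in> dual"
    unfolding P_def by (intro bounded_clinear_compose y bounded_clinear_power R_clinear \<mu>)
  have dec: "half_plane_decay (\<omega> - 1) (\<lambda>z. exp (- (of_real t * z)) * (1 / (\<mu> - z)\<^sup>2))"
    by (intro half_plane_decay_exp t half_plane_decay_inverse_square \<mu>)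
  have "blinfun_apply y (Ppow k (T t x)) = blinfun_apply ?y (P (P (T t x)))"
    by (simp add: j blinfun_power_apply funpow_swap1)
  also have "\<dots> = - (1 / (2 * of_real pi)) *
      line_integral \<delta> (\<lambda>z. exp (- (of_real t * z)) * (1 / (\<mu> - z)\<^sup>2) * blinfun_apply ?y (R z x))"
    unfolding P_def \<mu>_def \<delta>_def by (rule T_weak[OF t y'[unfolded P_def \<mu>_def]])
  also have "line_integral \<delta> (\<lambda>z. exp (- (of_real t * z)) * (1 / (\<mu> - z)\<^sup>2) * blinfun_apply ?y (R z x))
      = line_integral \<delta> (\<lambda>z. exp (- (of_real t * z)) * (1 / (\<mu> - z)\<^sup>2) / (\<mu> - z) ^ j * blinfun_apply y (R z x))"
    using line_integral_mult_R_power[OF dec \<mu>(2) \<delta> y, of j x] by (simp add: blinfun_power_apply P_def)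
  also have "(\<lambda>z. exp (- (of_real t * z)) * (1 / (\<mu> - z)\<^sup>2) / (\<mu> - z) ^ j * blinfun_apply y (R z x))
      = (\<lambda>z. exp (- (of_real t * z)) * (1 / (\<mu> - z) ^ k) * blinfun_apply y (R z x))"
    by (simp add: j power_add power2_eq_square mult_ac)
  finally show ?thesis .
qed

lemma P_inj: "P u = P v \<Longrightarrow> u = v"
  unfolding P_def by (rule R_inj[OF \<mu>(1)])

text \<open>Resolvents commute under the integral, so both sides have the same regularized pairings.\<close>

lemma T_R_commute:
  assumes t: "0 \<le> t" and z: "Re z < \<omega>"
  shows "T t (R z x) = R z (T t x)"
proof -
  have "P (P (T t (R z x))) = P (P (R z (T t x)))"
  proof (rule functionals_separate)
    fix y :: "'a \<Rightarrow>\<^sub>L complex" assume y: "y \<in> dual"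
    have y': "y o\<^sub>L R z \<in> bounded_clinear" by (intro bounded_clinear_compose y R_clinear z)
    have "blinfun_apply y (P (P (R z (T t x)))) = blinfun_apply (y o\<^sub>L R z) (P (P (T t x)))"
      unfolding P_def by (simp add: R_commute[OF \<mu>(1) z])
    also have "\<dots> = - (1 / (2 * of_real pi)) * line_integral \<delta>
        (\<lambda>w. exp (- (of_real t * w)) * (1 / (\<mu> - w)\<^sup>2) * blinfun_apply (y o\<^sub>L R z) (R w x))"
      using T_weak_power[OF t y', of 2 x] by (simp add: numeral_2_eq_2)
    also have "line_integral \<delta> (\<lambda>w. exp (- (of_real t * w)) * (1 / (\<mu> - w)\<^sup>2) * blinfun_apply (y o\<^sub>L R z) (R w x))
        = line_integral \<delta> (\<lambda>w. exp (- (of_real t * w)) * (1 / (\<mu> - w)\<^sup>2) * blinfun_apply y (R w (R z x)))"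
      unfolding line_integral_def using \<delta> R_commute[OF z, of "Complex \<delta> _" x]
      by (intro Bochner_Integration.integral_cong) simp_all
    also have "- (1 / (2 * of_real pi)) * \<dots> = blinfun_apply y (P (P (T t (R z x))))"
      using T_weak_power[OF t y, of 2 "R z x"] by (simp add: numeral_2_eq_2)
    finally show "blinfun_apply y (P (P (T t (R z x)))) = blinfun_apply y (P (P (R z (T t x))))" by (rule sym)
  qed
  then show ?thesis by (rule P_inj[OF P_inj])
qed

lemma T_P_commute: "0 \<le> t \<Longrightarrow> T t (P x) = P (T t x)"
  unfolding P_def by (rule T_R_commute[OF _ \<mu>(1)])

lemma T_P_power_commute: "0 \<le> t \<Longrightarrow> T t (Ppow n x) = Ppow n (T t x)"
  by (induction n) (simp_all add: T_P_commute)

lemma T_bounded_on: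
  assumes "b \<ge> 0"
  obtains C where "C \<ge> 0" "\<And>t. 0 \<le> t \<Longrightarrow> t \<le> b \<Longrightarrow> norm (T t) \<le> C"
proof (rule that[of "\<bar>K\<bar> * exp (\<bar>\<omega>\<bar> * b)"])
  fix t assume t: "0 \<le> t" "t \<le> b"
  have "- \<omega> * t \<le> \<bar>\<omega>\<bar> * t" using t by (intro mult_right_mono) auto
  also have "\<dots> \<le> \<bar>\<omega>\<bar> * b" using t by (intro mult_left_mono) auto
  finally have "exp (- \<omega> * t) \<le> exp (\<bar>\<omega>\<bar> * b)" by simp
  then have "K * exp (- \<omega> * t) \<le> \<bar>K\<bar> * exp (\<bar>\<omega>\<bar> * b)" by (intro mult_mono) auto
  with T_bound[OF t(1)] show "norm (T t) \<le> \<bar>K\<bar> * exp (\<bar>\<omega>\<bar> * b)" by linarith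
qed simp

text \<open>\<open>- A\<close> after regularization: \<open>B u = - A P\<^sup>4 u\<close> because \<open>A P = \<mu> P - I\<close>.\<close>

definition B :: "'a \<Rightarrow> 'a"
  where "B u = Ppow 3 u - \<mu> *\<^sub>C Ppow 4 u"

lemma T_B_commute: "0 \<le> t \<Longrightarrow> T t (B u) = B (T t u)"
  by (simp add: B_def blinfun.diff_right bounded_clinear_scaleC[OF T_clinear] T_P_power_commute del: funpow.simps)

text \<open>Second-order Taylor expansion of \<open>exp (- t z)\<close> in \<open>t\<close> under the integral.  The remainder grows like
  \<open>|z|\<^sup>2\<close>, so the regularization by \<open>P\<^sup>4\<close> leaves exactly the decay that makes the integral converge.\<close>

lemma T_expansion:
  assumes b: "b \<ge> 0"
  obtains C where "C \<ge> 0"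
    "\<And>s t u. \<lbrakk>0 \<le> s; s \<le> b; 0 \<le> t; t \<le> b\<rbrakk> \<Longrightarrow>
      norm (T s (Ppow 4 u) - T t (Ppow 4 u) - (s - t) *\<^sub>R T t (B u))
        \<le> C * norm u * (s - t)\<^sup>2"
proof -
  obtain M where M: "M > 0" "\<And>z. Re z \<le> \<delta> \<Longrightarrow> norm (R z) \<le> M" using R_bound[OF \<delta>(2)] by blast
  \<comment> \<open>The constant of the lemma on shifted squares for points at distance at least \<open>1\<close> from \<open>\<mu>\<close>.\<close>
  define Q where "Q = (1 + 2 * (cmod \<mu>)\<^sup>2) / 1\<^sup>2 + 2"
  define C where "C = exp (\<bar>\<delta>\<bar> * b) * (exp (\<bar>\<delta>\<bar> * b) * Q\<^sup>2) * M"
  have Q: "Q \<ge> 0" by (simp add: Q_def)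
  have C: "C \<ge> 0" using M Q by (simp add: C_def)
  show thesis
  proof (rule that[OF C])
    fix s t :: real and u
    assume st: "0 \<le> s" "s \<le> b" "0 \<le> t" "t \<le> b"
    define h where "h = s - t"
    have h: "\<bar>h\<bar> \<le> b" using st by (auto simp: h_def)
    let ?D = "T s (Ppow 4 u) - T t (Ppow 4 u) - (s - t) *\<^sub>R T t (B u)"
    show "norm ?D \<le> C * norm u * (s - t)\<^sup>2"
    proof (rule norm_le_by_functionals)
      fix y :: "'a \<Rightarrow>\<^sub>L complex" assume y: "y \<in> dual"
      define r where "r z = blinfun_apply y (R z u)" for z
      define g where "g k t z = exp (- (of_real t * z)) * (1 / (\<mu> - z) ^ k) * r z" for k :: nat and t z
      have int: "integrable lborel (\<lambda>\<tau>. g k t (Complex \<delta> \<tau>))" if "0 \<le> t" "k \<ge> 2" for k t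
      proof -
        have "half_plane_decay (\<omega> - 1) (\<lambda>z. exp (- (of_real t * z)) * (1 / (\<mu> - z) ^ k))"
          by (intro half_plane_decay_exp that half_plane_decay_inverse_power \<mu>)
        from strip_decay_integrable[OF strip_decay_mult[OF R_strip_bounded[OF y] half_plane_decay_strip[OF this]] \<delta>]
        show ?thesis by (simp add: g_def r_def mult.commute)
      qed
      have w: "blinfun_apply y (Ppow k (T t u)) = - (1 / (2 * of_real pi)) * line_integral \<delta> (g k t)"
        if "0 \<le> t" "k \<ge> 2" for k t
        unfolding g_def r_def by (rule T_weak_power[OF that(1) y that(2)])
      let ?G = "\<lambda>z. g 4 s z - g 4 t z - of_real h * (g 3 t z - \<mu> * g 4 t z)"
      have "blinfun_apply y ?D = blinfun_apply y (Ppow 4 (T s u)) - blinfun_apply y (Ppow 4 (T t u))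
          - of_real h * (blinfun_apply y (Ppow 3 (T t u)) - \<mu> * blinfun_apply y (Ppow 4 (T t u)))"
        unfolding T_B_commute[OF st(3)] T_P_power_commute[OF st(1)] T_P_power_commute[OF st(3)]
        unfolding B_def
        by (simp add: h_def blinfun.diff_right blinfun.scaleR_right functional_scaleC[OF y] scaleR_conv_of_real)
      also have "\<dots> = - (1 / (2 * of_real pi)) * (line_integral \<delta> (g 4 s) - line_integral \<delta> (g 4 t)
          - of_real h * (line_integral \<delta> (g 3 t) - \<mu> * line_integral \<delta> (g 4 t)))"
        using st by (subst (1 2 3 4) w) (simp_all add: algebra_simps)
      also have "line_integral \<delta> (g 4 s) - line_integral \<delta> (g 4 t) - of_real h * (line_integral \<delta> (g 3 t) - \<mu> * line_integral \<delta> (g 4 t))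
          = line_integral \<delta> ?G"
        unfolding line_integral_def using int[of s 4] int[of t 4] int[of t 3] st by simp
      finally have yD: "blinfun_apply y ?D = - (1 / (2 * of_real pi)) * line_integral \<delta> ?G" .
      have point: "cmod (?G (Complex \<delta> \<tau>)) \<le> (C * norm u * h\<^sup>2 * norm y) / (1 + \<tau>\<^sup>2)" for \<tau>
      proof -
        let ?z = "Complex \<delta> \<tau>"
        have dist: "1 \<le> cmod (\<mu> - ?z)"
          using abs_Re_le_cmod[of "\<mu> - ?z"] by (simp add: \<mu>_def \<delta>_def)
        then have nz: "\<mu> - ?z \<noteq> 0" by auto
        have p34: "1 / (\<mu> - ?z) ^ 3 = (\<mu> - ?z) * (1 / (\<mu> - ?z) ^ 4)"
          using nz by (simp add: power3_eq_cube power4_eq_xxxx)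
        have es: "exp (- (of_real s * ?z)) = exp (- (of_real t * ?z)) * exp (- (of_real h * ?z))"
          by (simp add: h_def exp_add[symmetric] algebra_simps)
        \<comment> \<open>Since \<open>1 / (\<mu> - z)\<^sup>3 - \<mu> / (\<mu> - z)\<^sup>4 = - z / (\<mu> - z)\<^sup>4\<close>, the integrand contains the Taylor remainder of \<open>exp\<close> at \<open>- h z\<close>.\<close>
        have fact: "?G ?z = exp (- (of_real t * ?z)) * (exp (- (of_real h * ?z)) - (1 + (- (of_real h * ?z)))) * (1 / (\<mu> - ?z) ^ 4) * r ?z"
        proof -
          define w where "w = 1 / (\<mu> - ?z) ^ 4"
          show ?thesis unfolding g_def es p34 w_def[symmetric] by (simp add: algebra_simps)
        qed
        have e1: "cmod (exp (- (of_real t * ?z))) \<le> exp (\<bar>\<delta>\<bar> * b)"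
        proof -
          have "- (t * \<delta>) \<le> \<bar>t * \<delta>\<bar>" by (rule abs_ge_minus_self)
          also have "\<dots> = t * \<bar>\<delta>\<bar>" using st by (simp add: abs_mult)
          also have "\<dots> \<le> b * \<bar>\<delta>\<bar>" using st by (intro mult_right_mono) auto
          finally show ?thesis by (simp add: mult.commute)
        qed
        have "cmod (exp (- (of_real h * ?z)) - (\<Sum>k\<le>1. (- (of_real h * ?z)) ^ k / fact k))
            \<le> exp \<bar>Re (- (of_real h * ?z))\<bar> * cmod (- (of_real h * ?z)) ^ Suc 1 / fact 1"
          by (rule Taylor_exp)
        then have "cmod (exp (- (of_real h * ?z)) - (1 + (- (of_real h * ?z)))) \<le> exp \<bar>h * \<delta>\<bar> * (h\<^sup>2 * (cmod ?z)\<^sup>2)"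
          by (simp add: norm_mult power2_eq_square mult_ac abs_mult_self_eq)
        also have "\<dots> \<le> exp (\<bar>\<delta>\<bar> * b) * (h\<^sup>2 * (cmod ?z)\<^sup>2)"
          using h by (intro mult_right_mono) (auto simp: abs_mult mult.commute mult_right_mono)
        finally have e2: "cmod (exp (- (of_real h * ?z)) - (1 + (- (of_real h * ?z)))) \<le> exp (\<bar>\<delta>\<bar> * b) * (h\<^sup>2 * (cmod ?z)\<^sup>2)" .
        have e3: "(cmod ?z)\<^sup>2 * cmod (1 / (\<mu> - ?z) ^ 4) \<le> Q\<^sup>2 / (1 + \<tau>\<^sup>2)"
        proof -
          have i: "1 + (cmod ?z)\<^sup>2 \<le> Q * (cmod (\<mu> - ?z))\<^sup>2"
            unfolding Q_def by (rule shifted_square_bound[OF _ dist]) simp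
          have "(1 + \<tau>\<^sup>2) * (cmod ?z)\<^sup>2 \<le> (1 + (cmod ?z)\<^sup>2) * (1 + (cmod ?z)\<^sup>2)"
            by (intro mult_mono) (auto simp: cmod_power2)
          also have "\<dots> \<le> (Q * (cmod (\<mu> - ?z))\<^sup>2) * (Q * (cmod (\<mu> - ?z))\<^sup>2)"
            using Q by (intro mult_mono i) auto
          finally have "(1 + \<tau>\<^sup>2) * (cmod ?z)\<^sup>2 \<le> Q\<^sup>2 * cmod (\<mu> - ?z) ^ 4"
            by (simp add: power2_eq_square power4_eq_xxxx mult_ac)
          then show ?thesis using nz one_plus_square_pos[of \<tau>] by (simp add: norm_divide norm_power field_simps)
        qed
        have e4: "cmod (r ?z) \<le> norm y * (M * norm u)"
          unfolding r_def using M(2)[of ?z]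
          by (intro order.trans[OF norm_blinfun] mult_left_mono mult_right_mono) auto
        have "cmod (?G ?z) = cmod (exp (- (of_real t * ?z))) * cmod (exp (- (of_real h * ?z)) - (1 + (- (of_real h * ?z))))
            * cmod (1 / (\<mu> - ?z) ^ 4) * cmod (r ?z)" unfolding fact by (simp only: norm_mult)
        also have "\<dots> \<le> exp (\<bar>\<delta>\<bar> * b) * (exp (\<bar>\<delta>\<bar> * b) * (h\<^sup>2 * (cmod ?z)\<^sup>2)) * cmod (1 / (\<mu> - ?z) ^ 4) * (norm y * (M * norm u))"
          by (intro mult_mono e1 e2 e4) auto
        also have "\<dots> = exp (\<bar>\<delta>\<bar> * b) * exp (\<bar>\<delta>\<bar> * b) * h\<^sup>2 * ((cmod ?z)\<^sup>2 * cmod (1 / (\<mu> - ?z) ^ 4)) * (norm y * (M * norm u))"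
          by (simp only: mult_ac)
        also have "\<dots> \<le> exp (\<bar>\<delta>\<bar> * b) * exp (\<bar>\<delta>\<bar> * b) * h\<^sup>2 * (Q\<^sup>2 / (1 + \<tau>\<^sup>2)) * (norm y * (M * norm u))"
          using M(1) by (intro mult_right_mono mult_left_mono e3) auto
        also have "\<dots> = (C * norm u * h\<^sup>2 * norm y) / (1 + \<tau>\<^sup>2)" by (simp add: C_def mult_ac)
        finally show ?thesis .
      qed
      have "cmod (line_integral \<delta> ?G) \<le> (\<integral>\<tau>. (C * norm u * h\<^sup>2 * norm y) / (1 + \<tau>\<^sup>2) \<partial>lborel)"
        unfolding line_integral_def
      proof (rule norm_integral_le)
        show "integrable lborel (\<lambda>\<tau>. ?G (Complex \<delta> \<tau>))" using int[of s 4] int[of t 4] int[of t 3] st by simp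
        show "integrable lborel (\<lambda>\<tau>. (C * norm u * h\<^sup>2 * norm y) / (1 + \<tau>\<^sup>2))" by (rule integrable_inverse_one_plus_square)
      qed (rule point)
      also have "\<dots> = (C * norm u * h\<^sup>2 * norm y) * pi"
        unfolding divide_inverse integral_mult_right_zero integral_inverse_one_plus_square ..
      finally have "cmod (line_integral \<delta> ?G) \<le> (C * norm u * h\<^sup>2 * norm y) * pi" .
      then have "cmod (blinfun_apply y ?D) \<le> (1 / (2 * pi)) * ((C * norm u * h\<^sup>2 * norm y) * pi)"
        unfolding yD norm_mult by (intro mult_mono) (auto simp: norm_divide norm_mult)
      also have "\<dots> = (C * norm u * h\<^sup>2 * norm y) / 2" by simp
      also have "\<dots> \<le> C * norm u * h\<^sup>2 * norm y" using C by simp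
      finally show "cmod (blinfun_apply y ?D) \<le> C * norm u * (s - t)\<^sup>2 * norm y" by (simp add: h_def)
    qed (use C in simp)
  qed
qed

lemma T_expansion_at_zero:
  obtains C where "C \<ge> 0" "\<And>h u. \<lbrakk>0 \<le> h; h \<le> 1\<rbrakk> \<Longrightarrow>
      norm (T h (Ppow 4 u) - Ppow 4 u - h *\<^sub>R B u) \<le> C * norm u * h\<^sup>2"
proof -
  obtain C where C: "C \<ge> 0" "\<And>s t u. \<lbrakk>0 \<le> s; s \<le> 1; 0 \<le> t; t \<le> 1\<rbrakk> \<Longrightarrow>
      norm (T s (Ppow 4 u) - T t (Ppow 4 u) - (s - t) *\<^sub>R T t (B u)) \<le> C * norm u * (s - t)\<^sup>2"
    using T_expansion[of 1] by auto
  show thesis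
    using C(1) C(2)[of _ 0] by (intro that[of C]) (simp_all add: T_zero)
qed

lemma P_power_dense: "closure (range (\<lambda>x. Ppow n x)) = UNIV"
  unfolding P_def by (rule R_power_dense[OF \<mu>(1)])

text \<open>\<open>T (b - r) (T r v)\<close> does not depend on \<open>r\<close>, for regularized \<open>v\<close>: the first-order terms of its
  two factors cancel.\<close>

lemma T_semigroup:
  assumes s: "0 \<le> s" and t: "0 \<le> t"
  shows "T (s + t) x = T s (T t x)"
proof -
  let ?P4 = "\<lambda>x. Ppow 4 x"
  define b where "b = s + t"
  have b: "b \<ge> 0" "t \<le> b" using s t by (auto simp: b_def)
  obtain C where C: "C \<ge> 0" "\<And>s t u. \<lbrakk>0 \<le> s; s \<le> b; 0 \<le> t; t \<le> b\<rbrakk> \<Longrightarrow>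
      norm (T s (?P4 u) - T t (?P4 u) - (s - t) *\<^sub>R T t (B u)) \<le> C * norm u * (s - t)\<^sup>2"
    using T_expansion[OF b(1)] by blast
  obtain L where L: "L \<ge> 0" "\<And>t. 0 \<le> t \<Longrightarrow> t \<le> b \<Longrightarrow> norm (T t) \<le> L" using T_bounded_on[OF b(1)] by blast
  define G where "G r = T (b - r) (T r (?P4 (?P4 x)))" for r
  have "G 0 = G t"
  proof (rule quadratic_modulus_constant[of "{0..b}"])
    fix r assume "r \<in> {0..b}"
    then have r: "0 \<le> r" "r \<le> b" by auto
    show "\<exists>C r'. r' > 0 \<and> (\<forall>q\<in>{0..b}. \<bar>q - r\<bar> < r' \<longrightarrow> norm (G q - G r) \<le> C * (q - r)\<^sup>2)"
    proof (rule exI[of _ "L * (C * norm (?P4 x)) + C * (L * norm (?P4 x))"], rule exI[of _ 1], intro conjI ballI impI)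
      fix q assume "q \<in> {0..b}"
      then have q: "0 \<le> q" "q \<le> b" by auto
      define u where "u = ?P4 x"
      define v where "v = T r u"
      \<comment> \<open>The Taylor remainders of the right and of the left factor, the latter expanded at \<open>b - q\<close>.\<close>
      define D1 where "D1 = T q (?P4 u) - T r (?P4 u) - (q - r) *\<^sub>R T r (B u)"
      define D2 where "D2 = T (b - r) (?P4 v) - T (b - q) (?P4 v) - ((b - r) - (b - q)) *\<^sub>R T (b - q) (B v)"
      have D1: "norm D1 \<le> C * norm u * (q - r)\<^sup>2" unfolding D1_def by (rule C(2)[OF q r])
      have D2: "norm D2 \<le> C * norm v * (q - r)\<^sup>2"
        using C(2)[of "b - r" "b - q" v] q r unfolding D2_def by simp
      have v: "norm v \<le> L * norm u"
        unfolding v_def using L(2)[OF r] by (intro order.trans[OF norm_blinfun] mult_right_mono) auto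
      have "G q - G r = T (b - q) D1 - D2"
        using r q unfolding G_def D1_def D2_def v_def u_def[symmetric]
        by (simp add: blinfun.diff_right blinfun.scaleR_right T_P_power_commute T_B_commute del: funpow.simps)
      then have "norm (G q - G r) \<le> norm (T (b - q) D1) + norm D2" by (simp add: norm_triangle_ineq4)
      also have "\<dots> \<le> L * (C * norm u * (q - r)\<^sup>2) + C * (L * norm u) * (q - r)\<^sup>2"
      proof (rule add_mono)
        have "norm (T (b - q) D1) \<le> norm (T (b - q)) * norm D1" by (rule norm_blinfun)
        also have "\<dots> \<le> L * (C * norm u * (q - r)\<^sup>2)" using L q D1 by (intro mult_mono) auto
        finally show "norm (T (b - q) D1) \<le> L * (C * norm u * (q - r)\<^sup>2)" .
        show "norm D2 \<le> C * (L * norm u) * (q - r)\<^sup>2"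
          by (rule order.trans[OF D2]) (intro mult_right_mono mult_left_mono v C(1) zero_le_power2)
      qed
      also have "\<dots> = (L * (C * norm (?P4 x)) + C * (L * norm (?P4 x))) * (q - r)\<^sup>2"
        unfolding u_def by (simp only: distrib_right mult.assoc)
      finally show "norm (G q - G r) \<le> (L * (C * norm (?P4 x)) + C * (L * norm (?P4 x))) * (q - r)\<^sup>2" .
    qed simp
  qed (use b t in auto)
  then have "T (s + t) (?P4 (?P4 x)) = T s (T t (?P4 (?P4 x)))" by (simp add: G_def b_def T_zero)
  then have "?P4 (?P4 (T (s + t) x)) = ?P4 (?P4 (T s (T t x)))"
    using s t by (simp only: T_P_power_commute add_nonneg_nonneg)
  then show ?thesis using R_power_inj[OF \<mu>(1)] unfolding P_def by blast
qed

lemma T_tendsto_at_zero: "((\<lambda>h. T h x) \<longlongrightarrow> x) (at_right 0)"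
proof -
  obtain L where L: "L \<ge> 0" "\<And>t. 0 \<le> t \<Longrightarrow> t \<le> 1 \<Longrightarrow> norm (T t) \<le> L" using T_bounded_on[of 1] by auto
  obtain C where C: "C \<ge> 0" "\<And>h u. \<lbrakk>0 \<le> h; h \<le> 1\<rbrakk> \<Longrightarrow>
      norm (T h (Ppow 4 u) - Ppow 4 u - h *\<^sub>R B u) \<le> C * norm u * h\<^sup>2"
    using T_expansion_at_zero by blast
  have "((\<lambda>h. T h x - x) \<longlongrightarrow> 0) (at_right 0)"
  proof (rule tendsto_zero_by_density[where Q = "\<lambda>h x. T h x - x" and D = "range (\<lambda>x. Ppow 4 x)" and K = "L + 1"])
    fix h :: real and x x' :: 'a assume h: "0 < h" "h \<le> 1"
    have "norm ((T h x - x) - (T h x' - x')) = norm (T h (x - x') - (x - x'))"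
      by (simp add: blinfun.diff_right algebra_simps)
    also have "\<dots> \<le> L * norm (x - x') + norm (x - x')"
      using L(2)[of h] h by (intro order.trans[OF norm_triangle_ineq4] add_right_mono order.trans[OF norm_blinfun] mult_right_mono) auto
    finally show "norm ((T h x - x) - (T h x' - x')) \<le> (L + 1) * norm (x - x')" by (simp add: algebra_simps)
  next
    fix x assume "x \<in> range (\<lambda>x. Ppow 4 x)"
    then obtain u where u: "x = Ppow 4 u" by auto
    show "((\<lambda>h. T h x - x) \<longlongrightarrow> 0) (at_right 0)"
    proof (rule Lim_null_comparison)
      have "\<forall>\<^sub>F h in at_right 0. 0 < h \<and> h \<le> (1::real)"
        by (auto simp: eventually_at_right_field intro!: exI[of _ 1])
      then show "\<forall>\<^sub>F h in at_right 0. norm (T h x - x) \<le> C * norm u * h\<^sup>2 + h * norm (B u)"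
      proof eventually_elim
        case (elim h)
        have "norm (T h x - x - h *\<^sub>R B u) \<le> C * norm u * h\<^sup>2"
          using C(2)[of h u] elim by (simp add: u)
        then show ?case
          using norm_triangle_sub[of "T h x - x" "h *\<^sub>R B u"] elim by simp
      qed
      have "((\<lambda>h. C * norm u * h\<^sup>2 + h * norm (B u)) \<longlongrightarrow> C * norm u * 0\<^sup>2 + 0 * norm (B u)) (at_right 0)"
        by (intro tendsto_intros)
      then show "((\<lambda>h. C * norm u * h\<^sup>2 + h * norm (B u)) \<longlongrightarrow> 0) (at_right 0)" by simp
    qed
  qed (rule P_power_dense)
  then show ?thesis by (simp add: LIM_zero_iff)
qed

lemma C0_semigroup_T: "C0_semigroup T"
  unfolding C0_semigroup_def
  using T_clinear T_zero T_tendsto_at_zero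
  by (auto intro!: blinfun_eqI simp: T_semigroup)

text \<open>A Lipschitz bound at \<open>0\<close> on the range of \<open>P\<close>, where \<open>norm x\<close> measures the graph norm of \<open>P x\<close>.  It holds by
  the mean value inequality on a dense set and extends by continuity; it is what lets the derivative at \<open>0\<close> be computed
  on a dense set.\<close>

lemma T_difference_bound:
  obtains L where "\<And>h x. 0 < h \<Longrightarrow> h \<le> 1 \<Longrightarrow> norm (T h (P x) - P x) \<le> h * (L * norm x)"
proof -
  obtain L where L: "L \<ge> 0" "\<And>t. 0 \<le> t \<Longrightarrow> t \<le> 1 \<Longrightarrow> norm (T t) \<le> L" using T_bounded_on[of 1] by auto
  obtain C where C: "C \<ge> 0" "\<And>s t u. \<lbrakk>0 \<le> s; s \<le> 1; 0 \<le> t; t \<le> 1\<rbrakk> \<Longrightarrow>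
      norm (T s (Ppow 4 u) - T t (Ppow 4 u) - (s - t) *\<^sub>R T t (B u)) \<le> C * norm u * (s - t)\<^sup>2"
    using T_expansion[of 1] by auto
  define L' where "L' = L * (1 + cmod \<mu> * norm P)"
  show thesis
  proof (rule that[of L'])
    fix h x assume h: "0 < h" "h \<le> (1::real)"
    have "closed {x. norm (T h (P x) - P x) \<le> h * (L' * norm x)}"
      by (intro closed_Collect_le continuous_intros blinfun.continuous_on)
    moreover have "range (\<lambda>u. Ppow 3 u) \<subseteq> {x. norm (T h (P x) - P x) \<le> h * (L' * norm x)}"
    proof safe
      fix u
      let ?x = "Ppow 3 u"
      have P4: "Ppow 4 u = P ?x" by (simp add: eval_nat_numeral)
      have Bu: "B u = ?x - \<mu> *\<^sub>C P ?x" by (simp only: B_def P4)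
      have "norm (T h (P ?x) - T 0 (P ?x)) \<le> (L' * norm ?x) * norm (h - 0)"
      proof (rule differentiable_bound[where S = "{0..1}" and f = "\<lambda>t. T t (P ?x)" and f' = "\<lambda>t r. r *\<^sub>R T t (B u)"])
        fix t :: real assume "t \<in> {0..1}"
        then have t: "0 \<le> t" "t \<le> 1" by auto
        have "((\<lambda>t. T t (P ?x)) has_vector_derivative T t (B u)) (at t within {0..1})"
        proof (rule quadratic_expansion_derivative[of 1])
          fix s assume "s \<in> {0..1::real}"
          then show "norm (T s (P ?x) - T t (P ?x) - (s - t) *\<^sub>R T t (B u)) \<le> C * norm u * (s - t)\<^sup>2"
            using C(2)[of s t u] t by (simp only: P4 atLeastAtMost_iff)
        qed simp
        then show "((\<lambda>t. T t (P ?x)) has_derivative (\<lambda>r. r *\<^sub>R T t (B u))) (at t within {0..1})"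
          by (simp only: has_vector_derivative_def)
        have "norm (B u) \<le> norm ?x + cmod \<mu> * (norm P * norm ?x)"
          unfolding Bu by (intro order.trans[OF norm_triangle_ineq4]) (simp add: norm_scaleC mult_left_mono norm_blinfun)
        then have "norm (T t (B u)) \<le> L * (norm ?x + cmod \<mu> * (norm P * norm ?x))"
          using L t by (intro order.trans[OF norm_blinfun] mult_mono) auto
        also have "\<dots> = L' * norm ?x" by (simp add: L'_def algebra_simps)
        finally have "norm (T t (B u)) \<le> L' * norm ?x" .
        then show "onorm (\<lambda>r. r *\<^sub>R T t (B u)) \<le> L' * norm ?x"
          by (intro onorm_le) (simp add: mult.commute mult_left_mono)
      qed (use h in auto)
      then show "norm (T h (P ?x) - P ?x) \<le> h * (L' * norm ?x)" using h by (simp add: T_zero mult.commute)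
    qed
    ultimately have "closure (range (\<lambda>u. Ppow 3 u)) \<subseteq> {x. norm (T h (P x) - P x) \<le> h * (L' * norm x)}"
      by (rule closure_minimal[rotated])
    then show "norm (T h (P x) - P x) \<le> h * (L' * norm x)" unfolding P_power_dense by blast
  qed
qed

lemma T_derivative_at_zero:
  "((\<lambda>h. (1 / h) *\<^sub>R (T h (P x) - P x)) \<longlongrightarrow> x - \<mu> *\<^sub>C P x) (at_right 0)"
proof -
  obtain L where L: "\<And>h x. 0 < h \<Longrightarrow> h \<le> 1 \<Longrightarrow> norm (T h (P x) - P x) \<le> h * (L * norm x)"
    using T_difference_bound by blast
  obtain C where C: "C \<ge> 0" "\<And>h u. \<lbrakk>0 \<le> h; h \<le> 1\<rbrakk> \<Longrightarrow>
      norm (T h (Ppow 4 u) - Ppow 4 u - h *\<^sub>R B u) \<le> C * norm u * h\<^sup>2"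
    using T_expansion_at_zero by blast
  let ?Q = "\<lambda>h x. (1 / h) *\<^sub>R (T h (P x) - P x) - (x - \<mu> *\<^sub>C P x)"
  have "((\<lambda>h. ?Q h x) \<longlongrightarrow> 0) (at_right 0)"
  proof (rule tendsto_zero_by_density[where Q = ?Q and D = "range (\<lambda>x. Ppow 3 x)" and K = "L + (1 + cmod \<mu> * norm P)"])
    fix h :: real and x x' :: 'a assume h: "0 < h" "h \<le> 1"
    let ?w = "x - x'"
    have "?Q h x - ?Q h x' = (1 / h) *\<^sub>R (T h (P ?w) - P ?w) - (?w - \<mu> *\<^sub>C P ?w)"
      by (simp add: blinfun.diff_right scaleC_diff_right scaleR_diff_right)
    also have "norm \<dots> \<le> (1 / h) * (h * (L * norm ?w)) + (norm ?w + cmod \<mu> * (norm P * norm ?w))"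
    proof (rule order.trans[OF norm_triangle_ineq4], rule add_mono)
      show "norm ((1 / h) *\<^sub>R (T h (P ?w) - P ?w)) \<le> (1 / h) * (h * (L * norm ?w))"
        unfolding norm_scaleR using L[OF h, of ?w] h by (intro mult_mono) auto
      have "norm (\<mu> *\<^sub>C P ?w) \<le> cmod \<mu> * (norm P * norm ?w)"
        by (simp add: norm_scaleC mult_left_mono norm_blinfun)
      then show "norm (?w - \<mu> *\<^sub>C P ?w) \<le> norm ?w + cmod \<mu> * (norm P * norm ?w)"
        using norm_triangle_ineq4[of ?w "\<mu> *\<^sub>C P ?w"] by linarith
    qed
    also have "\<dots> = (L + (1 + cmod \<mu> * norm P)) * norm ?w" using h by (simp add: algebra_simps)
    finally show "norm (?Q h x - ?Q h x') \<le> (L + (1 + cmod \<mu> * norm P)) * norm (x - x')" .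
  next
    fix x assume "x \<in> range (\<lambda>x. Ppow 3 x)"
    then obtain u where u: "x = Ppow 3 u" by auto
    have P4: "Ppow 4 u = P x" by (simp add: u eval_nat_numeral)
    have Bu: "B u = x - \<mu> *\<^sub>C P x" by (simp only: B_def P4 u)
    show "((\<lambda>h. ?Q h x) \<longlongrightarrow> 0) (at_right 0)"
    proof (rule Lim_null_comparison)
      have "\<forall>\<^sub>F h in at_right 0. 0 < h \<and> h \<le> (1::real)"
        by (auto simp: eventually_at_right_field intro!: exI[of _ 1])
      then show "\<forall>\<^sub>F h in at_right 0. norm (?Q h x) \<le> C * norm u * h"
      proof eventually_elim
        case (elim h)
        have le: "norm (T h (P x) - P x - h *\<^sub>R B u) \<le> C * norm u * h\<^sup>2"
          using C(2)[of h u] elim by (simp add: P4)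
        have "?Q h x = (1 / h) *\<^sub>R (T h (P x) - P x - h *\<^sub>R B u)"
          using elim by (simp add: Bu scaleR_diff_right)
        then have "norm (?Q h x) = (1 / h) * norm (T h (P x) - P x - h *\<^sub>R B u)"
          using elim by (simp only: norm_scaleR) simp
        also have "\<dots> \<le> (1 / h) * (C * norm u * h\<^sup>2)" using elim le by (intro mult_left_mono) auto
        also have "\<dots> = C * norm u * h" using elim by (simp add: power2_eq_square)
        finally show ?case .
      qed
      have "((\<lambda>h. C * norm u * h) \<longlongrightarrow> C * norm u * 0) (at_right 0)" by (intro tendsto_intros)
      then show "((\<lambda>h. C * norm u * h) \<longlongrightarrow> 0) (at_right 0)" by simp
    qed
  qed (rule P_power_dense)
  then show ?thesis by (simp only: LIM_zero_iff)
qed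

text \<open>One inclusion is the derivative at \<open>0\<close> on the range of \<open>P\<close>, which is the domain of \<open>A\<close>.  Conversely,
  \<open>P\<close> commutes with the semigroup, so applying it to a difference quotient at a point of the
  domain of the generator forces \<open>P g = x - \<mu> P x\<close>, and this puts \<open>x\<close> into the range of \<open>P\<close>.\<close>

lemma generator_T: "generator T = neg_op A"
proof (intro set_eqI iffI)
  fix p assume "p \<in> neg_op A"
  then obtain x v where p: "p = (x, - v)" and xv: "(x, v) \<in> A" by (auto simp: neg_op_def)
  define u where "u = \<mu> *\<^sub>C x - v"
  have Pu: "P u = x" unfolding P_def u_def by (rule R_of_graph[OF \<mu>(1) xv])
  have "u - \<mu> *\<^sub>C x = - v" by (simp add: u_def)
  then show "p \<in> generator T"
    using T_derivative_at_zero[of u] by (simp add: generator_def p Pu)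
next
  fix p assume "p \<in> generator T"
  then obtain x g where p: "p = (x, g)" and lim: "((\<lambda>h. (1 / h) *\<^sub>R (T h x - x)) \<longlongrightarrow> g) (at_right 0)"
    by (auto simp: generator_def)
  have "((\<lambda>h. P ((1 / h) *\<^sub>R (T h x - x))) \<longlongrightarrow> P g) (at_right 0)"
    by (intro tendsto_intros blinfun.tendsto lim)
  moreover have "\<forall>\<^sub>F h in at_right 0. P ((1 / h) *\<^sub>R (T h x - x)) = (1 / h) *\<^sub>R (T h (P x) - P x)"
  proof -
    have "\<forall>\<^sub>F h in at_right 0. 0 < (h::real)" by (rule eventually_at_right_less)
    then show ?thesis by eventually_elim (simp add: T_P_commute blinfun.scaleR_right blinfun.diff_right)
  qed
  ultimately have "((\<lambda>h. (1 / h) *\<^sub>R (T h (P x) - P x)) \<longlongrightarrow> P g) (at_right 0)"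
    by (rule Lim_transform_eventually)
  from tendsto_unique[OF _ this T_derivative_at_zero[of x]]
  have "P g = x - \<mu> *\<^sub>C P x" by simp
  then have x: "P (g + \<mu> *\<^sub>C x) = x" using R_scaleC[OF \<mu>(1)] by (simp add: blinfun.add_right P_def)
  have "(P (g + \<mu> *\<^sub>C x), \<mu> *\<^sub>C P (g + \<mu> *\<^sub>C x) - (g + \<mu> *\<^sub>C x)) \<in> A"
    unfolding P_def by (rule R_in_graph[OF \<mu>(1)])
  then have "(x, - g) \<in> A" unfolding x by simp
  then show "p \<in> neg_op A" by (force simp: neg_op_def p)
qed

end

context half_plane_operator begin

section \<open>Exponentials in the functional calculus\<close>

text \<open>Normalized to have norm at most \<open>1\<close> on \<open>Re z > \<omega> - 1 / t\<close>.\<close>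

definition scaled_exp :: "real \<Rightarrow> complex \<Rightarrow> complex"
  where "scaled_exp t z = of_real (exp (\<omega> * t - 1)) * exp (- (of_real t * z))"

lemma scaled_exp_Hinf:
  assumes t: "t > 0"
  shows "scaled_exp t \<in> Hinf (\<omega> - 1 / t)" "Hinf_norm (\<omega> - 1 / t) (scaled_exp t) \<le> 1"
proof -
  have hol: "scaled_exp t holomorphic_on half_plane (\<omega> - 1 / t)"
    unfolding scaled_exp_def by (intro holomorphic_intros)
  have le: "cmod (scaled_exp t z) \<le> 1" if "z \<in> half_plane (\<omega> - 1 / t)" for z
  proof -
    have "t * (\<omega> - 1 / t) \<le> t * Re z" using t that by (intro mult_left_mono) (auto simp: half_plane_def)
    then have "\<omega> * t - 1 - t * Re z \<le> 0" using t by (simp add: algebra_simps)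
    moreover have "cmod (scaled_exp t z) = exp (\<omega> * t - 1) * exp (- (t * Re z))"
      unfolding scaled_exp_def norm_mult norm_of_real by simp
    then have "cmod (scaled_exp t z) = exp (\<omega> * t - 1 - t * Re z)"
      by (simp add: exp_add[symmetric])
    ultimately show ?thesis by simp
  qed
  show "scaled_exp t \<in> Hinf (\<omega> - 1 / t)" "Hinf_norm (\<omega> - 1 / t) (scaled_exp t) \<le> 1"
    using HinfI[OF hol le] by auto
qed

lemma deriv_scaled_exp: "deriv (scaled_exp t) z = - of_real t * scaled_exp t z"
  unfolding scaled_exp_def by (rule DERIV_imp_deriv) (auto intro!: derivative_eq_intros)

text \<open>The derivative of \<open>exp (- t z)\<close> is \<open>- t\<close> times the function, so that its calculus for \<open>m = 1\<close> provides a
  bounded operator for \<open>exp (- t z)\<close> itself.  The regularizer and the line in the definition of the calculus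
  depend on \<open>t\<close>; they are replaced by fixed ones: first the line is moved, to the right of both
  poles, then the second regularizer is introduced and the first one cancelled by injectivity.\<close>

lemma scaled_exp_operator_weak:
  assumes t: "t > 0" and S: "deriv_calc \<omega> A (\<omega> - 1 / t) 1 (scaled_exp t) = graph_of S" "S \<in> bounded_clinear"
    and y: "y \<in> dual"
  defines "\<mu> \<equiv> complex_of_real (\<omega> - 2)"
  shows "blinfun_apply y (R \<mu> (R \<mu> (((- (exp (1 - \<omega> * t) / t)) *\<^sub>R S) x)))
    = - (1 / (2 * of_real pi)) * line_integral (\<omega> - 1 / 2)
        (\<lambda>z. exp (- (of_real t * z)) * (1 / (\<mu> - z)\<^sup>2) * blinfun_apply y (R z x))"
proof -
  define \<alpha> where "\<alpha> = \<omega> - 1 / t"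
  define \<beta> where "\<beta> = (\<alpha> + \<omega>) / 2"
  define \<delta> where "\<delta> = (\<beta> + \<omega>) / 2"
  define \<nu> where "\<nu> = complex_of_real (\<beta> - 1)"
  define T where "T = (- (exp (1 - \<omega> * t) / t)) *\<^sub>R S"
  define E where "E z = exp (- (of_real t * z))" for z :: complex
  have \<alpha>: "\<alpha> < \<omega>" using t by (simp add: \<alpha>_def)
  have ord: "\<beta> < \<delta>" "\<delta> < \<omega>" "\<beta> < \<omega>" using \<alpha> by (auto simp: \<beta>_def \<delta>_def)
  have R\<mu>: "Re \<mu> < \<omega>" and R\<nu>: "Re \<nu> < \<omega>" using ord by (auto simp: \<mu>_def \<nu>_def)
  have f: "scaled_exp t \<in> Hinf \<alpha>" unfolding \<alpha>_def by (rule scaled_exp_Hinf[OF t])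
  have T_at: "blinfun_apply y (R \<nu> (R \<nu> (T x))) = - (1 / (2 * of_real pi)) *
      line_integral \<delta> (\<lambda>z. E z * (1 / (\<nu> - z)\<^sup>2) * blinfun_apply y (R z x))"
    if y: "y \<in> dual" for y :: "'a \<Rightarrow>\<^sub>L complex"
  proof -
    define c where "c = - (exp (1 - \<omega> * t) / t)"
    have c: "of_real c * (- of_real t * scaled_exp t z) = E z" for z
    proof -
      have "c * (- t * exp (\<omega> * t - 1)) = exp (1 - \<omega> * t) * exp (\<omega> * t - 1)" using t by (simp add: c_def)
      also have "\<dots> = 1" by (simp add: exp_add[symmetric])
      finally have "of_real (c * (- t * exp (\<omega> * t - 1))) * E z = E z" by simp
      then show ?thesis by (simp add: scaled_exp_def E_def mult_ac)
    qed
    have "blinfun_apply y (R \<nu> (R \<nu> (T x))) = of_real c * blinfun_apply y (R \<nu> (R \<nu> (S x)))"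
      by (simp add: T_def c_def[symmetric] blinfun.scaleR_left blinfun.scaleR_right scaleR_conv_of_real)
    also have "blinfun_apply y (R \<nu> (R \<nu> (S x))) = - (1 / (2 * of_real pi)) *
        line_integral \<delta> (\<lambda>z. 1 / (\<nu> - z)\<^sup>2 * (deriv ^^ 1) (scaled_exp t) z * blinfun_apply y (R z x))"
      using S(1) y unfolding \<alpha>_def[symmetric] deriv_calc_eq_graph_iff[OF \<alpha> f] \<beta>_def[symmetric] \<nu>_def[symmetric] \<delta>_def[symmetric]
      by blast
    also have "of_real c * (- (1 / (2 * of_real pi)) *
        line_integral \<delta> (\<lambda>z. 1 / (\<nu> - z)\<^sup>2 * (deriv ^^ 1) (scaled_exp t) z * blinfun_apply y (R z x)))
        = - (1 / (2 * of_real pi)) * (of_real c *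
          line_integral \<delta> (\<lambda>z. 1 / (\<nu> - z)\<^sup>2 * (deriv ^^ 1) (scaled_exp t) z * blinfun_apply y (R z x)))"
      by (simp only: mult_ac)
    also have "of_real c * line_integral \<delta> (\<lambda>z. 1 / (\<nu> - z)\<^sup>2 * (deriv ^^ 1) (scaled_exp t) z * blinfun_apply y (R z x))
        = line_integral \<delta> (\<lambda>z. of_real c * (1 / (\<nu> - z)\<^sup>2 * (deriv ^^ 1) (scaled_exp t) z * blinfun_apply y (R z x)))"
      unfolding line_integral_def by (rule integral_mult_right_zero[symmetric])
    also have "(\<lambda>z. of_real c * (1 / (\<nu> - z)\<^sup>2 * (deriv ^^ 1) (scaled_exp t) z * blinfun_apply y (R z x)))
        = (\<lambda>z. E z * (1 / (\<nu> - z)\<^sup>2) * blinfun_apply y (R z x))"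
    proof
      fix z
      have "of_real c * (1 / (\<nu> - z)\<^sup>2 * (deriv ^^ 1) (scaled_exp t) z * blinfun_apply y (R z x))
          = (of_real c * (- of_real t * scaled_exp t z)) * (1 / (\<nu> - z)\<^sup>2) * blinfun_apply y (R z x)"
        by (simp add: deriv_scaled_exp)
      then show "of_real c * (1 / (\<nu> - z)\<^sup>2 * (deriv ^^ 1) (scaled_exp t) z * blinfun_apply y (R z x))
          = E z * (1 / (\<nu> - z)\<^sup>2) * blinfun_apply y (R z x)" unfolding c .
    qed
    finally show ?thesis .
  qed
  have dec\<nu>: "half_plane_decay a (\<lambda>z. E z * (1 / (\<nu> - z)\<^sup>2))" if "\<beta> - 1 < a" for a
    unfolding E_def using t that by (intro half_plane_decay_exp half_plane_decay_inverse_square) (auto simp: \<nu>_def)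
  have dec\<mu>: "half_plane_decay (\<omega> - 1) (\<lambda>z. E z * (1 / (\<mu> - z)\<^sup>2))"
    unfolding E_def using t by (intro half_plane_decay_exp half_plane_decay_inverse_square) (auto simp: \<mu>_def)
  have \<delta>': "\<omega> - 1 < \<omega> - 1 / 2" "\<omega> - 1 / 2 < \<omega>" by auto
  have shift: "line_integral \<delta> (\<lambda>z. E z * (1 / (\<nu> - z)\<^sup>2) * blinfun_apply y (R z x))
      = line_integral (\<omega> - 1 / 2) (\<lambda>z. E z * (1 / (\<nu> - z)\<^sup>2) * blinfun_apply y (R z x))"
    if y: "y \<in> dual" for y :: "'a \<Rightarrow>\<^sub>L complex"
  proof -
    \<comment> \<open>The abscissa \<open>\<beta> - 3/4\<close> lies between the pole \<open>\<nu> = \<beta> - 1\<close> and both lines.\<close>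
    have "strip_decay (\<beta> - 3 / 4) \<omega> (\<lambda>z. blinfun_apply y (R z x) * (E z * (1 / (\<nu> - z)\<^sup>2)))"
      by (intro strip_decay_mult R_strip_bounded[OF y] half_plane_decay_strip dec\<nu>) simp
    from line_integral_shift[OF this, of \<delta> "\<omega> - 1 / 2"] ord show ?thesis by (simp add: mult.commute)
  qed
  define U where "U = elem_calc \<omega> A (\<omega> - 1) (\<lambda>z. E z * (1 / (\<mu> - z)\<^sup>2))"
  have U: "blinfun_apply y (U x) = - (1 / (2 * of_real pi)) * line_integral (\<omega> - 1 / 2)
      (\<lambda>z. E z * (1 / (\<mu> - z)\<^sup>2) * blinfun_apply y (R z x))"
    if "y \<in> dual" for y :: "'a \<Rightarrow>\<^sub>L complex"
  proof -
    have mid: "(\<omega> - 1 + \<omega>) / 2 = \<omega> - 1 / 2" and lt: "\<omega> - 1 < \<omega>" by (simp_all add: field_simps)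
    show ?thesis
      unfolding U_def elem_calc_weak[OF half_plane_decay_strip[OF dec\<mu>] order.refl lt that] mid ..
  qed
  have "R \<nu> (R \<nu> (R \<mu> (R \<mu> (T x)))) = R \<nu> (R \<nu> (U x))"
  proof (rule functionals_separate)
    fix y :: "'a \<Rightarrow>\<^sub>L complex" assume y: "y \<in> dual"
    let ?y\<mu> = "y o\<^sub>L (R \<mu> o\<^sub>L R \<mu>)" and ?y\<nu> = "y o\<^sub>L (R \<nu> o\<^sub>L R \<nu>)"
    have y\<mu>: "?y\<mu> \<in> dual" and y\<nu>: "?y\<nu> \<in> dual"
      by (intro bounded_clinear_compose y R_clinear R\<mu> R\<nu>)+
    have "blinfun_apply y (R \<nu> (R \<nu> (R \<mu> (R \<mu> (T x))))) = blinfun_apply ?y\<mu> (R \<nu> (R \<nu> (T x)))"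
      by (simp add: R_commute[OF R\<mu> R\<nu>])
    also have "\<dots> = - (1 / (2 * of_real pi)) * line_integral (\<omega> - 1 / 2)
        (\<lambda>z. E z * (1 / (\<nu> - z)\<^sup>2) * blinfun_apply ?y\<mu> (R z x))"
      by (simp only: T_at[OF y\<mu>] shift[OF y\<mu>])
    also have "line_integral (\<omega> - 1 / 2) (\<lambda>z. E z * (1 / (\<nu> - z)\<^sup>2) * blinfun_apply ?y\<mu> (R z x))
        = line_integral (\<omega> - 1 / 2) (\<lambda>z. E z * (1 / (\<nu> - z)\<^sup>2) / (\<mu> - z)\<^sup>2 * blinfun_apply y (R z x))"
      using line_integral_mult_R_power[OF dec\<nu>[of "\<omega> - 1"] _ \<delta>' y, of \<mu> 2 x] ord
      by (simp add: \<mu>_def numeral_2_eq_2)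
    also have "(\<lambda>z. E z * (1 / (\<nu> - z)\<^sup>2) / (\<mu> - z)\<^sup>2 * blinfun_apply y (R z x))
        = (\<lambda>z. E z * (1 / (\<mu> - z)\<^sup>2) / (\<nu> - z)\<^sup>2 * blinfun_apply y (R z x))"
      by (simp add: mult.commute)
    also have "line_integral (\<omega> - 1 / 2) \<dots> = line_integral (\<omega> - 1 / 2) (\<lambda>z. E z * (1 / (\<mu> - z)\<^sup>2) * blinfun_apply ?y\<nu> (R z x))"
      using line_integral_mult_R_power[OF dec\<mu> _ \<delta>' y, of \<nu> 2 x] ord
      by (simp add: \<nu>_def numeral_2_eq_2)
    also have "- (1 / (2 * of_real pi)) * \<dots> = blinfun_apply y (R \<nu> (R \<nu> (U x)))"
      using U[OF y\<nu>] by simp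
    finally show "blinfun_apply y (R \<nu> (R \<nu> (R \<mu> (R \<mu> (T x))))) = blinfun_apply y (R \<nu> (R \<nu> (U x)))" .
  qed
  then have "R \<mu> (R \<mu> (T x)) = U x" by (rule R_inj[OF R\<nu> R_inj[OF R\<nu>]])
  then show ?thesis using U[OF y] by (simp add: T_def E_def)
qed

text \<open>The choice \<open>\<alpha> = \<omega> - 1 / t\<close> makes \<open>exp (\<omega> t) T\<^sub>t\<close> equal to \<open>- e\<close> times a member of the
  \<open>W\<gamma>\<close>-bounded family, for every \<open>t > 0\<close>.  The parameter \<open>t = 0\<close> is reached by strong continuity: the defining
  inequality involves finitely many operators and is closed under strong limits.\<close>

lemma strong_calculus_semigroup:
  assumes "strong_Wgamma_bounded_calculus M \<gamma> 1 \<omega> A"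
  shows "\<exists>T. C0_semigroup T \<and> generator T = neg_op A \<and> of_Wgamma_type M \<gamma> \<omega> T"
proof -
  let ?T = "derivative_family 1 \<omega> A"
  obtain C where C: "C > 0" "\<And>\<alpha> f. \<alpha> < \<omega> \<Longrightarrow> f \<in> Hinf \<alpha> \<Longrightarrow> \<exists>S\<in>bounded_clinear. deriv_calc \<omega> A \<alpha> 1 f = graph_of S \<and>
      norm S \<le> C / (\<omega> - \<alpha>) ^ 1 * Hinf_norm \<alpha> f"
    using assms unfolding strong_Wgamma_bounded_calculus_iff strong_bounded_calculus_def by blast
  have W: "Wgamma_bounded M \<gamma> ?T" using assms by (simp add: strong_Wgamma_bounded_calculus_iff)
  obtain C0 where "C0 \<ge> 0" and C0: "\<And>N T x y. (\<forall>n<N. T n \<in> ?T) \<and> (\<forall>n<N. y n \<in> dual) \<Longrightarrow>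
      (\<Sum>n<N. cmod (blinfun_apply (y n) (blinfun_apply (T n) (x n)))) \<le> C0 * gauss_norm M \<gamma> N x * gauss_norm M \<gamma> N y"
    by (rule Wgamma_boundedE[OF W]) blast
  have "\<exists>S\<in>bounded_clinear. deriv_calc \<omega> A (\<omega> - 1 / t) 1 (scaled_exp t) = graph_of S \<and> norm S \<le> C * t"
    if t: "t > 0" for t
  proof -
    obtain S where S: "S \<in> bounded_clinear" "deriv_calc \<omega> A (\<omega> - 1 / t) 1 (scaled_exp t) = graph_of S"
        "norm S \<le> C / (\<omega> - (\<omega> - 1 / t)) ^ 1 * Hinf_norm (\<omega> - 1 / t) (scaled_exp t)"
      using C(2)[OF _ scaled_exp_Hinf(1)[OF t]] t by auto
    have "C / (\<omega> - (\<omega> - 1 / t)) ^ 1 * Hinf_norm (\<omega> - 1 / t) (scaled_exp t) \<le> C / (\<omega> - (\<omega> - 1 / t)) ^ 1 * 1"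
      using C(1) t by (intro mult_left_mono scaled_exp_Hinf(2)) auto
    then show ?thesis using S by (intro bexI[of _ S]) auto
  qed
  then obtain S where S: "\<And>t. t > 0 \<Longrightarrow> S t \<in> bounded_clinear"
      "\<And>t. t > 0 \<Longrightarrow> deriv_calc \<omega> A (\<omega> - 1 / t) 1 (scaled_exp t) = graph_of (S t)"
      "\<And>t. t > 0 \<Longrightarrow> norm (S t) \<le> C * t"
    by metis
  define T where "T t = (if t > 0 then (- (exp (1 - \<omega> * t) / t)) *\<^sub>R S t else id_blinfun)" for t
  interpret T: exponential_family A \<omega> T "max 1 (C * exp 1)"
  proof
    fix t :: real assume t: "0 \<le> t"
    show "T t \<in> bounded_clinear"
    proof (cases "t > 0")
      case True
      then have "of_real (- (exp (1 - \<omega> * t) / t)) *\<^sub>C S t \<in> bounded_clinear"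
        by (intro bounded_clinear_scale S)
      then show ?thesis using True by (simp only: T_def if_True scaleC_of_real)
    qed (simp add: T_def bounded_clinear_def)
    show "norm (T t) \<le> max 1 (C * exp 1) * exp (- \<omega> * t)"
    proof (cases "t > 0")
      case True
      have "norm (T t) = exp (1 - \<omega> * t) / t * norm (S t)" using True by (simp add: T_def)
      also have "\<dots> \<le> exp (1 - \<omega> * t) / t * (C * t)" using S(3)[OF True] True by (intro mult_left_mono) auto
      also have "\<dots> = C * exp 1 * exp (- \<omega> * t)" using True by (simp add: exp_diff exp_minus field_simps)
      also have "\<dots> \<le> max 1 (C * exp 1) * exp (- \<omega> * t)" by (intro mult_right_mono) auto
      finally show ?thesis .
    next
      case False
      then have "t = 0" using t by simp
      then show ?thesis by (simp add: T_def le_max_iff_disj norm_blinfun_id_le)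
    qed
  next
    show "T 0 = id_blinfun" by (simp add: T_def)
  next
    fix t :: real and y :: "'a \<Rightarrow>\<^sub>L complex" and x
    assume t: "0 \<le> t" and y: "y \<in> dual"
    show "blinfun_apply y (R (of_real (\<omega> - 2)) (R (of_real (\<omega> - 2)) (T t x)))
      = - (1 / (2 * of_real pi)) * line_integral (\<omega> - 1 / 2)
          (\<lambda>z. exp (- (of_real t * z)) * (1 / (of_real (\<omega> - 2) - z)\<^sup>2) * blinfun_apply y (R z x))"
    proof (cases "t > 0")
      case True
      show ?thesis
        using scaled_exp_operator_weak[OF True S(2)[OF True] S(1)[OF True] y, of x] True
        by (simp only: T_def if_True)
    next
      case False
      then have t0: "t = 0" using t by simp
      show ?thesis
        using line_integral_regularizer[of "\<omega> - 2" "\<omega> - 1 / 2" y x] y by (simp add: t0 T_def)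
    qed
  qed
  have member: "exp (\<omega> * t) *\<^sub>R T t = (- exp 1) *\<^sub>R ((\<omega> - (\<omega> - 1 / t)) ^ 1 *\<^sub>R S t)"
    "(\<omega> - (\<omega> - 1 / t)) ^ 1 *\<^sub>R S t \<in> ?T" if t: "t > 0" for t
  proof -
    have "exp (\<omega> * t) * exp (1 - \<omega> * t) = exp 1" by (simp add: exp_add[symmetric])
    then show "exp (\<omega> * t) *\<^sub>R T t = (- exp 1) *\<^sub>R ((\<omega> - (\<omega> - 1 / t)) ^ 1 *\<^sub>R S t)"
      using t by (simp add: T_def)
    have "\<omega> - 1 / t \<in> {..<\<omega>}" using t by simp
    then show "(\<omega> - (\<omega> - 1 / t)) ^ 1 *\<^sub>R S t \<in> ?T"
      using S[OF t] scaled_exp_Hinf[OF t] unfolding derivative_family_def by blast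
  qed
  \<comment> \<open>Only positive times are covered by the calculus.\<close>
  have pos_bound: "(\<Sum>n<N. cmod (blinfun_apply (y n) (blinfun_apply (exp (\<omega> * t n) *\<^sub>R T (t n)) (x n))))
      \<le> exp 1 * C0 * gauss_norm M \<gamma> N x * gauss_norm M \<gamma> N y"
    if t: "\<forall>n<N. t n > 0" and y: "\<forall>n<N. y n \<in> dual" for N t x and y :: "nat \<Rightarrow> 'a \<Rightarrow>\<^sub>L complex"
  proof -
    let ?W = "\<lambda>n. (\<omega> - (\<omega> - 1 / t n)) ^ 1 *\<^sub>R S (t n)"
    have "(\<Sum>n<N. cmod (blinfun_apply (y n) (blinfun_apply (exp (\<omega> * t n) *\<^sub>R T (t n)) (x n))))
        = (\<Sum>n<N. exp 1 * cmod (blinfun_apply (y n) (blinfun_apply (?W n) (x n))))"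
    proof (intro sum.cong refl)
      fix n assume "n \<in> {..<N}"
      then have "t n > 0" using t by simp
      then show "cmod (blinfun_apply (y n) (blinfun_apply (exp (\<omega> * t n) *\<^sub>R T (t n)) (x n)))
          = exp 1 * cmod (blinfun_apply (y n) (blinfun_apply (?W n) (x n)))"
        by (simp only: member(1) blinfun.scaleR_left[of "- exp 1"] blinfun.scaleR_right[of _ "- exp 1"] norm_scaleR) simp
    qed
    also have "\<dots> = exp 1 * (\<Sum>n<N. cmod (blinfun_apply (y n) (blinfun_apply (?W n) (x n))))"
      by (simp only: sum_distrib_left)
    also have "\<dots> \<le> exp 1 * (C0 * gauss_norm M \<gamma> N x * gauss_norm M \<gamma> N y)"
      using member(2) t y by (intro mult_left_mono C0) auto
    finally show ?thesis by (simp only: mult.assoc)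
  qed
  have "of_Wgamma_type M \<gamma> \<omega> T"
    unfolding of_Wgamma_type_def Wgamma_bounded_def
  proof (intro exI[of _ "exp 1 * C0"] allI impI)
    fix N :: nat and V and x :: "nat \<Rightarrow> 'a" and y :: "nat \<Rightarrow> 'a \<Rightarrow>\<^sub>L complex"
    assume asm: "(\<forall>n<N. V n \<in> {exp (\<omega> * t) *\<^sub>R T t |t. 0 \<le> t}) \<and> (\<forall>n<N. y n \<in> dual)"
    then have "\<forall>n<N. \<exists>t\<ge>0. V n = exp (\<omega> * t) *\<^sub>R T t" by blast
    then obtain t where t: "\<And>n. n < N \<Longrightarrow> t n \<ge> 0" "\<And>n. n < N \<Longrightarrow> V n = exp (\<omega> * t n) *\<^sub>R T (t n)" by metis
    have lim: "((\<lambda>h. \<Sum>n<N. cmod (blinfun_apply (y n) (blinfun_apply (exp (\<omega> * (t n + h)) *\<^sub>R T (t n + h)) (x n))))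
        \<longlongrightarrow> (\<Sum>n<N. cmod (blinfun_apply (y n) (blinfun_apply (V n) (x n))))) (at_right 0)"
    proof (rule tendsto_sum, rule tendsto_norm, rule blinfun.tendsto[OF tendsto_const])
      fix n assume "n \<in> {..<N}"
      then have n: "n < N" by simp
      have "((\<lambda>h. exp (\<omega> * (t n + h)) *\<^sub>R T (t n) (T h (x n))) \<longlongrightarrow> exp (\<omega> * (t n + 0)) *\<^sub>R T (t n) (x n)) (at_right 0)"
        by (intro tendsto_intros blinfun.tendsto T.T_tendsto_at_zero)
      moreover have "\<forall>\<^sub>F h in at_right 0. exp (\<omega> * (t n + h)) *\<^sub>R T (t n) (T h (x n))
          = blinfun_apply (exp (\<omega> * (t n + h)) *\<^sub>R T (t n + h)) (x n)"
      proof -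
        have "\<forall>\<^sub>F h in at_right 0. 0 < (h::real)" by (rule eventually_at_right_less)
        then show ?thesis
          by eventually_elim (simp add: T.T_semigroup[OF t(1)[OF n]] blinfun.scaleR_left)
      qed
      ultimately have "((\<lambda>h. blinfun_apply (exp (\<omega> * (t n + h)) *\<^sub>R T (t n + h)) (x n))
          \<longlongrightarrow> exp (\<omega> * (t n + 0)) *\<^sub>R T (t n) (x n)) (at_right 0)" by (rule Lim_transform_eventually)
      then show "((\<lambda>h. blinfun_apply (exp (\<omega> * (t n + h)) *\<^sub>R T (t n + h)) (x n)) \<longlongrightarrow> blinfun_apply (V n) (x n)) (at_right 0)"
        by (simp add: t(2)[OF n] blinfun.scaleR_left)
    qed
    show "(\<Sum>n<N. cmod (blinfun_apply (y n) (blinfun_apply (V n) (x n))))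
        \<le> exp 1 * C0 * gauss_norm M \<gamma> N x * gauss_norm M \<gamma> N y"
    proof (rule tendsto_upperbound[OF lim])
      have "\<forall>\<^sub>F h in at_right 0. 0 < (h::real)" by (rule eventually_at_right_less)
      then show "\<forall>\<^sub>F h in at_right 0. (\<Sum>n<N. cmod (blinfun_apply (y n) (blinfun_apply (exp (\<omega> * (t n + h)) *\<^sub>R T (t n + h)) (x n))))
          \<le> exp 1 * C0 * gauss_norm M \<gamma> N x * gauss_norm M \<gamma> N y"
        by eventually_elim (rule pos_bound, use asm t(1) in \<open>auto intro: add_nonneg_pos\<close>)
    qed simp
  qed
  then show ?thesis using T.C0_semigroup_T T.generator_T by blast
qed

lemma Wgamma_GFS_iff_1:
  assumes "m \<ge> 1"
  shows "Wgamma_GFS M \<gamma> m \<omega> A \<longleftrightarrow> Wgamma_GFS M \<gamma> 1 \<omega> A"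
  using assms
proof (induction m rule: dec_induct)
  case (step n)
  have "Wgamma_GFS M \<gamma> (Suc n) \<omega> A \<longleftrightarrow> Wgamma_GFS M \<gamma> n \<omega> A"
    using Wgamma_GFS_Suc_imp strong_imp_Wgamma_GFS_Suc Wgamma_GFS_imp_strong step.hyps(1) by blast
  then show ?case using step.IH by simp
qed simp

lemma Wgamma_GFS_iff_strong:
  assumes "m \<ge> 1"
  shows "Wgamma_GFS M \<gamma> m \<omega> A \<longleftrightarrow> strong_Wgamma_bounded_calculus M \<gamma> m \<omega> A"
  using Wgamma_GFS_imp_strong strong_imp_Wgamma_GFS_Suc Wgamma_GFS_Suc_imp assms by blast

end

theorem theorem3p8:
  fixes A :: "('a::complex_banach \<times> 'a) set"
    and \<omega> :: real
    and m :: nat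
    and M :: "'s measure"
    and \<gamma> :: "nat \<Rightarrow> 's \<Rightarrow> complex"
  assumes "complex_gaussian_sequence M \<gamma>"
    and "half_plane_type \<omega> A"
    and "m \<ge> 1"
  shows "(Wgamma_GFS M \<gamma> m \<omega> A \<longleftrightarrow> strong_Wgamma_bounded_calculus M \<gamma> 1 \<omega> A) \<and>
    (strong_Wgamma_bounded_calculus M \<gamma> 1 \<omega> A \<longleftrightarrow>
      strong_Wgamma_bounded_calculus M \<gamma> m \<omega> A) \<and>
    (Wgamma_GFS M \<gamma> m \<omega> A \<longrightarrow>
      (\<exists>T. C0_semigroup T \<and> generator T = neg_op A \<and> of_Wgamma_type M \<gamma> \<omega> T))"
proof -
  interpret half_plane_operator A \<omega> by standard (rule assms(2))
  have "Wgamma_GFS M \<gamma> m \<omega> A \<longleftrightarrow> strong_Wgamma_bounded_calculus M \<gamma> 1 \<omega> A"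
    by (rule trans[OF Wgamma_GFS_iff_1[OF assms(3)] Wgamma_GFS_iff_strong[OF order.refl]])
  moreover have "Wgamma_GFS M \<gamma> m \<omega> A \<longleftrightarrow> strong_Wgamma_bounded_calculus M \<gamma> m \<omega> A"
    by (rule Wgamma_GFS_iff_strong[OF assms(3)])
  ultimately show ?thesis using strong_calculus_semigroup by blast
qed

end
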